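(* Let $X$ be a Cantor space and let $K\subseteq \mathrm{Prob}(X)$ be a divisible dynamical simplex on $X$. Then there exists a homeomorphism $\varphi$ of $X$ which is isomorphic (topologically conjugate) to a Toeplitz subshift on the alphabet $\{0,1\}$ and is such that $$K=\{\mu\in \mathrm{Prob}(X) : \varphi_*\mu=\mu\}.$$
   Context: A Cantor space is a nonempty compact metrizable zero-dimensional space without isolated points. $\mathrm{Prob}(X)$ is the space of Borel probability measures on $X$, with the compact topology induced by the maps $\mu\mapsto\mu(U)$, $U$ clopen in $X$. A set $K\subseteq\mathrm{Prob}(X)$ is a dynamical simplex if: (1) $K$ is nonempty, compact and convex; (2) every element of $K$ is atomless and has full support; (3) (Glasner--Weiss property) for all clopen $U,V\subseteq X$ such that $\mu(U)<\mu(V)$ for all $\mu\in K$, there is a clopen $W\subseteq V$ with $\mu(W)=\mu(U)$ for all $\mu\in K$. A set $K\subseteq \mathrm{Prob}(X)$ is divisible if for every clopen $U\subseteq X$ and every integer $n\ge 1$ there is a clopen $V\subseteq U$ with $\mu(V)=\frac1n\mu(U)$ for all $\mu\in K$. For a finite alphabet $A$, the shift $S\colon A^{\mathbb Z}\to A^{\mathbb Z}$ is $S(x)(n)=x(n+1)$. A sequence $x\in A^{\mathbb Z}$ is quasiperiodic if for all $m\in\mathbb Z$ there is $p\neq 0$ such that $x(m)=x(m+np)$ for all $n\in\mathbb Z$; it is Toeplitz if it is quasiperiodic but not periodic. The Toeplitz subshift associated to a Toeplitz sequence $x$ is the closure in $A^{\mathbb Z}$ of the orbit of $x$ under the shift,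 equipped with the restriction of $S$. A homeomorphism $\varphi$ of $X$ is isomorphic to a subshift $F\subseteq A^{\mathbb Z}$ if there is a homeomorphism $h\colon X\to F$ with $h\circ\varphi=S|_F\circ h$. *)

theory Defs
  imports "HOL-Probability.Probability"
begin

definition cantor_space :: "'a topology \<Rightarrow> bool" where
  "cantor_space X \<longleftrightarrow>
     topspace X \<noteq> {} \<and> compact_space X \<and> metrizable_space X \<and> X dim_le 0 \<and>
     (\<forall>x\<in>topspace X. \<not> openin X {x})"

definition clopenin :: "'a topology \<Rightarrow> 'a set \<Rightarrow> bool" where
  "clopenin X U \<longleftrightarrow> openin X U \<and> closedin X U"

subsection \<open>Borel probability measures\<close>

(* As a measure, this carries the zero measure; only its space and its sigma-algebra are used. *)
definition borel_of :: "'a topology \<Rightarrow> 'a measure" where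
  "borel_of X = sigma (topspace X) {U. openin X U}"

definition Prob :: "'a topology \<Rightarrow> 'a measure set" where
  "Prob X = {\<mu>. sets \<mu> = sets (borel_of X) \<and> prob_space \<mu>}"

(* The coarsest topology on Prob X making all evaluations at clopen sets continuous. *)
definition Prob_topology :: "'a topology \<Rightarrow> 'a measure topology" where
  "Prob_topology X =
     topology_generated_by {{\<mu> \<in> Prob X. measure \<mu> U \<in> I} | U I. clopenin X U \<and> open (I :: real set)}"

(* Measures do not form a vector space type, so convex combinations are taken setwise;
   the measure \<rho> below is determined by its values on the Borel sets. *)
definition convex_measures :: "'a topology \<Rightarrow> 'a measure set \<Rightarrow> bool" where
  "convex_measures X K \<longleftrightarrow>
     (\<forall>\<mu>\<in>K. \<forall>\<nu>\<in>K. \<forall>t\<in>{0..1}. \<exists>\<rho>\<in>K. \<forall>B\<in>sets (borel_of X).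
        measure \<rho> B = t * measure \<mu> B + (1 - t) * measure \<nu> B)"

definition atom :: "'a measure \<Rightarrow> 'a set \<Rightarrow> bool" where
  "atom \<mu> A \<longleftrightarrow> A \<in> sets \<mu> \<and> measure \<mu> A > 0 \<and>
     (\<forall>B\<in>sets \<mu>. B \<subseteq> A \<longrightarrow> measure \<mu> B = 0 \<or> measure \<mu> B = measure \<mu> A)"

definition atomless :: "'a measure \<Rightarrow> bool" where
  "atomless \<mu> \<longleftrightarrow> (\<nexists>A. atom \<mu> A)"

definition full_support :: "'a topology \<Rightarrow> 'a measure \<Rightarrow> bool" where
  "full_support X \<mu> \<longleftrightarrow> (\<forall>U. openin X U \<and> U \<noteq> {} \<longrightarrow> measure \<mu> U > 0)"

definition glasner_weiss :: "'a topology \<Rightarrow> 'a measure set \<Rightarrow> bool" where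
  "glasner_weiss X K \<longleftrightarrow>
     (\<forall>U V. clopenin X U \<and> clopenin X V \<and> (\<forall>\<mu>\<in>K. measure \<mu> U < measure \<mu> V) \<longrightarrow>
        (\<exists>W. clopenin X W \<and> W \<subseteq> V \<and> (\<forall>\<mu>\<in>K. measure \<mu> W = measure \<mu> U)))"

definition dynamical_simplex :: "'a topology \<Rightarrow> 'a measure set \<Rightarrow> bool" where
  "dynamical_simplex X K \<longleftrightarrow>
     K \<subseteq> Prob X \<and>
     K \<noteq> {} \<and> compactin (Prob_topology X) K \<and> convex_measures X K \<and>
     (\<forall>\<mu>\<in>K. atomless \<mu> \<and> full_support X \<mu>) \<and>
     glasner_weiss X K"

definition divisible :: "'a topology \<Rightarrow> 'a measure set \<Rightarrow> bool" where
  "divisible X K \<longleftrightarrow>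
     (\<forall>U n. clopenin X U \<and> n \<ge> (1::nat) \<longrightarrow>
        (\<exists>V. clopenin X V \<and> V \<subseteq> U \<and> (\<forall>\<mu>\<in>K. measure \<mu> V = 1 / real n * measure \<mu> U)))"

definition invariant_measures :: "'a topology \<Rightarrow> ('a \<Rightarrow> 'a) \<Rightarrow> 'a measure set" where
  "invariant_measures X \<phi> = {\<mu> \<in> Prob X. distr \<mu> (borel_of X) \<phi> = \<mu>}"

subsection \<open>Toeplitz subshifts\<close>

definition full_shift :: "'b set \<Rightarrow> (int \<Rightarrow> 'b) topology" where
  "full_shift A = product_topology (\<lambda>_. discrete_topology A) UNIV"

definition shift :: "(int \<Rightarrow> 'b) \<Rightarrow> int \<Rightarrow> 'b" where
  "shift x = (\<lambda>n. x (n + 1))"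

(* The two-sided orbit: the members are the images of x under all integer powers of the shift. *)
definition shift_orbit :: "(int \<Rightarrow> 'b) \<Rightarrow> (int \<Rightarrow> 'b) set" where
  "shift_orbit x = {(\<lambda>n. x (n + k)) | k. True}"

definition quasiperiodic :: "(int \<Rightarrow> 'b) \<Rightarrow> bool" where
  "quasiperiodic x \<longleftrightarrow> (\<forall>m. \<exists>p. p \<noteq> 0 \<and> (\<forall>n. x m = x (m + n * p)))"

definition periodic :: "(int \<Rightarrow> 'b) \<Rightarrow> bool" where
  "periodic x \<longleftrightarrow> (\<exists>p. p \<noteq> 0 \<and> (\<forall>m. x (m + p) = x m))"

definition toeplitz :: "'b set \<Rightarrow> (int \<Rightarrow> 'b) \<Rightarrow> bool" where
  "toeplitz A x \<longleftrightarrow> x \<in> topspace (full_shift A) \<and> quasiperiodic x \<and> \<not> periodic x"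

definition toeplitz_subshift :: "'b set \<Rightarrow> (int \<Rightarrow> 'b) \<Rightarrow> (int \<Rightarrow> 'b) set" where
  "toeplitz_subshift A x = full_shift A closure_of shift_orbit x"

definition isomorphic_to_subshift ::
  "'a topology \<Rightarrow> ('a \<Rightarrow> 'a) \<Rightarrow> 'b set \<Rightarrow> (int \<Rightarrow> 'b) set \<Rightarrow> bool" where
  "isomorphic_to_subshift X \<phi> A F \<longleftrightarrow>
     (\<exists>h. homeomorphic_map X (subtopology (full_shift A) F) h \<and>
          (\<forall>x\<in>topspace X. h (\<phi> x) = shift (h x)))"

end

theory Submission
  imports Defs
begin

text \<open>The homeomorphism is built from a refining sequence of clopen partitions of \<open>X\<close> into
  finitely many towers of a common height \<open>p\<^sub>n\<close>, all levels of a tower having the same measure for every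
  \<open>\<mu> \<in> K\<close>. A point is moved to the next level of its tower. Every tower of stage \<open>n + 1\<close> is a
  concatenation of towers of stage \<open>n\<close>; all these concatenations begin with tower 0 and end with
  tower 1, so that the map is defined everywhere in the limit, and they begin with a recognizable
  pattern, so that the coding of orbits by the partition of stage 0 is injective. As all towers have
  equal height, the intersection of the bases of tower 0 is a point with a Toeplitz coding.

  All measures in \<open>K\<close> are invariant by construction. For the converse, enumerate the pairs \<open>(U, V)\<close> of
  clopen sets and arrange that, if \<open>\<mu>(U) = \<mu>(V)\<close> for all \<open>\<mu> \<in> K\<close>, then every tower of some stage has as
  many levels in \<open>U\<close> as in \<open>V\<close>; every invariant measure then takes the same value on \<open>U\<close> and \<open>V\<close>. If such
  a measure \<open>\<nu>\<close> were not in the compact convex set \<open>K\<close>, it could be separated from \<open>K\<close> by an integer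
  combination of clopen sets. By divisibility this combination is realized by a clopen set, and the
  Glasner-Weiss property gives a contradiction.

  The equal counts come from divisibility: a linear relation \<open>\<Sum> d\<^sub>j \<mu>(b\<^sub>j) = 0\<close> between the measures of
  the tower bases is resolved by splitting the vector of the \<open>b\<^sub>j\<close> into multiples of integer vectors in
  the kernel of \<open>d\<close>, and these vectors are the letter counts of the new towers.\<close>

section \<open>Clopen sets under the Glasner-Weiss and divisibility conditions\<close>

text \<open>The hard point is that an invariant measure \<nu> outside \<open>K\<close> need not
  satisfy the linear relations that hold on \<open>K\<close>. So \<mu>(U) = \<mu>(V) on
  \<open>K\<close> has to become an equality of counts inside every single tower, which binds any
  invariant measure. The vector of base measures varies with \<mu>, but always lies in the cone of
  nonnegative kernel vectors of the integer relation \<open>d\<close>. That cone has finitely many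
  rational rays, each with at most two nonzero entries; \<mu> enters only through the weights, and
  the Glasner-Weiss property realizes these by clopen sets, as a transport between the positive and
  the negative coefficients of \<open>d\<close>. The common height is a requirement and a tool: it
  makes the total base measure the constant 1/p, which lets a constant part be redistributed. Each
  step restores it by repeating letter counts and dividing bases accordingly. No map is carried
  along: the levels of a tower only have equal measures, so each level may be cut independently, and
  the map emerges in the limit.\<close>

locale fin_additive =
  fixes S :: "'a set" and C :: "'a set set" and K :: "'k set" and m :: "'k \<Rightarrow> 'a set \<Rightarrow> real"
  assumes alg: "algebra S C"
    and add: "\<And>k U V. k \<in> K \<Longrightarrow> U \<in> C \<Longrightarrow> V \<in> C \<Longrightarrow> U \<inter> V = {} \<Longrightarrow> m k (U \<union> V) = m k U + m k V"
    and total: "\<And>k. k \<in> K \<Longrightarrow> m k S = 1"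
    and nonneg: "\<And>k U. k \<in> K \<Longrightarrow> U \<in> C \<Longrightarrow> 0 \<le> m k U"
begin

lemma C_Un [intro]: "U \<in> C \<Longrightarrow> V \<in> C \<Longrightarrow> U \<union> V \<in> C"
  and C_Int [intro]: "U \<in> C \<Longrightarrow> V \<in> C \<Longrightarrow> U \<inter> V \<in> C"
  and C_Diff [intro]: "U \<in> C \<Longrightarrow> V \<in> C \<Longrightarrow> U - V \<in> C"
  and C_empty [simp, intro]: "{} \<in> C"
  and C_top [simp, intro]: "S \<in> C"
  and C_sub: "U \<in> C \<Longrightarrow> U \<subseteq> S"
proof -
  interpret algebra S C by (rule alg)
  show "U \<in> C \<Longrightarrow> V \<in> C \<Longrightarrow> U \<union> V \<in> C" "U \<in> C \<Longrightarrow> V \<in> C \<Longrightarrow> U \<inter> V \<in> C"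
    "U \<in> C \<Longrightarrow> V \<in> C \<Longrightarrow> U - V \<in> C" "{} \<in> C" "S \<in> C" "U \<in> C \<Longrightarrow> U \<subseteq> S"
    using sets_into_space by auto
qed

lemma C_UN [intro]: "finite I \<Longrightarrow> (\<And>i. i \<in> I \<Longrightarrow> d i \<in> C) \<Longrightarrow> (\<Union>i\<in>I. d i) \<in> C"
  by (induction I rule: finite_induct) auto

lemma m_empty [simp]: "k \<in> K \<Longrightarrow> m k {} = 0"
  using add[of k "{}" "{}"] by auto

lemma m_diff: "k \<in> K \<Longrightarrow> U \<in> C \<Longrightarrow> V \<in> C \<Longrightarrow> V \<subseteq> U \<Longrightarrow> m k (U - V) = m k U - m k V"
  using add[of k V "U - V"] C_Diff[of U V] by (simp add: Un_absorb1)

lemma m_mono: "k \<in> K \<Longrightarrow> U \<in> C \<Longrightarrow> V \<in> C \<Longrightarrow> V \<subseteq> U \<Longrightarrow> m k V \<le> m k U"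
  using m_diff[of k U V] nonneg[of k "U - V"] by auto

lemma m_le_1: "k \<in> K \<Longrightarrow> U \<in> C \<Longrightarrow> m k U \<le> 1"
  using m_mono[of k S U] total[of k] C_sub[of U] by simp

lemma m_UN:
  assumes "k \<in> K" "finite I" "\<And>i. i \<in> I \<Longrightarrow> d i \<in> C" "disjoint_family_on d I"
  shows "m k (\<Union>i\<in>I. d i) = (\<Sum>i\<in>I. m k (d i))"
  using assms(2-4)
proof (induction I rule: finite_induct)
  case empty
  then show ?case using assms(1) by simp
next
  case (insert x F)
  have "d x \<inter> (\<Union>i\<in>F. d i) = {}"
    using insert.prems(2) insert.hyps(2) by (auto simp: disjoint_family_on_def)
  moreover have "disjoint_family_on d F"
    using insert.prems(2) by (auto simp: disjoint_family_on_def)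
  moreover have "(\<Union>i\<in>F. d i) \<in> C" using insert by auto
  ultimately show ?case using insert add[OF assms(1), of "d x" "\<Union>i\<in>F. d i"] by auto
qed

text \<open>Kakutani-Rokhlin partitions of constant height \<open>p\<close>, with tower index set
  \<open>I\<close>. No map between the levels is recorded, only the equality of their measures, and
  empty levels are allowed.\<close>

definition kr :: "'i set \<Rightarrow> nat \<Rightarrow> ('i \<Rightarrow> nat \<Rightarrow> 'a set) \<Rightarrow> bool" where
  "kr I p b \<longleftrightarrow> finite I \<and> p > 0 \<and> (\<forall>t\<in>I. \<forall>i<p. b t i \<in> C) \<and>
     disjoint_family_on (\<lambda>(t, i). b t i) (I \<times> {..<p}) \<and>
     (\<Union>t\<in>I. \<Union>i<p. b t i) = S \<and>
     (\<forall>t\<in>I. \<forall>i<p. \<forall>k\<in>K. m k (b t 0) = m k (b t i))"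

lemma kr_unique:
  assumes "kr I p b" "t \<in> I" "t' \<in> I" "i < p" "i' < p" "x \<in> b t i" "x \<in> b t' i'"
  shows "t = t' \<and> i = i'"
proof -
  have "disjoint_family_on (\<lambda>(t, i). b t i) (I \<times> {..<p})" using assms(1) by (simp add: kr_def)
  from disjoint_family_onD[OF this, of "(t, i)" "(t', i')"] show ?thesis using assms by auto
qed

lemma kr_sum:
  assumes "kr I p b" "k \<in> K"
  shows "(\<Sum>t\<in>I. m k (b t 0)) = 1 / p"
proof -
  have "1 = m k (\<Union>x\<in>I\<times>{..<p}. case x of (t, i) \<Rightarrow> b t i)"
  proof -
    have "(\<Union>x\<in>I\<times>{..<p}. case x of (t, i) \<Rightarrow> b t i) = (\<Union>t\<in>I. \<Union>i<p. b t i)"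
      by blast
    also have "\<dots> = S" using assms(1) by (simp only: kr_def)
    finally have "(\<Union>x\<in>I\<times>{..<p}. case x of (t, i) \<Rightarrow> b t i) = S" .
    then show ?thesis using total[OF assms(2)] by simp
  qed
  also have "\<dots> = (\<Sum>x\<in>I\<times>{..<p}. m k (case x of (t, i) \<Rightarrow> b t i))"
    by (rule m_UN) (use assms(1,2) in \<open>auto simp: kr_def\<close>)
  also have "\<dots> = (\<Sum>t\<in>I. \<Sum>i<p. m k (b t i))"
    by (simp add: sum.cartesian_product case_prod_unfold)
  also have "\<dots> = (\<Sum>t\<in>I. \<Sum>i<p. m k (b t 0))"
    by (intro sum.cong refl) (use assms in \<open>simp add: kr_def\<close>)
  also have "\<dots> = p * (\<Sum>t\<in>I. m k (b t 0))"
    by (simp add: sum_distrib_left)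
  finally show ?thesis using assms by (auto simp: kr_def field_simps)
qed

text \<open>Turns a decided clopen set into a linear form in the base measures. Applied to
  \<open>K\<close> it gives the relation to be resolved; applied to a single invariant measure it
  draws the conclusion from equal counts.\<close>

lemma kr_count:
  assumes "kr I p b" "k \<in> K" "U \<in> C"
    and dec: "\<And>t i. t \<in> I \<Longrightarrow> i < p \<Longrightarrow> b t i \<subseteq> U \<or> b t i \<inter> U = {}"
  shows "m k U = (\<Sum>t\<in>I. real (card {i. i < p \<and> b t i \<subseteq> U}) * m k (b t 0))"
proof -
  let ?A = "SIGMA t:I. {i. i < p \<and> b t i \<subseteq> U}"
  have fin: "finite I" using assms(1) by (simp add: kr_def)
  have cov: "(\<Union>t\<in>I. \<Union>i<p. b t i) = S" using assms(1) by (simp add: kr_def)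
  have "U \<subseteq> (\<Union>x\<in>?A. case x of (t, i) \<Rightarrow> b t i)"
  proof
    fix x assume x: "x \<in> U"
    then have "x \<in> S" using C_sub assms(3) by auto
    then obtain t i where "t \<in> I" "i < p" "x \<in> b t i" using cov by blast
    then show "x \<in> (\<Union>x\<in>?A. case x of (t, i) \<Rightarrow> b t i)" using dec[of t i] x by auto
  qed
  moreover have "(\<Union>x\<in>?A. case x of (t, i) \<Rightarrow> b t i) \<subseteq> U" by blast
  ultimately have "m k U = m k (\<Union>x\<in>?A. case x of (t, i) \<Rightarrow> b t i)"
    by (rule arg_cong[where f = "m k", OF equalityI])
  also have "\<dots> = (\<Sum>x\<in>?A. m k (case x of (t, i) \<Rightarrow> b t i))"
  proof (rule m_UN)
    show "disjoint_family_on (\<lambda>(t, i). b t i) ?A"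
      using assms(1) unfolding kr_def by (elim conjE disjoint_family_on_mono[rotated]) auto
  next
    show "(case x of (t, i) \<Rightarrow> b t i) \<in> C" if "x \<in> ?A" for x
      using that assms(1) by (auto simp: kr_def)
  next
    show "finite ?A" using fin by auto
  qed (rule assms(2))
  also have "\<dots> = (\<Sum>t\<in>I. \<Sum>i | i < p \<and> b t i \<subseteq> U. m k (b t i))"
    by (subst sum.Sigma) (use fin in \<open>simp_all add: case_prod_unfold\<close>)
  also have "\<dots> = (\<Sum>t\<in>I. \<Sum>i | i < p \<and> b t i \<subseteq> U. m k (b t 0))"
    by (intro sum.cong refl) (use assms(1,2) in \<open>auto simp: kr_def\<close>)
  finally show ?thesis by simp
qed

end

text \<open>Separated from \<open>div_simplex\<close> because these two properties extend to
  \<open>K\<close> enlarged by a further measure (\<open>insert_div_algebra\<close>), for which no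
  uniform lower bound is established.\<close>

locale div_algebra = fin_additive +
  assumes gw: "\<And>U V. U \<in> C \<Longrightarrow> V \<in> C \<Longrightarrow> (\<And>k. k \<in> K \<Longrightarrow> m k U < m k V) \<Longrightarrow>
               \<exists>W\<in>C. W \<subseteq> V \<and> (\<forall>k\<in>K. m k W = m k U)"
    and dv: "\<And>U n. U \<in> C \<Longrightarrow> n \<ge> (1::nat) \<Longrightarrow>
               \<exists>V\<in>C. V \<subseteq> U \<and> (\<forall>k\<in>K. m k V = m k U / n)"
begin

text \<open>The pieces are placed in \<open>Y\<close> one after the other; the strict bound on the
  whole sum leaves strictly more room than the next piece needs, which is what \<open>gw\<close>
  asks for.\<close>

lemma realize_sum:
  assumes "finite I" "\<And>x. x \<in> I \<Longrightarrow> E x \<in> C" "Y \<in> C"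
    and "\<And>k. k \<in> K \<Longrightarrow> (\<Sum>x\<in>I. m k (E x)) < m k Y"
  shows "\<exists>V\<in>C. V \<subseteq> Y \<and> (\<forall>k\<in>K. m k V = (\<Sum>x\<in>I. m k (E x)))"
  using assms(1,2,4)
proof (induction I rule: finite_induct)
  case empty
  then show ?case by (auto intro!: bexI[of _ "{}"])
next
  case (insert x F)
  have lt: "(\<Sum>x\<in>F. m k (E x)) + m k (E x) < m k Y" if "k \<in> K" for k
    using insert.prems(2)[OF that] insert.hyps by simp
  have "\<exists>V\<in>C. V \<subseteq> Y \<and> (\<forall>k\<in>K. m k V = (\<Sum>x\<in>F. m k (E x)))"
  proof (rule insert.IH)
    fix k assume "k \<in> K"
    then show "(\<Sum>x\<in>F. m k (E x)) < m k Y"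
      using lt[of k] nonneg[of k "E x"] insert.prems(1) by fastforce
  qed (use insert.prems in auto)
  then obtain V where V: "V \<in> C" "V \<subseteq> Y" "\<And>k. k \<in> K \<Longrightarrow> m k V = (\<Sum>x\<in>F. m k (E x))" by auto
  have "\<exists>W\<in>C. W \<subseteq> Y - V \<and> (\<forall>k\<in>K. m k W = m k (E x))"
  proof (rule gw)
    fix k assume "k \<in> K"
    then show "m k (E x) < m k (Y - V)"
      using lt[of k] V m_diff[of k Y V] assms(3) by auto
  qed (use V assms(3) insert.prems in auto)
  then obtain W where W: "W \<in> C" "W \<subseteq> Y - V" "\<And>k. k \<in> K \<Longrightarrow> m k W = m k (E x)" by auto
  have "m k (V \<union> W) = (\<Sum>x\<in>insert x F. m k (E x))" if "k \<in> K" for k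
  proof -
    have "V \<inter> W = {}" using W(2) by blast
    then show ?thesis using add[OF that V(1) W(1)] V(3)[OF that] W(3)[OF that] insert.hyps by simp
  qed
  then show ?case using V W by (intro bexI[of _ "V \<union> W"]) auto
qed

end

locale div_simplex = div_algebra +
  assumes lower: "\<And>U. U \<in> C \<Longrightarrow> U \<noteq> {} \<Longrightarrow> \<exists>\<epsilon>>0. \<forall>k\<in>K. \<epsilon> \<le> m k U"
    and K_ne: "K \<noteq> {}"
begin

lemma pos: "k \<in> K \<Longrightarrow> U \<in> C \<Longrightarrow> U \<noteq> {} \<Longrightarrow> 0 < m k U"
  using lower[of U] by force

lemma pos_iff: "k \<in> K \<Longrightarrow> U \<in> C \<Longrightarrow> 0 < m k U \<longleftrightarrow> U \<noteq> {}"
  using pos[of k U] by auto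

lemma nonempty_cong:
  "U \<in> C \<Longrightarrow> V \<in> C \<Longrightarrow> (\<And>k. k \<in> K \<Longrightarrow> m k U = m k V) \<Longrightarrow> U = {} \<longleftrightarrow> V = {}"
  using K_ne pos_iff by (metis all_not_in_conv)

text \<open>With equality of the totals, the strictness that \<open>gw\<close> needs comes from the
  pieces still to be placed, which are nonempty and so have positive measure; the last piece takes
  whatever remains.\<close>

lemma partition_by_sum:
  assumes "finite I" "I \<noteq> {}" "\<And>x. x \<in> I \<Longrightarrow> E x \<in> C" "\<And>x. x \<in> I \<Longrightarrow> E x \<noteq> {}" "B \<in> C"
    and "\<And>k. k \<in> K \<Longrightarrow> (\<Sum>x\<in>I. m k (E x)) = m k B"
  shows "\<exists>d. (\<forall>x\<in>I. d x \<in> C \<and> (\<forall>k\<in>K. m k (d x) = m k (E x))) \<and>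
             disjoint_family_on d I \<and> (\<Union>x\<in>I. d x) = B"
  using assms
proof (induction I arbitrary: B rule: finite_ne_induct)
  case (singleton x)
  then show ?case by (intro exI[of _ "\<lambda>_. B"]) (auto simp: disjoint_family_on_def)
next
  case (insert x F)
  have s: "m k (E x) + (\<Sum>x\<in>F. m k (E x)) = m k B" if "k \<in> K" for k
    using insert.prems(4)[OF that] insert.hyps by simp
  have "\<exists>W\<in>C. W \<subseteq> B \<and> (\<forall>k\<in>K. m k W = m k (E x))"
  proof (rule gw)
    fix k assume k: "k \<in> K"
    have "0 < (\<Sum>x\<in>F. m k (E x))"
      by (rule sum_pos) (use insert pos k in auto)
    then show "m k (E x) < m k B" using s[OF k] by simp
  qed (use insert.prems in auto)
  then obtain W where W: "W \<in> C" "W \<subseteq> B" "\<And>k. k \<in> K \<Longrightarrow> m k W = m k (E x)" by auto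
  have "\<exists>d. (\<forall>x\<in>F. d x \<in> C \<and> (\<forall>k\<in>K. m k (d x) = m k (E x))) \<and>
             disjoint_family_on d F \<and> (\<Union>x\<in>F. d x) = B - W"
  proof (rule insert.IH)
    fix k assume "k \<in> K"
    then show "(\<Sum>x\<in>F. m k (E x)) = m k (B - W)"
      using s[of k] W m_diff[of k B W] insert.prems by auto
  qed (use insert.prems W in auto)
  then obtain d where d: "\<And>y. y \<in> F \<Longrightarrow> d y \<in> C" "\<And>y k. y \<in> F \<Longrightarrow> k \<in> K \<Longrightarrow> m k (d y) = m k (E y)"
    "disjoint_family_on d F" "(\<Union>x\<in>F. d x) = B - W" by auto
  have dis: "disjoint_family_on (d(x := W)) (insert x F)"
    using d(3,4) insert.hyps(3)
    by (simp add: disjoint_family_on_insert) (auto simp: disjoint_family_on_def)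
  have un: "(\<Union>y\<in>insert x F. (d(x := W)) y) = B"
    using d(4) W(2) insert.hyps(3) by (auto split: if_splits)
  show ?case
    by (intro exI[of _ "d(x := W)"] conjI dis un) (use d W in auto)
qed

text \<open>If \<open>Y\<close> is a proper subset, \<open>U - Y\<close> has positive measure and
  \<open>gw\<close> applies; otherwise \<open>V\<close> itself is the copy.\<close>

lemma copy_subset:
  assumes "U \<in> C" "V \<in> C" "\<And>k. k \<in> K \<Longrightarrow> m k U = m k V" "Y \<in> C" "Y \<subseteq> U"
  shows "\<exists>Z\<in>C. Z \<subseteq> V \<and> (\<forall>k\<in>K. m k Z = m k Y)"
proof (cases "Y = U")
  case True
  then show ?thesis using assms by (intro bexI[of _ V]) auto
next
  case False
  show ?thesis
  proof (rule gw)
    fix k assume k: "k \<in> K"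
    have "0 < m k (U - Y)" by (rule pos) (use assms False k in auto)
    then show "m k Y < m k V" using m_diff[of k U Y] assms k by auto
  qed (use assms in auto)
qed

lemma realize_fraction:
  assumes "U \<in> C" "a < (n::nat)"
  shows "\<exists>V\<in>C. V \<subseteq> U \<and> (\<forall>k\<in>K. m k V = a / n * m k U)"
proof (cases "U = {}")
  case True
  then show ?thesis by (intro bexI[of _ "{}"]) auto
next
  case False
  obtain V where V: "V \<in> C" "V \<subseteq> U" "\<And>k. k \<in> K \<Longrightarrow> m k V = m k U / n"
    using dv[OF assms(1), of n] assms(2) by auto
  have "\<exists>W\<in>C. W \<subseteq> U \<and> (\<forall>k\<in>K. m k W = (\<Sum>x\<in>{..<a}. m k V))"
  proof (rule realize_sum)
    fix k assume k: "k \<in> K"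
    then show "(\<Sum>x\<in>{..<a}. m k V) < m k U"
      using assms(2) pos[OF k assms(1) False] by (simp add: V field_simps)
  qed (use V assms in auto)
  then show ?thesis by (auto simp: V)
qed

text \<open>Induction on the number \<open>i\<close> of levels already decided by \<open>U\<close>.
  The index \<open>A\<close> records the levels at which the part inside \<open>U\<close> was
  chosen; each step cuts level \<open>i\<close> along \<open>U\<close> and copies the cut in measure
  to all other levels, so that the pieces are towers again.\<close>

lemma split_tower:
  fixes c :: "nat \<Rightarrow> 'a set"
  assumes "\<And>l. l < p \<Longrightarrow> c l \<in> C" "\<And>l k. l < p \<Longrightarrow> k \<in> K \<Longrightarrow> m k (c 0) = m k (c l)" "U \<in> C"
    "i \<le> p"
  shows "\<exists>d. (\<forall>A\<in>Pow {..<i}. \<forall>l<p. d A l \<in> C \<and> (\<forall>k\<in>K. m k (d A 0) = m k (d A l)) \<and>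
               (l < i \<longrightarrow> d A l \<subseteq> U \<or> d A l \<inter> U = {})) \<and>
            (\<forall>l<p. disjoint_family_on (\<lambda>A. d A l) (Pow {..<i}) \<and> (\<Union>A\<in>Pow {..<i}. d A l) = c l)"
  using assms(4)
proof (induction i)
  case 0
  show ?case by (rule exI[of _ "\<lambda>A. c"]) (use assms in \<open>auto simp: disjoint_family_on_def\<close>)
next
  case (Suc i)
  then have ip: "i < p" by simp
  from Suc obtain d where d0: "\<And>A l. A \<subseteq> {..<i} \<Longrightarrow> l < p \<Longrightarrow> d A l \<in> C \<and>
      (\<forall>k\<in>K. m k (d A 0) = m k (d A l)) \<and> (l < i \<longrightarrow> d A l \<subseteq> U \<or> d A l \<inter> U = {})"
    "\<And>l. l < p \<Longrightarrow> disjoint_family_on (\<lambda>A. d A l) (Pow {..<i}) \<and> (\<Union>A\<in>Pow {..<i}. d A l) = c l"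
    by (force simp: Ball_def)
  have d: "\<And>A l. A \<subseteq> {..<i} \<Longrightarrow> l < p \<Longrightarrow> d A l \<in> C"
    "\<And>A l k. A \<subseteq> {..<i} \<Longrightarrow> l < p \<Longrightarrow> k \<in> K \<Longrightarrow> m k (d A 0) = m k (d A l)"
    "\<And>A l. A \<subseteq> {..<i} \<Longrightarrow> l < i \<Longrightarrow> d A l \<subseteq> U \<or> d A l \<inter> U = {}"
    "\<And>l. l < p \<Longrightarrow> disjoint_family_on (\<lambda>A. d A l) (Pow {..<i})"
    "\<And>l. l < p \<Longrightarrow> (\<Union>A\<in>Pow {..<i}. d A l) = c l"
    using d0 ip by (blast, blast, metis order.strict_trans, blast, blast)
  \<comment> \<open>Level \<open>i\<close> has to be cut exactly along \<open>U\<close>; on the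
    other levels any subset of the same measure serves.\<close>
  have "\<exists>Z. Z \<in> C \<and> Z \<subseteq> d A l \<and> (\<forall>k\<in>K. m k Z = m k (d A i \<inter> U)) \<and> (l = i \<longrightarrow> Z = d A i \<inter> U)"
    if "A \<subseteq> {..<i}" "l < p" for A l
  proof (cases "l = i")
    case True
    then show ?thesis using d(1)[OF that] assms(3) by (intro exI[of _ "d A i \<inter> U"]) auto
  next
    case False
    have "\<exists>Z\<in>C. Z \<subseteq> d A l \<and> (\<forall>k\<in>K. m k Z = m k (d A i \<inter> U))"
    proof (rule copy_subset[of "d A i"])
      show "m k (d A i) = m k (d A l)" if "k \<in> K" for k
        using d(2)[OF _ _ that, of A] \<open>A \<subseteq> {..<i}\<close> \<open>l < p\<close> ip by metis
    qed (use d(1) that ip assms(3) in auto)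
    then show ?thesis using False by auto
  qed
  note ex = this
  define f where "f A l = (SOME Z. Z \<in> C \<and> Z \<subseteq> d A l \<and> (\<forall>k\<in>K. m k Z = m k (d A i \<inter> U)) \<and> (l = i \<longrightarrow> Z = d A i \<inter> U))" for A l
  have f0: "f A l \<in> C \<and> f A l \<subseteq> d A l \<and> (\<forall>k\<in>K. m k (f A l) = m k (d A i \<inter> U)) \<and> (l = i \<longrightarrow> f A l = d A i \<inter> U)" if "A \<subseteq> {..<i}" "l < p" for A l
    unfolding f_def by (rule someI_ex[OF ex[OF that]])
  have f: "\<And>A l. A \<subseteq> {..<i} \<Longrightarrow> l < p \<Longrightarrow> f A l \<in> C"
    "\<And>A l. A \<subseteq> {..<i} \<Longrightarrow> l < p \<Longrightarrow> f A l \<subseteq> d A l"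
    "\<And>A l k. A \<subseteq> {..<i} \<Longrightarrow> l < p \<Longrightarrow> k \<in> K \<Longrightarrow> m k (f A l) = m k (d A i \<inter> U)"
    "\<And>A. A \<subseteq> {..<i} \<Longrightarrow> f A i = d A i \<inter> U"
    using f0 ip by blast+
  define d' where "d' A l = (if i \<in> A then f (A - {i}) l else d A l - f A l)" for A l
  have sub: "A - {i} \<subseteq> {..<i}" if "A \<subseteq> {..<Suc i}" for A using that by (auto simp: less_Suc_eq)
  have sub': "A \<subseteq> {..<i}" if "A \<subseteq> {..<Suc i}" "i \<notin> A" for A using that by (auto simp: less_Suc_eq)
  have le: "d' A l \<subseteq> d (A - {i}) l" if "A \<subseteq> {..<Suc i}" "l < p" for A l
    using f(2)[OF sub[OF that(1)] that(2)] by (auto simp: d'_def)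
  show ?case
  proof (rule exI[of _ d'], intro conjI ballI allI impI)
    fix A l assume "A \<in> Pow {..<Suc i}" and l: "l < p"
    then have A: "A \<subseteq> {..<Suc i}" by auto
    show "d' A l \<in> C"
      using f(1)[OF sub[OF A] l] f(1)[OF sub'[OF A] l] d(1)[OF sub'[OF A] l] by (auto simp: d'_def)
    fix k assume k: "k \<in> K"
    have p0: "0 < p" using ip by simp
    show "m k (d' A 0) = m k (d' A l)"
    proof (cases "i \<in> A")
      case True
      then show ?thesis using f(3)[OF sub[OF A] l k] f(3)[OF sub[OF A] p0 k] by (simp add: d'_def)
    next
      case False
      note A' = sub'[OF A False]
      have "m k (d A l - f A l) = m k (d A l) - m k (f A l)" "m k (d A 0 - f A 0) = m k (d A 0) - m k (f A 0)"
        by (rule m_diff; use k f(1,2) d(1) A' l p0 in auto)+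
      then show ?thesis using False f(3)[OF A' l k] f(3)[OF A' p0 k] d(2)[OF A' l k]
        by (simp add: d'_def)
    qed
  next
    fix A l assume "A \<in> Pow {..<Suc i}" and l: "l < p" and li: "l < Suc i"
    then have A: "A \<subseteq> {..<Suc i}" by auto
    show "d' A l \<subseteq> U \<or> d' A l \<inter> U = {}"
    proof (cases "l = i")
      case True
      then show ?thesis using f(4)[OF sub[OF A]] f(4)[OF sub'[OF A]] by (auto simp: d'_def)
    next
      case False
      then show ?thesis using le[OF A l] d(3)[OF sub[OF A], of l] li by fastforce
    qed
  next
    fix l assume l: "l < p"
    show "disjoint_family_on (\<lambda>A. d' A l) (Pow {..<Suc i})"
      unfolding disjoint_family_on_def
    proof (intro ballI impI)
      fix A B assume "A \<in> Pow {..<Suc i}" "B \<in> Pow {..<Suc i}" and ne: "A \<noteq> B"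
      then have A: "A \<subseteq> {..<Suc i}" and B: "B \<subseteq> {..<Suc i}" by auto
      show "d' A l \<inter> d' B l = {}"
      proof (cases "A - {i} = B - {i}")
        case True
        then have "i \<in> A \<longleftrightarrow> i \<notin> B" using ne by auto
        then show ?thesis using True by (cases "i \<in> A") (auto simp: d'_def)
      next
        case False
        then have "d (A - {i}) l \<inter> d (B - {i}) l = {}"
          using d(4)[OF l] sub[OF A] sub[OF B] by (auto simp: disjoint_family_on_def)
        then show ?thesis using le[OF A l] le[OF B l] by blast
      qed
    qed
    show "(\<Union>A\<in>Pow {..<Suc i}. d' A l) = c l"
    proof
      show "(\<Union>A\<in>Pow {..<Suc i}. d' A l) \<subseteq> c l"
      proof
        fix x assume "x \<in> (\<Union>A\<in>Pow {..<Suc i}. d' A l)"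
        then obtain A where "A \<subseteq> {..<Suc i}" "x \<in> d' A l" by blast
        then have "A - {i} \<in> Pow {..<i}" "x \<in> d (A - {i}) l" using le[of A l] sub l by auto
        then show "x \<in> c l" using d(5)[OF l] by blast
      qed
      show "c l \<subseteq> (\<Union>A\<in>Pow {..<Suc i}. d' A l)"
      proof
        fix x assume "x \<in> c l"
        then obtain A where A: "A \<subseteq> {..<i}" "x \<in> d A l" using d(5)[OF l] by blast
        then have iA: "i \<notin> A" by auto
        show "x \<in> (\<Union>A\<in>Pow {..<Suc i}. d' A l)"
        proof (cases "x \<in> f A l")
          case True
          then have "x \<in> d' (insert i A) l" using iA by (simp add: d'_def)
          then show ?thesis using A by (intro UN_I[of "insert i A"]) auto
        next
          case False
          then have "x \<in> d' A l" using iA A by (simp add: d'_def)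
          then show ?thesis using A by (intro UN_I[of A]) auto
        qed
      qed
    qed
  qed
qed

lemma kr_split:
  fixes I :: "'i set"
  assumes b: "kr I p b" and U: "U \<in> C"
  shows "\<exists>d. kr (I \<times> Pow {..<p}) p d \<and>
             (\<forall>t\<in>I \<times> Pow {..<p}. \<forall>i<p. d t i \<subseteq> b (fst t) i \<and> (d t i \<subseteq> U \<or> d t i \<inter> U = {}))"
proof -
  let ?Q = "\<lambda>t d. (\<forall>A\<in>Pow {..<p}. \<forall>l<p. d A l \<in> C \<and> (\<forall>k\<in>K. m k (d A 0) = m k (d A l)) \<and>
               (l < p \<longrightarrow> d A l \<subseteq> U \<or> d A l \<inter> U = {})) \<and>
            (\<forall>l<p. disjoint_family_on (\<lambda>A. d A l) (Pow {..<p}) \<and> (\<Union>A\<in>Pow {..<p}. d A l) = b t l)"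
  have "\<forall>t\<in>I. \<exists>d. ?Q t d"
    by (intro ballI split_tower) (use b U in \<open>auto simp: kr_def\<close>)
  then obtain d where d': "\<forall>t\<in>I. ?Q t (d t)" by (rule bchoice[THEN exE])
  have d: "d t A l \<in> C" "d t A l \<subseteq> U \<or> d t A l \<inter> U = {}"
    if "t \<in> I" "A \<subseteq> {..<p}" "l < p" for t A l
    using d' that by blast+
  have d2: "m k (d t A 0) = m k (d t A l)" if "t \<in> I" "A \<subseteq> {..<p}" "l < p" "k \<in> K" for t A l k
    using d' that by blast
  have d4: "disjoint_family_on (\<lambda>A. d t A l) (Pow {..<p})" and d5: "(\<Union>A\<in>Pow {..<p}. d t A l) = b t l"
    if "t \<in> I" "l < p" for t l
    using d' that by blast+
  have sub: "d t A l \<subseteq> b t l" if "t \<in> I" "l < p" "A \<subseteq> {..<p}" for t A l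
    using d5[OF that(1,2)] that(3) by blast
  have "kr (I \<times> Pow {..<p}) p (\<lambda>(t, A). d t A)"
    unfolding kr_def
  proof (intro conjI)
    show "disjoint_family_on (\<lambda>(x, i). (case x of (t, A) \<Rightarrow> d t A) i) ((I \<times> Pow {..<p}) \<times> {..<p})"
      unfolding disjoint_family_on_def
    proof (intro ballI impI)
      fix u v assume u: "u \<in> (I \<times> Pow {..<p}) \<times> {..<p}" and v: "v \<in> (I \<times> Pow {..<p}) \<times> {..<p}"
        and ne: "u \<noteq> v"
      obtain t A i t' A' i' where uv: "u = ((t, A), i)" "v = ((t', A'), i')" by (metis prod.exhaust)
      have *: "t \<in> I" "A \<subseteq> {..<p}" "i < p" "t' \<in> I" "A' \<subseteq> {..<p}" "i' < p" using u v uv by auto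
      have "d t A i \<inter> d t' A' i' = {}"
      proof (rule ccontr)
        assume "d t A i \<inter> d t' A' i' \<noteq> {}"
        then obtain x where x: "x \<in> d t A i" "x \<in> d t' A' i'" by blast
        then have "x \<in> b t i" "x \<in> b t' i'" using sub * by blast+
        then have eq: "t = t'" "i = i'" using kr_unique[OF b] * by blast+
        then have "A = A'"
          using disjoint_family_onD[OF d4[OF *(1,3)], of A A'] x * by auto
        then show False using ne uv eq by simp
      qed
      then show "(case u of (x, i) \<Rightarrow> (case x of (t, A) \<Rightarrow> d t A) i) \<inter>
                 (case v of (x, i) \<Rightarrow> (case x of (t, A) \<Rightarrow> d t A) i) = {}"
        by (simp add: uv)
    qed
    have "(\<Union>x\<in>I \<times> Pow {..<p}. \<Union>i<p. (case x of (t, A) \<Rightarrow> d t A) i) =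
          (\<Union>t\<in>I. \<Union>i<p. \<Union>A\<in>Pow{..<p}. d t A i)" by fastforce
    also have "\<dots> = S" using d5 b by (simp add: kr_def)
    finally show "(\<Union>x\<in>I \<times> Pow {..<p}. \<Union>i<p. (case x of (t, A) \<Rightarrow> d t A) i) = S" .
  qed (use b d d2 in \<open>auto simp: kr_def\<close>)
  then show ?thesis using d(2) sub by (intro exI[of _ "\<lambda>(t, A). d t A"]) auto
qed

end

section \<open>Resolving a linear relation by kernel vectors\<close>

lemma common_denominator:
  assumes "finite A" "A \<subseteq> (\<rat> :: real set)"
  shows "\<exists>h::nat. h > 0 \<and> (\<forall>a\<in>A. real h * a \<in> \<int>)"
  using assms
proof (induction A rule: finite_induct)
  case empty
  then show ?case by (intro exI[of _ 1]) auto
next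
  case (insert x F)
  then obtain h :: nat where h: "h > 0" "\<And>a. a \<in> F \<Longrightarrow> real h * a \<in> \<int>" by auto
  from insert.prems have "x \<in> \<rat>" by auto
  then obtain a b where ab: "b > 0" "x = of_int a / of_int b"
    by (elim Rats_cases')
  have "real (h * nat b) * x = of_int (int h * a)" using ab by simp
  then have "real (h * nat b) * x \<in> \<int>" by (metis Ints_of_int)
  moreover have "real (h * nat b) * y \<in> \<int>" if "y \<in> F" for y
  proof -
    have "real (h * nat b) * y = of_int b * (real h * y)" using ab by simp
    also have "\<dots> \<in> \<int>" by (rule Ints_mult[OF Ints_of_int h(2)[OF that]])
    finally show ?thesis .
  qed
  ultimately show ?case using h(1) ab(1) by (intro exI[of _ "h * nat b"]) auto
qed

context div_simplex
begin

text \<open>A transport argument. Scaling \<open>f j\<close> by |d j| / D turns the relation into an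
  equality of total masses between the indices with positive and with negative coefficient. Cutting
  the positive mass into copies of the negative pieces matches the two sides, and each matched pair
  carries a kernel vector with two nonzero entries.\<close>

lemma ray_decomposition:
  fixes J :: "'j set" and f :: "'j \<Rightarrow> 'a set" and d :: "'j \<Rightarrow> int"
  assumes J: "finite J" and f_all: "\<forall>j\<in>J. f j \<in> C \<and> f j \<noteq> {}"
    and dis: "disjoint_family_on f J"
    and rel_all: "\<forall>k\<in>K. (\<Sum>j\<in>J. of_int (d j) * m k (f j)) = 0"
  shows "\<exists>(T :: ('j \<times> 'j) set) \<rho> e. finite T \<and> (\<forall>t\<in>T. e t \<in> C \<and> e t \<noteq> {}) \<and>
           (\<forall>t\<in>T. \<forall>j\<in>J. \<rho> t j \<in> \<rat> \<and> 0 \<le> \<rho> t j) \<and> (\<forall>t\<in>T. \<exists>j\<in>J. 0 < \<rho> t j) \<and>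
           (\<forall>j\<in>J. \<forall>k\<in>K. (\<Sum>t\<in>T. \<rho> t j * m k (e t)) = m k (f j)) \<and>
           (\<forall>t\<in>T. (\<Sum>j\<in>J. of_int (d j) * \<rho> t j) = (0::real))"
proof -
  have f: "\<And>j. j \<in> J \<Longrightarrow> f j \<in> C" "\<And>j. j \<in> J \<Longrightarrow> f j \<noteq> {}"
    using f_all by auto
  have rel: "(\<Sum>j\<in>J. of_int (d j) * m k (f j)) = 0" if "k \<in> K" for k using rel_all that by blast
  define P where "P = {j\<in>J. d j > 0}"
  define M where "M = {j\<in>J. d j < 0}"
  \<comment> \<open>The summand 1 makes every |d j| strictly smaller than \<open>D\<close>, as
    \<open>realize_fraction\<close> demands.\<close>
  define D where "D = 1 + (\<Sum>j\<in>J. nat \<bar>d j\<bar>)"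
  have dD: "nat \<bar>d j\<bar> < D" if "j \<in> J" for j
    using member_le_sum[of j J "\<lambda>j. nat \<bar>d j\<bar>"] that J by (auto simp: D_def)
  have "0 < D" by (simp add: D_def)
  then have D0: "0 < real D" by simp
  have fin: "finite P" "finite M" using J by (auto simp: P_def M_def)
  have "\<exists>V\<in>C. V \<subseteq> f j \<and> (\<forall>k\<in>K. m k V = nat \<bar>d j\<bar> / D * m k (f j))" if "j \<in> J" for j
    by (rule realize_fraction) (use that f dD in auto)
  then obtain y where y: "\<And>j. j \<in> J \<Longrightarrow> y j \<in> C" "\<And>j. j \<in> J \<Longrightarrow> y j \<subseteq> f j"
    "\<And>j k. j \<in> J \<Longrightarrow> k \<in> K \<Longrightarrow> m k (y j) = nat \<bar>d j\<bar> / D * m k (f j)"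
    by metis
  have y_ne: "y j \<noteq> {}" if "j \<in> J" "d j \<noteq> 0" for j
  proof -
    obtain k where k: "k \<in> K" using K_ne by blast
    have "0 < m k (y j)" using y(3)[OF that(1) k] pos[OF k f(1,2)] that D0 by simp
    then show ?thesis using k by auto
  qed
  define Y where "Y = (\<Union>j\<in>P. y j)"
  have disy: "disjoint_family_on y J"
    using dis y(2) unfolding disjoint_family_on_def by (meson disjoint_iff subsetD)
  have disP: "disjoint_family_on y P"
    by (rule disjoint_family_on_mono[OF _ disy]) (auto simp: P_def)
  have YC: "Y \<in> C" unfolding Y_def by (intro C_UN) (use fin y in \<open>auto simp: P_def\<close>)
  have mY: "m k Y = (\<Sum>l\<in>M. m k (y l))" if k: "k \<in> K" for k
  proof -
    have "0 = (\<Sum>j\<in>P \<union> M. of_int (d j) * m k (f j))"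
      unfolding rel[OF k, symmetric] using J by (intro sum.mono_neutral_right) (auto simp: P_def M_def)
    also have "\<dots> = (\<Sum>j\<in>P. of_int (d j) * m k (f j)) + (\<Sum>j\<in>M. of_int (d j) * m k (f j))"
      using fin by (intro sum.union_disjoint) (auto simp: P_def M_def)
    also have "(\<Sum>j\<in>P. of_int (d j) * m k (f j)) = (\<Sum>j\<in>P. D * m k (y j))"
      using y(3) k D0 by (intro sum.cong) (auto simp: P_def)
    also have "(\<Sum>j\<in>M. of_int (d j) * m k (f j)) = (\<Sum>j\<in>M. - D * m k (y j))"
      using y(3) k D0 by (intro sum.cong) (auto simp: M_def)
    finally have "D * (\<Sum>j\<in>P. m k (y j)) = D * (\<Sum>j\<in>M. m k (y j))"
      by (simp add: sum_distrib_left sum_negf)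
    then have "(\<Sum>j\<in>P. m k (y j)) = (\<Sum>j\<in>M. m k (y j))" using D0 by simp
    moreover have "m k Y = (\<Sum>j\<in>P. m k (y j))" unfolding Y_def
      by (rule m_UN) (use k fin y disP in \<open>auto simp: P_def\<close>)
    ultimately show ?thesis by simp
  qed
  \<comment> \<open>\<open>partition_by_sum\<close> needs a nonempty index set; without negative
    coefficients the relation forces \<open>Y\<close> to be empty.\<close>
  have "\<exists>z. (\<forall>l\<in>M. z l \<in> C \<and> (\<forall>k\<in>K. m k (z l) = m k (y l))) \<and>
             disjoint_family_on z M \<and> (\<Union>l\<in>M. z l) = Y"
  proof (cases "M = {}")
    case True
    have "Y = {}"
    proof (rule ccontr)
      obtain k where k: "k \<in> K" using K_ne by blast
      assume "Y \<noteq> {}"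
      then show False using pos[OF k YC] mY[OF k] True by simp
    qed
    then show ?thesis using True by (auto simp: disjoint_family_on_def)
  next
    case False
    show ?thesis
      by (rule partition_by_sum[OF fin(2) False _ _ YC]) (use y y_ne mY in \<open>auto simp: M_def\<close>)
  qed
  then obtain z where z: "\<And>l. l \<in> M \<Longrightarrow> z l \<in> C" "\<And>l k. l \<in> M \<Longrightarrow> k \<in> K \<Longrightarrow> m k (z l) = m k (y l)"
    "disjoint_family_on z M" "(\<Union>l\<in>M. z l) = Y" by auto
  \<comment> \<open>One type for every \<open>j\<close> with \<open>d j = 0\<close>, indexed by \<open>(j, j)\<close>, and one for every pair \<open>(j, l)\<close> with
    \<open>d j > 0 > d l\<close>: these index the extreme rays of the cone of nonnegative vectors in the kernel of \<open>d\<close>.\<close>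
  define e where "e t = (case t of (j, l) \<Rightarrow> if d j = 0 \<and> l = j then f j else
                           if d j > 0 \<and> d l < 0 then y j \<inter> z l else {})" for t
  define \<rho> :: "'j \<times> 'j \<Rightarrow> 'j \<Rightarrow> real" where
    "\<rho> t i = (case t of (j, l) \<Rightarrow> if j = l then (if i = j then 1 else 0) else
                           if i = j then D / of_int (d j) else if i = l then D / - of_int (d l) else 0)" for t i
  define T where "T = {t\<in>J \<times> J. e t \<noteq> {}}"
  have finT: "finite T" unfolding T_def using J by auto
  have eC: "e t \<in> C" if "t \<in> J \<times> J" for t
    using that f y z by (auto simp: e_def M_def split: prod.splits)
  have T_cases: "(fst t = snd t \<and> d (fst t) = 0) \<or> (d (fst t) > 0 \<and> d (snd t) < 0)" if "t \<in> T" for t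
    using that by (auto simp: T_def e_def split: prod.splits if_splits)
  have T_J: "fst t \<in> J" "snd t \<in> J" if "t \<in> T" for t
    using that by (auto simp: T_def)
  \<comment> \<open>The transport matrix: its row sums are the measures of the \<open>y j\<close>,
    its column sums those of the \<open>z l\<close>.\<close>
  have yz1: "(\<Sum>l\<in>M. m k (y j \<inter> z l)) = m k (y j)" if "j \<in> P" "k \<in> K" for j k
  proof -
    have jJ: "j \<in> J" using that by (simp add: P_def)
    have "y j = (\<Union>l\<in>M. y j \<inter> z l)" using z(4) that(1) by (auto simp: Y_def)
    then have "m k (y j) = m k (\<Union>l\<in>M. y j \<inter> z l)" by simp
    also have "\<dots> = (\<Sum>l\<in>M. m k (y j \<inter> z l))"
    proof (rule m_UN)
      show "disjoint_family_on (\<lambda>l. y j \<inter> z l) M" using z(3) by (auto simp: disjoint_family_on_def)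
    qed (use that fin y(1)[OF jJ] z in auto)
    finally show ?thesis by simp
  qed
  have yz2: "(\<Sum>j\<in>P. m k (y j \<inter> z l)) = m k (z l)" if "l \<in> M" "k \<in> K" for l k
  proof -
    have "z l = (\<Union>j\<in>P. y j \<inter> z l)" using z(4) that(1) by (auto simp: Y_def)
    then have "m k (z l) = m k (\<Union>j\<in>P. y j \<inter> z l)" by simp
    also have "\<dots> = (\<Sum>j\<in>P. m k (y j \<inter> z l))"
    proof (rule m_UN)
      show "disjoint_family_on (\<lambda>j. y j \<inter> z l) P" using disP by (auto simp: disjoint_family_on_def)
      show "y j \<inter> z l \<in> C" if "j \<in> P" for j
        using y(1) that z(1) \<open>l \<in> M\<close> by (auto simp: P_def)
    qed (use that fin in auto)
    finally show ?thesis by simp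
  qed
  have sums: "(\<Sum>t\<in>T. \<rho> t i * m k (e t)) = m k (f i)" if i: "i \<in> J" and k: "k \<in> K" for i k
  proof -
    have "(\<Sum>t\<in>T. \<rho> t i * m k (e t)) = (\<Sum>t\<in>J\<times>J. \<rho> t i * m k (e t))"
      using J k by (intro sum.mono_neutral_left) (auto simp: T_def)
    also have "\<dots> = (\<Sum>j\<in>J. \<Sum>l\<in>J. \<rho> (j, l) i * m k (e (j, l)))"
      by (simp add: sum.cartesian_product)
    also have "\<dots> = m k (f i)"
    proof (cases "d i" "0::int" rule: linorder_cases)
      case equal
      have "(\<Sum>j\<in>J. \<Sum>l\<in>J. \<rho> (j, l) i * m k (e (j, l))) =
            (\<Sum>j\<in>J. if j = i then \<Sum>l\<in>J. if l = i then m k (f i) else 0 else 0)"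
        using equal k by (intro sum.cong refl) (auto simp: \<rho>_def e_def intro!: sum.cong sum.neutral)
      then show ?thesis using i J by simp
    next
      case greater
      have "(\<Sum>j\<in>J. \<Sum>l\<in>J. \<rho> (j, l) i * m k (e (j, l))) =
            (\<Sum>j\<in>J. if j = i then \<Sum>l\<in>J. if d l < 0 then D / d i * m k (y i \<inter> z l) else 0 else 0)"
        using greater k by (intro sum.cong refl) (auto simp: \<rho>_def e_def intro!: sum.cong sum.neutral)
      also have "\<dots> = D / d i * (\<Sum>l\<in>M. m k (y i \<inter> z l))"
        using i J by (simp add: sum_distrib_left M_def flip: sum.inter_filter)
      also have "\<dots> = m k (f i)"
        using greater D0 yz1[of i k] y(3)[OF i k] i k by (simp add: P_def)
      finally show ?thesis .
    next
      case less
      have "(\<Sum>j\<in>J. \<Sum>l\<in>J. \<rho> (j, l) i * m k (e (j, l))) =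
            (\<Sum>l\<in>J. \<Sum>j\<in>J. \<rho> (j, l) i * m k (e (j, l)))" by (rule sum.swap)
      also have "\<dots> =
            (\<Sum>l\<in>J. if l = i then \<Sum>j\<in>J. if d j > 0 then D / - d i * m k (y j \<inter> z i) else 0 else 0)"
        using less k by (intro sum.cong refl) (auto simp: \<rho>_def e_def intro!: sum.cong sum.neutral)
      also have "\<dots> = D / - d i * (\<Sum>j\<in>P. m k (y j \<inter> z i))"
        using i J by (simp add: sum_distrib_left P_def flip: sum.inter_filter)
      also have "\<dots> = m k (f i)"
        using less D0 yz2[of i k] y(3)[OF i k] z(2)[of i k] i k by (simp add: M_def)
      finally show ?thesis .
    qed
    finally show ?thesis .
  qed
  have rel': "(\<Sum>j\<in>J. of_int (d j) * \<rho> t j) = 0" if t: "t \<in> T" for t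
  proof -
    obtain j l where jl: "t = (j, l)" by (cases t)
    note J_jl = T_J[OF t, unfolded jl, simplified]
    show ?thesis
    proof (cases "j = l")
      case True
      then have "d j = 0" using T_cases[OF t] by (auto simp: jl)
      then show ?thesis using True by (intro sum.neutral) (auto simp: \<rho>_def jl)
    next
      case False
      then have dd: "d j > 0" "d l < 0" using T_cases[OF t] by (auto simp: jl)
      have "(\<Sum>i\<in>J. of_int (d i) * \<rho> t i) = (\<Sum>i\<in>J. (if i = j then real D else 0) + (if i = l then - real D else 0))"
        using False dd by (intro sum.cong refl) (auto simp: \<rho>_def jl)
      also have "\<dots> = 0" using J J_jl by (simp add: sum.distrib)
      finally show ?thesis .
    qed
  qed
  have rat: "\<rho> t j \<in> \<rat> \<and> 0 \<le> \<rho> t j" if "t \<in> T" for t j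
    using T_cases[OF that] by (auto simp: \<rho>_def split: prod.splits intro!: divide_nonneg_pos divide_nonneg_neg)
  have ex: "\<exists>j\<in>J. 0 < \<rho> t j" if "t \<in> T" for t
    using T_cases[OF that] T_J[OF that] D0
    by (cases t) (auto simp: \<rho>_def intro!: bexI[of _ "fst t"])
  show ?thesis
    by (intro exI[of _ T] exI[of _ \<rho>] exI[of _ e]) (use finT eC sums rel' rat ex in \<open>auto simp: T_def\<close>)
qed

text \<open>Passes from rational nonnegative rays to positive integer vectors, because the entries
  become letter counts and every letter has to occur in every word.\<close>

lemma decompose_kernel:
  fixes J :: "'j set" and b :: "'j \<Rightarrow> 'a set" and d :: "'j \<Rightarrow> int"
  assumes J: "finite J" and b_all: "\<forall>j\<in>J. b j \<in> C \<and> b j \<noteq> {}"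
    and dis: "disjoint_family_on b J"
    and tot_all: "\<forall>k\<in>K. (\<Sum>j\<in>J. m k (b j)) = 1 / real p"
    and rel_all: "\<forall>k\<in>K. (\<Sum>j\<in>J. of_int (d j) * m k (b j)) = 0"
  shows "\<exists>(T :: ('j \<times> 'j) set) N e. finite T \<and> (\<forall>t\<in>T. e t \<in> C \<and> e t \<noteq> {}) \<and>
           (\<forall>t\<in>T. \<forall>j\<in>J. 1 \<le> N t j) \<and>
           (\<forall>j\<in>J. \<forall>k\<in>K. (\<Sum>t\<in>T. real (N t j) * m k (e t)) = m k (b j)) \<and>
           (\<forall>t\<in>T. (\<Sum>j\<in>J. d j * int (N t j)) = 0)"
proof -
  have b: "\<And>j. j \<in> J \<Longrightarrow> b j \<in> C" "\<And>j. j \<in> J \<Longrightarrow> b j \<noteq> {}"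
    using b_all by auto
  have rel: "(\<Sum>j\<in>J. of_int (d j) * m k (b j)) = 0" if "k \<in> K" for k using rel_all that by blast
  have tot: "(\<Sum>j\<in>J. m k (b j)) = 1 / real p" if "k \<in> K" for k using tot_all that by blast
  obtain k0 where k0: "k0 \<in> K" using K_ne by blast
  have "\<exists>v :: 'j \<Rightarrow> nat. (\<forall>j\<in>J. 1 \<le> v j) \<and> (\<Sum>j\<in>J. of_int (d j) * real (v j)) = 0"
  proof (cases "\<forall>j\<in>J. d j = 0")
    case True
    then show ?thesis by (intro exI[of _ "\<lambda>_. 1"]) auto
  next
    case False
    \<comment> \<open>\<open>A\<close> and \<open>B\<close> are the total positive and negative
      weight of \<open>d\<close>. Giving weight \<open>B\<close> to the positive and
      \<open>A\<close> to the negative indices balances the relation. Both are nonzero, since a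
      nontrivial relation between positive measures has coefficients of both signs.\<close>
    define A where "A = (\<Sum>j\<in>J. nat (d j))"
    define B where "B = (\<Sum>j\<in>J. nat (- d j))"
    have bpos: "0 < m k0 (b j)" if "j \<in> J" for j using pos[OF k0] b that by auto
    have "\<exists>j\<in>J. d j > 0"
    proof (rule ccontr)
      assume "\<not> ?thesis"
      then have le: "of_int (d j) * m k0 (b j) \<le> 0" if "j \<in> J" for j
        using bpos[OF that] that by (auto simp: mult_le_0_iff not_less)
      have "of_int (d j) * m k0 (b j) = 0" if "j \<in> J" for j
        using sum_nonneg_eq_0_iff[OF J, of "\<lambda>j. - (of_int (d j) * m k0 (b j))"] le rel[OF k0] that
        by (auto simp: sum_negf)
      then show False using False bpos by fastforce
    qed
    then have "A > 0" using J by (auto simp: A_def sum_pos2)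
    have "\<exists>j\<in>J. d j < 0"
    proof (rule ccontr)
      assume "\<not> ?thesis"
      then have le: "of_int (d j) * m k0 (b j) \<ge> 0" if "j \<in> J" for j
        using bpos[OF that] that by (auto simp: zero_le_mult_iff not_less)
      have "of_int (d j) * m k0 (b j) = 0" if "j \<in> J" for j
        using sum_nonneg_eq_0_iff[OF J, of "\<lambda>j. of_int (d j) * m k0 (b j)"] le rel[OF k0] that by auto
      then show False using False bpos by fastforce
    qed
    then have "B > 0" using J by (auto simp: B_def sum_pos2)
    define v where "v j = (if d j > 0 then B else if d j < 0 then A else 1)" for j
    have "(\<Sum>j\<in>J. of_int (d j) * real (v j)) = (\<Sum>j\<in>J. real B * real (nat (d j)) - real A * real (nat (- d j)))"
      by (intro sum.cong refl) (auto simp: v_def)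
    also have "\<dots> = real B * real A - real A * real B"
      by (simp add: sum_subtractf A_def B_def flip: sum_distrib_left)
    finally have "(\<Sum>j\<in>J. of_int (d j) * real (v j)) = 0" by simp
    moreover have "\<forall>j\<in>J. 1 \<le> v j" using \<open>A > 0\<close> \<open>B > 0\<close> by (auto simp: v_def)
    ultimately show ?thesis by blast
  qed
  \<comment> \<open>The rays have zero entries. To make all multiplicities positive, a part of measure \<open>v j / n\<close> of every
    \<open>b j\<close> is set aside, where \<open>v\<close> is a positive kernel vector, and distributed over all types; this is
    possible because the total measure of the \<open>b j\<close> does not depend on the measure.\<close>
  then obtain v :: "'j \<Rightarrow> nat" where v: "\<And>j. j \<in> J \<Longrightarrow> 1 \<le> v j" "(\<Sum>j\<in>J. of_int (d j) * real (v j)) = 0"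
    by blast
  have "\<exists>\<epsilon>>0. \<forall>k\<in>K. \<epsilon> \<le> m k (b j)" if "j \<in> J" for j
    by (rule lower[OF b(1)[OF that] b(2)[OF that]])
  then obtain \<epsilon> where \<epsilon>: "\<And>j. j \<in> J \<Longrightarrow> \<epsilon> j > 0" "\<And>j k. j \<in> J \<Longrightarrow> k \<in> K \<Longrightarrow> \<epsilon> j \<le> m k (b j)"
    by metis
  \<comment> \<open>\<open>n\<close> is taken so large that a part of measure v j / n fits strictly
    into every \<open>b j\<close>, uniformly over \<open>K\<close>.\<close>
  have "eventually (\<lambda>n. \<forall>j\<in>J. real (v j) / real n < \<epsilon> j) sequentially"
  proof (intro eventually_ball_finite J ballI)
    fix j assume "j \<in> J"
    have "(\<lambda>n. real (v j) / real n) \<longlonglongrightarrow> 0" by (rule lim_const_over_n)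
    then show "eventually (\<lambda>n. real (v j) / real n < \<epsilon> j) sequentially"
      using \<epsilon>(1)[OF \<open>j \<in> J\<close>] by (rule order_tendstoD)
  qed
  then have "eventually (\<lambda>n. n > 0 \<and> (\<forall>j\<in>J. real (v j) / real n < \<epsilon> j)) sequentially"
    using eventually_gt_at_top[of "0::nat"] by eventually_elim auto
  then obtain n where n: "n > 0" "\<And>j. j \<in> J \<Longrightarrow> real (v j) / real n < \<epsilon> j"
    by (auto simp: eventually_sequentially)
  obtain c where c: "c \<in> C" "\<And>k. k \<in> K \<Longrightarrow> m k c = 1 / n"
    using dv[of S n] total n(1) by auto
  have "\<exists>W\<in>C. W \<subseteq> b j \<and> (\<forall>k\<in>K. m k W = v j / n)" if j: "j \<in> J" for j
  proof -
    have "\<exists>W\<in>C. W \<subseteq> b j \<and> (\<forall>k\<in>K. m k W = (\<Sum>_\<in>{..<v j}. m k c))"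
    proof (rule realize_sum)
      fix k assume "k \<in> K"
      then show "(\<Sum>_\<in>{..<v j}. m k c) < m k (b j)"
        using n(2)[OF j] \<epsilon>(2)[OF j] by (fastforce simp: c)
    qed (use c b j in auto)
    then show ?thesis by (auto simp: c)
  qed
  then obtain W where W: "\<And>j. j \<in> J \<Longrightarrow> W j \<in> C" "\<And>j. j \<in> J \<Longrightarrow> W j \<subseteq> b j"
    "\<And>j k. j \<in> J \<Longrightarrow> k \<in> K \<Longrightarrow> m k (W j) = v j / n" by metis
  define f where "f j = b j - W j" for j
  have mf: "m k (f j) = m k (b j) - v j / n" if "j \<in> J" "k \<in> K" for j k
    unfolding f_def using that m_diff[of k "b j" "W j"] b W by simp
  have fpos: "0 < m k (f j)" if "j \<in> J" "k \<in> K" for j k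
    using mf[OF that] n(2)[OF that(1)] \<epsilon>(2)[OF that] by simp
  have fC: "f j \<in> C" if "j \<in> J" for j using b W that by (auto simp: f_def)
  have f_ne: "f j \<noteq> {}" if "j \<in> J" for j using fpos[OF that k0] k0 by auto
  have disf: "disjoint_family_on f J"
    using dis by (auto simp: f_def disjoint_family_on_def)
  have relf: "(\<Sum>j\<in>J. of_int (d j) * m k (f j)) = 0" if k: "k \<in> K" for k
  proof -
    have "(\<Sum>j\<in>J. of_int (d j) * m k (f j)) =
          (\<Sum>j\<in>J. of_int (d j) * m k (b j) - of_int (d j) * real (v j) / n)"
      using k by (intro sum.cong refl) (simp add: mf algebra_simps)
    also have "\<dots> = 0" using rel[OF k] v(2) by (simp add: sum_subtractf flip: sum_divide_distrib)
    finally show ?thesis .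
  qed
  have "\<forall>j\<in>J. f j \<in> C \<and> f j \<noteq> {}" "\<forall>k\<in>K. (\<Sum>j\<in>J. of_int (d j) * m k (f j)) = 0"
    using fC f_ne relf by auto
  from ray_decomposition[OF J this(1) disf this(2)]
  obtain T :: "('j \<times> 'j) set" and \<rho> e where *: "finite T \<and> (\<forall>t\<in>T. e t \<in> C \<and> e t \<noteq> {}) \<and>
           (\<forall>t\<in>T. \<forall>j\<in>J. \<rho> t j \<in> \<rat> \<and> 0 \<le> \<rho> t j) \<and> (\<forall>t\<in>T. \<exists>j\<in>J. 0 < \<rho> t j) \<and>
           (\<forall>j\<in>J. \<forall>k\<in>K. (\<Sum>t\<in>T. \<rho> t j * m k (e t)) = m k (f j)) \<and>
           (\<forall>t\<in>T. (\<Sum>j\<in>J. of_int (d j) * \<rho> t j) = (0::real))"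
    by (elim exE) (rule that)
  note c = conjunct2[OF *]
  have T: "finite T" "\<And>t. t \<in> T \<Longrightarrow> e t \<in> C" "\<And>t. t \<in> T \<Longrightarrow> e t \<noteq> {}"
    using * by blast+
  have \<rho>: "\<And>t j. t \<in> T \<Longrightarrow> j \<in> J \<Longrightarrow> \<rho> t j \<in> \<rat>" "\<And>t j. t \<in> T \<Longrightarrow> j \<in> J \<Longrightarrow> 0 \<le> \<rho> t j"
    using c[THEN conjunct2, THEN conjunct1] by blast+
  have \<rho>_pos: "\<And>t. t \<in> T \<Longrightarrow> \<exists>j\<in>J. 0 < \<rho> t j"
    using c[THEN conjunct2, THEN conjunct2, THEN conjunct1] by blast
  have sums: "\<And>j k. j \<in> J \<Longrightarrow> k \<in> K \<Longrightarrow> (\<Sum>t\<in>T. \<rho> t j * m k (e t)) = m k (f j)"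
    using c[THEN conjunct2, THEN conjunct2, THEN conjunct2, THEN conjunct1] by blast
  have rel\<rho>: "\<And>t. t \<in> T \<Longrightarrow> (\<Sum>j\<in>J. of_int (d j) * \<rho> t j) = 0"
    using c[THEN conjunct2, THEN conjunct2, THEN conjunct2, THEN conjunct2] by blast
  define R where "R t = (\<Sum>j\<in>J. \<rho> t j)" for t
  \<comment> \<open>The total measure left in the \<open>f j\<close>: rational and the same for all
    measures, because the \<open>b j\<close> have total 1/p.\<close>
  define s where "s = 1 / real p - (\<Sum>j\<in>J. real (v j)) / n"
  have s: "s = (\<Sum>j\<in>J. m k (f j))" if "k \<in> K" for k
    using tot[OF that] that by (simp add: s_def mf sum_subtractf flip: sum_divide_distrib)
  have R: "R t > 0" if "t \<in> T" for t
    using \<rho>_pos[OF that] \<rho>(2)[OF that] J by (auto simp: R_def intro!: sum_pos2)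
  show ?thesis
  proof (cases "J = {}")
    case True
    then show ?thesis by (intro exI[of _ "{}"]) auto
  next
    case False
    have s0: "s > 0" unfolding s[OF k0] by (rule sum_pos) (use J False fpos k0 in auto)
    have sR: "s = (\<Sum>t\<in>T. R t * m k (e t))" if "k \<in> K" for k
    proof -
      have "s = (\<Sum>j\<in>J. \<Sum>t\<in>T. \<rho> t j * m k (e t))" using s[OF that] sums that by simp
      also have "\<dots> = (\<Sum>t\<in>T. \<Sum>j\<in>J. \<rho> t j * m k (e t))" by (rule sum.swap)
      finally show ?thesis by (simp add: R_def sum_distrib_right)
    qed
    \<comment> \<open>The sum of the \<open>R t * m k (e t)\<close> is \<open>s\<close>, so the
      added term contributes exactly v j / n to entry \<open>j\<close>, the part set aside. Being a
      multiple of \<open>v\<close>, it stays in the kernel.\<close>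
    define NQ where "NQ t j = \<rho> t j + R t * v j / (n * s)" for t j
    have s_rat: "s \<in> \<rat>" unfolding s_def by (intro Rats_diff Rats_divide Rats_sum) auto
    have NQ_rat: "NQ t j \<in> \<rat>" if "t \<in> T" "j \<in> J" for t j
      unfolding NQ_def R_def using \<rho>(1) that s_rat
      by (intro Rats_add Rats_divide Rats_mult Rats_sum) auto
    have NQ_pos: "NQ t j > 0" if "t \<in> T" "j \<in> J" for t j
      unfolding NQ_def using \<rho>(2)[OF that] R[OF that(1)] v(1)[OF that(2)] n(1) s0
      by (intro add_nonneg_pos divide_pos_pos mult_pos_pos) auto
    have NQ_sum: "(\<Sum>t\<in>T. NQ t j * m k (e t)) = m k (b j)" if "j \<in> J" "k \<in> K" for j k
    proof -
      have "(\<Sum>t\<in>T. NQ t j * m k (e t)) = (\<Sum>t\<in>T. \<rho> t j * m k (e t)) + (\<Sum>t\<in>T. v j / (n * s) * (R t * m k (e t)))"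
        by (simp add: NQ_def sum.distrib algebra_simps)
      also have "(\<Sum>t\<in>T. v j / (n * s) * (R t * m k (e t))) = v j / (n * s) * s"
        by (simp only: sR[OF that(2)] flip: sum_distrib_left)
      also have "\<dots> = v j / n" using s0 by simp
      finally show ?thesis using sums[OF that] mf[OF that] by simp
    qed
    have NQ_rel: "(\<Sum>j\<in>J. of_int (d j) * NQ t j) = 0" if "t \<in> T" for t
    proof -
      have "(\<Sum>j\<in>J. of_int (d j) * NQ t j) = (\<Sum>j\<in>J. of_int (d j) * \<rho> t j) +
              (\<Sum>j\<in>J. R t / (n * s) * (of_int (d j) * v j))"
        by (simp add: NQ_def sum.distrib algebra_simps)
      also have "(\<Sum>j\<in>J. R t / (n * s) * (of_int (d j) * v j)) = 0"
        using v(2) by (simp only: flip: sum_distrib_left) simp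
      also have "(\<Sum>j\<in>J. of_int (d j) * \<rho> t j) + 0 = 0" using rel\<rho>[OF that] by simp
      finally show ?thesis .
    qed
    have "finite ((\<lambda>(t, j). NQ t j) ` (T \<times> J))" "(\<lambda>(t, j). NQ t j) ` (T \<times> J) \<subseteq> \<rat>"
      using T(1) J NQ_rat by auto
    from common_denominator[OF this]
    obtain h :: nat where h: "h > 0" "\<And>t j. t \<in> T \<Longrightarrow> j \<in> J \<Longrightarrow> real h * NQ t j \<in> \<int>"
      by auto
    \<comment> \<open>Clearing denominators: the counts are multiplied by \<open>h\<close>, and
      below the bases are divided by \<open>h\<close>.\<close>
    define N where "N t j = nat \<lfloor>h * NQ t j\<rfloor>" for t j
    have N: "real (N t j) = h * NQ t j" if "t \<in> T" "j \<in> J" for t j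
    proof -
      have "h * NQ t j \<in> \<int>" using h(2) that by auto
      then have "of_int \<lfloor>h * NQ t j\<rfloor> = h * NQ t j" by simp
      moreover have "\<lfloor>h * NQ t j\<rfloor> \<ge> 0" using NQ_pos[OF that] by simp
      ultimately show ?thesis by (simp add: N_def)
    qed
    have "\<exists>V\<in>C. V \<subseteq> e t \<and> (\<forall>k\<in>K. m k V = m k (e t) / h)" if "t \<in> T" for t
      using dv T(2)[OF that] h(1) by auto
    then obtain e' where e': "\<And>t. t \<in> T \<Longrightarrow> e' t \<in> C" "\<And>t k. t \<in> T \<Longrightarrow> k \<in> K \<Longrightarrow> m k (e' t) = m k (e t) / h"
      by metis
    have ne: "e' t \<noteq> {}" if "t \<in> T" for t
      using e'(2)[OF that k0] pos[OF k0 T(2,3)[OF that]] k0 h(1) by auto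
    show ?thesis
    proof (intro exI[of _ T] exI[of _ N] exI[of _ e'] conjI ballI)
      fix t j assume tj: "t \<in> T" "j \<in> J"
      have "real (N t j) > 0" unfolding N[OF tj] using NQ_pos[OF tj] h(1) by simp
      then show "1 \<le> N t j" by simp
    next
      fix j k assume jk: "j \<in> J" "k \<in> K"
      have "(\<Sum>t\<in>T. real (N t j) * m k (e' t)) = (\<Sum>t\<in>T. NQ t j * m k (e t))"
        using h(1) jk by (intro sum.cong refl) (simp add: N e')
      then show "(\<Sum>t\<in>T. real (N t j) * m k (e' t)) = m k (b j)" using NQ_sum[OF jk] by simp
    next
      fix t assume t: "t \<in> T"
      have "real_of_int (\<Sum>j\<in>J. d j * int (N t j)) = (\<Sum>j\<in>J. h * (of_int (d j) * NQ t j))"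
        using t by (simp add: N mult.left_commute)
      also have "\<dots> = 0" using NQ_rel[OF t] by (simp flip: sum_distrib_left)
      finally show "(\<Sum>j\<in>J. d j * int (N t j)) = 0" by linarith
    qed (use T e' ne in auto)
  qed
qed

text \<open>The equal entry sums \<open>q\<close> give the new towers a common height: the counts of
  a type are multiplied by a factor and its base is divided accordingly. The bound
  \<open>M + 3\<close> leaves room for marking the words and for one label per tower.\<close>

lemma decompose_kernel_uniform:
  fixes J :: "'j set" and b :: "'j \<Rightarrow> 'a set" and d :: "'j \<Rightarrow> int"
  assumes J: "finite J" "J \<noteq> {}" and b_all: "\<forall>j\<in>J. b j \<in> C \<and> b j \<noteq> {}"
    and dis: "disjoint_family_on b J"
    and tot_all: "\<forall>k\<in>K. (\<Sum>j\<in>J. m k (b j)) = 1 / real p"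
    and rel_all: "\<forall>k\<in>K. (\<Sum>j\<in>J. of_int (d j) * m k (b j)) = 0"
  shows "\<exists>M q N e. M \<ge> (2::nat) \<and> (\<forall>t<M. e t \<in> C \<and> e t \<noteq> {}) \<and>
           (\<forall>t<M. \<forall>j\<in>J. M + 3 \<le> N t j) \<and> (\<forall>t<M. (\<Sum>j\<in>J. N t j) = q) \<and>
           (\<forall>j\<in>J. \<forall>k\<in>K. (\<Sum>t<M. real (N t j) * m k (e t)) = m k (b j)) \<and>
           (\<forall>t<M. (\<Sum>j\<in>J. d j * int (N t j)) = 0)"
proof -
  have b: "\<And>j. j \<in> J \<Longrightarrow> b j \<in> C" "\<And>j. j \<in> J \<Longrightarrow> b j \<noteq> {}"
    using b_all by auto
  obtain k0 where k0: "k0 \<in> K" using K_ne by blast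
  from decompose_kernel[OF J(1) b_all dis tot_all rel_all]
  obtain T :: "('j \<times> 'j) set" and N e where *: "finite T \<and> (\<forall>t\<in>T. e t \<in> C \<and> e t \<noteq> {}) \<and>
           (\<forall>t\<in>T. \<forall>j\<in>J. 1 \<le> N t j) \<and>
           (\<forall>j\<in>J. \<forall>k\<in>K. (\<Sum>t\<in>T. real (N t j) * m k (e t)) = m k (b j)) \<and>
           (\<forall>t\<in>T. (\<Sum>j\<in>J. d j * int (N t j)) = 0)"
    by (elim exE) (rule that)
  have T: "finite T" "\<And>t. t \<in> T \<Longrightarrow> e t \<in> C" "\<And>t. t \<in> T \<Longrightarrow> e t \<noteq> {}"
    and N1: "\<And>t j. t \<in> T \<Longrightarrow> j \<in> J \<Longrightarrow> 1 \<le> N t j"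
    and sums: "\<And>j k. j \<in> J \<Longrightarrow> k \<in> K \<Longrightarrow> (\<Sum>t\<in>T. real (N t j) * m k (e t)) = m k (b j)"
    and relN: "\<And>t. t \<in> T \<Longrightarrow> (\<Sum>j\<in>J. d j * int (N t j)) = 0"
    using * by blast+
  have "T \<noteq> {}"
  proof
    assume "T = {}"
    obtain j where j: "j \<in> J" using J by blast
    then show False using sums[OF j k0] pos[OF k0 b[OF j]] \<open>T = {}\<close> by simp
  qed
  \<comment> \<open>Every type is used twice, once for each boolean, which guarantees two new
    towers; hence the factor 2 in \<open>2 * F t\<close>.\<close>
  define M where "M = card (T \<times> (UNIV :: bool set))"
  have "card T \<ge> 1" using T(1) \<open>T \<noteq> {}\<close> by (simp add: Suc_leI card_gt_0_iff)
  then have M2: "M \<ge> 2" by (simp add: M_def card_cartesian_product)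
  obtain h where "bij_betw h {0..<M} (T \<times> (UNIV :: bool set))"
    using ex_bij_betw_nat_finite[of "T \<times> (UNIV :: bool set)"] T(1) by (auto simp: M_def)
  then have h: "bij_betw h {..<M} (T \<times> (UNIV :: bool set))" by (simp add: atLeast0LessThan)
  have hT: "fst (h t) \<in> T" if "t < M" for t using bij_betwE[OF h] that by (metis lessThan_iff mem_Times_iff)
  define s where "s t = (\<Sum>j\<in>J. N t j)" for t
  have s: "s t > 0" if "t \<in> T" for t
    unfolding s_def using J N1[OF that] by (intro sum_pos) fastforce+
  \<comment> \<open>Chosen so that \<open>F t\<close> times the entry sum of type \<open>t\<close>
    is the same number \<open>q\<close> for all types; the factor \<open>M + 3\<close> secures the
    lower bound on the counts.\<close>
  define F where "F t = (M + 3) * (\<Prod>u\<in>T - {t}. s u)" for t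
  define q where "q = (M + 3) * (\<Prod>u\<in>T. s u)"
  have Fs: "F t * s t = q" if "t \<in> T" for t
    using prod.remove[OF T(1) that, of s] by (simp add: F_def q_def algebra_simps)
  have F: "F t \<ge> M + 3" if "t \<in> T" for t
  proof -
    have "(\<Prod>u\<in>T - {t}. s u) > 0" by (rule prod_pos) (use s in auto)
    then show ?thesis by (simp add: F_def)
  qed
  have "\<exists>V\<in>C. V \<subseteq> e t \<and> (\<forall>k\<in>K. m k V = m k (e t) / real (2 * F t))" if "t \<in> T" for t
    by (rule dv) (use T(2)[OF that] F[OF that] in auto)
  then obtain e' where e': "\<And>t. t \<in> T \<Longrightarrow> e' t \<in> C"
      "\<And>t k. t \<in> T \<Longrightarrow> k \<in> K \<Longrightarrow> m k (e' t) = m k (e t) / real (2 * F t)"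
    by metis
  have ne: "e' t \<noteq> {}" if "t \<in> T" for t
    using e'(2)[OF that k0] pos[OF k0 T(2,3)[OF that]] k0 F[OF that] by auto
  show ?thesis
  proof (rule exI[of _ M], rule exI[of _ q], rule exI[of _ "\<lambda>t j. F (fst (h t)) * N (fst (h t)) j"],
      rule exI[of _ "\<lambda>t. e' (fst (h t))"], intro conjI allI impI ballI M2)
    fix t assume "t < M"
    note t = hT[OF this]
    show "e' (fst (h t)) \<in> C" "e' (fst (h t)) \<noteq> {}" using e' ne t by auto
    show "(\<Sum>j\<in>J. F (fst (h t)) * N (fst (h t)) j) = q"
      using Fs[OF t] by (simp add: s_def sum_distrib_left)
    have "(\<Sum>j\<in>J. d j * int (F (fst (h t)) * N (fst (h t)) j)) = int (F (fst (h t))) * (\<Sum>j\<in>J. d j * int (N (fst (h t)) j))"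
      by (simp add: sum_distrib_left mult.left_commute)
    then show "(\<Sum>j\<in>J. d j * int (F (fst (h t)) * N (fst (h t)) j)) = 0" using relN[OF t] by simp
    fix j assume j: "j \<in> J"
    show "M + 3 \<le> F (fst (h t)) * N (fst (h t)) j"
      using mult_le_mono[OF F[OF t] N1[OF t j]] by simp
  next
    fix j k assume jk: "j \<in> J" "k \<in> K"
    have "(\<Sum>t<M. real (F (fst (h t)) * N (fst (h t)) j) * m k (e' (fst (h t)))) =
          (\<Sum>x\<in>T \<times> (UNIV :: bool set). real (F (fst x) * N (fst x) j) * m k (e' (fst x)))"
      by (rule sum.reindex_bij_betw[OF h])
    also have "\<dots> = (\<Sum>t\<in>T. \<Sum>u\<in>(UNIV :: bool set). real (F t * N t j) * m k (e' t))"
      by (simp only: sum.cartesian_product case_prod_unfold)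
    also have "\<dots> = (\<Sum>t\<in>T. real (N t j) * m k (e t))"
    proof (intro sum.cong refl)
      fix t assume t: "t \<in> T"
      then show "(\<Sum>u\<in>(UNIV :: bool set). real (F t * N t j) * m k (e' t)) = real (N t j) * m k (e t)"
        using F[OF t] by (simp add: e'(2)[OF t jk(2)] field_simps)
    qed
    finally show "(\<Sum>t<M. real (F (fst (h t)) * N (fst (h t)) j) * m k (e' (fst (h t)))) = m k (b j)"
      using sums[OF jk] by simp
  qed
qed

end

section \<open>Words and concatenation of towers\<close>

text \<open>In a concatenation of such words the pattern 1 0 0 occurs only where one word ends and
  the next begins: within a word, 0 0 either starts the word or is preceded by 0, and the last
  letter is not 0.\<close>

definition marked_word :: "nat list \<Rightarrow> bool" where
  "marked_word w \<longleftrightarrow> length w \<ge> 3 \<and> w ! 0 = 0 \<and> w ! 1 = 0 \<and> w ! (length w - 1) = 1 \<and>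
     (\<forall>k. 0 < k \<longrightarrow> Suc k < length w \<longrightarrow> w ! k = 0 \<longrightarrow> w ! Suc k = 0 \<longrightarrow> w ! (k - 1) = 0)"

text \<open>The length of the first run of 1s behind the initial 0s. It names the tower, so that
  distinct towers get distinct words.\<close>

definition word_label :: "nat list \<Rightarrow> nat" where
  "word_label w = length (takeWhile (\<lambda>x. x = 1) (dropWhile (\<lambda>x. x = 0) w))"

text \<open>Behind the initial block there is a single further 0, so 0 0 does not occur again. That
  0 also delimits the run of \<open>s\<close> ones, even if \<open>rest\<close> is empty.\<close>

lemma word_form:
  fixes rest :: "nat list"
  assumes w: "w = replicate a 0 @ replicate s 1 @ 0 # rest @ replicate r 1"
    and "a \<ge> 2" "s \<ge> 1" "r \<ge> 1" "0 \<notin> set rest"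
  shows "marked_word w" "word_label w = s"
proof -
  have nz: "(rest @ replicate r 1) ! k \<noteq> 0" if "k < length rest + r" for k
  proof -
    have "(rest @ replicate r 1) ! k \<in> set (rest @ replicate r 1)" by (rule nth_mem) (simp add: that)
    moreover have "0 \<notin> set (rest @ replicate r 1)" using assms(5) by simp
    ultimately show ?thesis by metis
  qed
  have zero: "k < a \<or> k = a + s" if "w ! k = 0" "k < length w" for k
  proof (rule ccontr)
    assume n: "\<not> ?thesis"
    consider "a \<le> k" "k < a + s" | "a + s < k" using n by linarith
    then show False
    proof cases
      case 1
      then have "k - a < s" by linarith
      then have "w ! k = 1" using 1 by (simp add: w nth_append)
      then show False using that by simp
    next
      case 2
      then have "w ! k = (rest @ replicate r 1) ! (k - a - s - 1)"
        by (simp add: w nth_append nth_Cons')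
      moreover have "length w = a + s + 1 + length rest + r" by (simp add: w)
      then have "k - a - s - 1 < length rest + r" using that(2) 2 by linarith
      ultimately show False using nz[of "k - a - s - 1"] that(1) by simp
    qed
  qed
  have front: "w ! k = 0" if "k < a" for k using that by (simp add: w nth_append)
  show "marked_word w"
    unfolding marked_word_def
  proof (intro conjI allI impI)
    show "length w \<ge> 3" "w ! 0 = 0" "w ! 1 = 0" using assms by (auto simp: nth_append)
    have "w ! (length w - 1) = last w" using w by (intro last_conv_nth[symmetric]) auto
    also have "\<dots> = 1" using w assms(4) by simp
    finally show "w ! (length w - 1) = 1" .
    fix k assume k: "0 < k" "Suc k < length w" "w ! k = 0" "w ! Suc k = 0"
    have "k < a" using zero[OF k(3)] zero[OF k(4,2)] k(2) assms(3) by linarith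
    then show "w ! (k - 1) = 0" by (intro front) auto
  qed
  have "dropWhile (\<lambda>x. x = 0) w = replicate s 1 @ 0 # rest @ replicate r 1"
    using assms(3) by (cases s) (auto simp: w dropWhile_append)
  then show "word_label w = s" by (simp add: word_label_def takeWhile_append)
qed

text \<open>The letters \<open>j\<close> are refined types whose counts are prescribed one by one,
  whereas the marking concerns only the numbers \<open>\<pi> j\<close> of the coarse towers
  containing them.\<close>

lemma word_with_counts:
  fixes J :: "'j set" and N :: "'j \<Rightarrow> nat" and \<pi> :: "'j \<Rightarrow> nat"
  assumes J: "finite J" and i0: "i0 \<in> J" "\<pi> i0 = 0" "N i0 \<ge> 3"
    and i1: "i1 \<in> J" "\<pi> i1 = 1" "N i1 > s" and s: "s \<ge> 1"
  shows "\<exists>xs. (\<forall>j\<in>J. count_list xs j = N j) \<and> set xs \<subseteq> J \<and> length xs = (\<Sum>j\<in>J. N j) \<and>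
              marked_word (map \<pi> xs) \<and> word_label (map \<pi> xs) = s"
proof -
  define A where "A = (\<Sum>j\<in>J. replicate_mset (N j) j)"
  have cA: "count A j = (if j \<in> J then N j else 0)" for j
    using J by (simp add: A_def count_sum)
  obtain ys where ys: "mset ys = A" using ex_mset by blast
  define zs where "zs = filter (\<lambda>j. \<pi> j = 0) ys"
  define os where "os = filter (\<lambda>j. \<pi> j = 1) ys"
  define rs where "rs = filter (\<lambda>j. \<pi> j \<noteq> 0 \<and> \<pi> j \<noteq> 1) ys"
  have len: "N i \<le> length (filter (\<lambda>j. \<pi> j = \<pi> i) ys)" if "i \<in> J" for i
  proof -
    have "N i = count (filter_mset (\<lambda>j. \<pi> j = \<pi> i) (mset ys)) i" using that by (simp add: ys cA)
    also have "\<dots> \<le> size (filter_mset (\<lambda>j. \<pi> j = \<pi> i) (mset ys))" by (rule count_le_size)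
    also have "\<dots> = length (filter (\<lambda>j. \<pi> j = \<pi> i) ys)" by (metis mset_filter size_mset)
    finally show ?thesis .
  qed
  have lz: "length zs \<ge> 3" using len[OF i0(1)] i0 by (simp add: zs_def)
  have lo: "length os > s" using len[OF i1(1)] i1 by (simp add: os_def)
  \<comment> \<open>One letter over 0 is kept as separator behind the label, leaving at least two in
    front; at least one letter over 1 is left for the end.\<close>
  define xs where "xs = butlast zs @ take s os @ last zs # rs @ drop s os"
  have zs: "zs = butlast zs @ [last zs]" using lz by (intro append_butlast_last_id[symmetric]) auto
  have "mset xs = (mset (butlast zs) + {#last zs#}) + (mset (take s os) + mset (drop s os)) + mset rs"
    by (simp add: xs_def)
  also have "\<dots> = mset zs + mset os + mset rs"
    using zs by (metis append_take_drop_id mset_append mset_single_iff_right)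
  also have "\<dots> = mset ys" unfolding zs_def os_def rs_def
    by (rule multiset_eqI) simp
  finally have xs: "mset xs = A" using ys by simp
  have cl: "count_list xs j = N j" if "j \<in> J" for j
    using that xs cA by (metis count_mset)
  moreover have sub: "set xs \<subseteq> J"
    using xs cA by (metis count_eq_zero_iff set_mset_mset subsetI)
  moreover have "length xs = (\<Sum>j\<in>J. N j)"
    using sum_count_set[OF sub J] cl by simp
  moreover have "map \<pi> xs = replicate (length zs - 1) 0 @ replicate s 1 @ 0 # map \<pi> rs @ replicate (length os - s) 1"
  proof -
    have z: "\<pi> x = 0" if "x \<in> set zs" for x using that by (simp add: zs_def)
    have o: "\<pi> x = 1" if "x \<in> set os" for x using that by (simp add: os_def)
    have "map \<pi> (butlast zs) = replicate (length zs - 1) 0"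
      using z by (intro replicate_eqI) (auto dest: in_set_butlastD)
    moreover have "\<pi> (last zs) = 0" using z lz by (intro z last_in_set) auto
    moreover have "map \<pi> (take s os) = replicate s 1"
      using o lo by (intro replicate_eqI) (auto dest: in_set_takeD)
    moreover have "map \<pi> (drop s os) = replicate (length os - s) 1"
      using o lo by (intro replicate_eqI) (auto dest: in_set_dropD)
    ultimately show ?thesis by (simp add: xs_def)
  qed
  note form = word_form[OF this]
  have "0 \<notin> set (map \<pi> rs)" by (auto simp: rs_def)
  with form lz lo s have "marked_word (map \<pi> xs)" "word_label (map \<pi> xs) = s" by auto
  ultimately show ?thesis by blast
qed

lemma sum_blocks:
  fixes g :: "nat \<Rightarrow> 'b::comm_monoid_add"
  shows "(\<Sum>i<p * q. g i) = (\<Sum>k<q. \<Sum>i<p. g (k * p + i))"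
proof -
  have "(\<Sum>i<p * q. g i) = (\<Sum>k<q. sum g {k * p..<k * p + p})"
    by (simp add: sum.nat_group mult.commute)
  also have "\<dots> = (\<Sum>k<q. \<Sum>i<p. g (k * p + i))"
  proof (rule sum.cong[OF refl])
    fix k
    have "sum g {k * p..<k * p + p} = sum g {0 + k * p..<p + k * p}" by (simp add: add.commute)
    also have "\<dots> = (\<Sum>i\<in>{0..<p}. g (i + k * p))" by (rule sum.shift_bounds_nat_ivl)
    finally show "sum g {k * p..<k * p + p} = (\<Sum>i<p. g (k * p + i))"
      by (simp add: atLeast0LessThan add.commute)
  qed
  finally show ?thesis .
qed

section \<open>Refining towers by concatenation\<close>

context div_simplex
begin

text \<open>Each level of tower \<open>r\<close> is cut into one piece per occurrence of
  \<open>r\<close> in the words, and by \<open>sums\<close> its measure is exactly what these pieces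
  need.\<close>

lemma kr_concat:
  fixes I :: "'i set" and w :: "nat \<Rightarrow> 'i list"
  assumes d: "kr I p d" and ne: "\<And>r i. r \<in> I \<Longrightarrow> i < p \<Longrightarrow> d r i \<noteq> {}"
    and M: "M > 0" and w: "\<And>t. t < M \<Longrightarrow> length (w t) = q" "\<And>t. t < M \<Longrightarrow> set (w t) = I" and q: "q > 0"
    and e: "\<And>t. t < M \<Longrightarrow> e t \<in> C" "\<And>t. t < M \<Longrightarrow> e t \<noteq> {}"
    and sums: "\<And>r k. r \<in> I \<Longrightarrow> k \<in> K \<Longrightarrow> (\<Sum>t<M. count_list (w t) r * m k (e t)) = m k (d r 0)"
  shows "\<exists>b'. kr {..<M} (p * q) b' \<and> (\<forall>t<M. \<forall>i<p * q. b' t i \<noteq> {} \<and> b' t i \<subseteq> d (w t ! (i div p)) (i mod p))"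
proof -
  have p: "p > 0" using d by (simp add: kr_def)
  \<comment> \<open>The occurrences (tower, position) of the letter \<open>r\<close> in the
    words.\<close>
  define F where "F r = (SIGMA t:{..<M}. {k. k < q \<and> w t ! k = r})" for r
  have finF: "finite (F r)" for r by (auto simp: F_def)
  have "\<exists>D. (\<forall>x\<in>F r. D x \<in> C \<and> (\<forall>k\<in>K. m k (D x) = m k (e (fst x)))) \<and>
             disjoint_family_on D (F r) \<and> (\<Union>x\<in>F r. D x) = d r i" if ri: "r \<in> I" "i < p" for r i
  proof (rule partition_by_sum[OF finF])
    have "r \<in> set (w 0)" using w(2)[OF M] ri by simp
    then obtain k where "k < q" "w 0 ! k = r" using w(1)[OF M] by (auto simp: in_set_conv_nth)
    then have "(0, k) \<in> F r" using M by (auto simp: F_def)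
    then show "F r \<noteq> {}" by blast
    show "d r i \<in> C" using d ri by (simp add: kr_def)
    fix k assume k: "k \<in> K"
    have "(\<Sum>x\<in>F r. m k (e (fst x))) = (\<Sum>t<M. \<Sum>l | l < q \<and> w t ! l = r. m k (e t))"
      unfolding F_def by (subst sum.Sigma) (auto simp: case_prod_unfold)
    also have "\<dots> = (\<Sum>t<M. count_list (w t) r * m k (e t))"
    proof (intro sum.cong refl)
      fix t assume "t \<in> {..<M}"
      then have "card {l. l < q \<and> w t ! l = r} = count_list (w t) r"
        using w(1)[of t] by (simp add: count_list_eq_length_filter length_filter_conv_card eq_commute)
      then show "(\<Sum>l | l < q \<and> w t ! l = r. m k (e t)) = count_list (w t) r * m k (e t)" by simp
    qed
    also have "\<dots> = m k (d r i)" using sums[OF ri(1) k] d ri k by (auto simp: kr_def)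
    finally show "(\<Sum>x\<in>F r. m k (e (fst x))) = m k (d r i)" .
  qed (use e in \<open>auto simp: F_def\<close>)
  note D_ex = this
  define D where "D r i = (SOME D. (\<forall>x\<in>F r. D x \<in> C \<and> (\<forall>k\<in>K. m k (D x) = m k (e (fst x)))) \<and>
             disjoint_family_on D (F r) \<and> (\<Union>x\<in>F r. D x) = d r i)" for r i
  have D0: "(\<forall>x\<in>F r. D r i x \<in> C \<and> (\<forall>k\<in>K. m k (D r i x) = m k (e (fst x)))) \<and>
             disjoint_family_on (D r i) (F r) \<and> (\<Union>x\<in>F r. D r i x) = d r i" if "r \<in> I" "i < p" for r i
    unfolding D_def by (rule someI_ex[OF D_ex[OF that]])
  \<comment> \<open>Level \<open>i\<close> of a new tower lies in block \<open>i div p\<close> of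
    its word, at height \<open>i mod p\<close> of the old tower named there.\<close>
  define b' where "b' t i = D (w t ! (i div p)) (i mod p) (t, i div p)" for t i
  have idx: "i div p < q" "i mod p < p" if "i < p * q" for i
    using that p by (auto simp: less_mult_imp_div_less mult.commute)
  have wI: "w t ! l \<in> I" if "t < M" "l < q" for t l
    using that w[of t] nth_mem[of l "w t"] by simp
  have inF: "(t, l) \<in> F (w t ! l)" if "t < M" "l < q" for t l using that by (simp add: F_def)
  have b'C: "b' t i \<in> C" and b'm: "\<And>k. k \<in> K \<Longrightarrow> m k (b' t i) = m k (e t)"
    and b'd: "b' t i \<subseteq> d (w t ! (i div p)) (i mod p)" if "t < M" "i < p * q" for t i
    using D0[OF wI[OF that(1) idx(1)[OF that(2)]] idx(2)[OF that(2)]] inF[OF that(1) idx(1)[OF that(2)]]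
    unfolding b'_def by (fastforce, fastforce, blast)
  have b'ne: "b' t i \<noteq> {}" if "t < M" "i < p * q" for t i
    using nonempty_cong[OF b'C[OF that] e(1)[OF that(1)] b'm[OF that]] e(2)[OF that(1)] by blast
  have "kr {..<M} (p * q) b'"
    unfolding kr_def
  proof (intro conjI ballI allI impI)
    show "p * q > 0" using p q by simp
    show "disjoint_family_on (\<lambda>(t, i). b' t i) ({..<M} \<times> {..<p * q})"
      unfolding disjoint_family_on_def
    proof (intro ballI impI)
      fix u v assume u: "u \<in> {..<M} \<times> {..<p * q}" and v: "v \<in> {..<M} \<times> {..<p * q}" and uv: "u \<noteq> v"
      obtain t i t' i' where eq: "u = (t, i)" "v = (t', i')" by (metis prod.exhaust)
      have *: "t < M" "i < p * q" "t' < M" "i' < p * q" using u v eq by auto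
      have "b' t i \<inter> b' t' i' = {}"
      proof (rule ccontr)
        assume "b' t i \<inter> b' t' i' \<noteq> {}"
        then obtain x where x: "x \<in> b' t i" "x \<in> b' t' i'" by blast
        then have "x \<in> d (w t ! (i div p)) (i mod p)" "x \<in> d (w t' ! (i' div p)) (i' mod p)"
          using b'd * by blast+
        then have same: "w t ! (i div p) = w t' ! (i' div p)" "i mod p = i' mod p"
          using kr_unique[OF d wI wI] idx * by blast+
        have "(t, i div p) = (t', i' div p)"
        proof (rule ccontr)
          assume ne: "(t, i div p) \<noteq> (t', i' div p)"
          have "disjoint_family_on (D (w t ! (i div p)) (i mod p)) (F (w t ! (i div p)))"
            using D0[OF wI idx(2)] idx * by blast
          from disjoint_family_onD[OF this _ _ ne] have "D (w t ! (i div p)) (i mod p) (t, i div p) \<inter>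
              D (w t ! (i div p)) (i mod p) (t', i' div p) = {}"
            using inF idx * same by metis
          then show False using x same unfolding b'_def by auto
        qed
        then have "t = t'" "i = i'" using same(2) by (auto, metis div_mult_mod_eq)
        then show False using uv eq by simp
      qed
      then show "(case u of (t, i) \<Rightarrow> b' t i) \<inter> (case v of (t, i) \<Rightarrow> b' t i) = {}" by (simp add: eq)
    qed
    show "(\<Union>t\<in>{..<M}. \<Union>i<p * q. b' t i) = S"
    proof
      show "(\<Union>t\<in>{..<M}. \<Union>i<p * q. b' t i) \<subseteq> S" using b'C C_sub by blast
      show "S \<subseteq> (\<Union>t\<in>{..<M}. \<Union>i<p * q. b' t i)"
      proof
        fix x assume "x \<in> S"
        moreover have "S = (\<Union>r\<in>I. \<Union>i<p. d r i)" using d by (simp add: kr_def)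
        ultimately obtain r i where ri: "r \<in> I" "i < p" "x \<in> d r i" by auto
        have "(\<Union>x\<in>F r. D r i x) = d r i" using D0[OF ri(1,2)] by blast
        then obtain u where "u \<in> F r" "x \<in> D r i u" using ri(3) by blast
        then obtain t l where tl: "(t, l) \<in> F r" "x \<in> D r i (t, l)" by (cases u) auto
        have "t < M" "l < q" "w t ! l = r" using tl by (auto simp: F_def)
        moreover have "(l * p + i) div p = l" "(l * p + i) mod p = i" using ri(2) by auto
        moreover have "l * p + i < p * q"
        proof -
          have "l * p + i < Suc l * p" using ri(2) by simp
          also have "\<dots> \<le> q * p" using \<open>l < q\<close> by (intro mult_le_mono1) simp
          finally show ?thesis by (simp add: mult.commute)
        qed
        ultimately have "x \<in> b' t (l * p + i)" "t < M" "l * p + i < p * q" using tl by (auto simp: b'_def)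
        then show "x \<in> (\<Union>t\<in>{..<M}. \<Union>i<p * q. b' t i)" by blast
      qed
    qed
    fix t i k assume "t \<in> {..<M}" "i < p * q" "k \<in> K"
    then show "m k (b' t 0) = m k (b' t i)" using b'm p q by simp
  qed (use b'C in auto)
  then show ?thesis using b'ne b'd by blast
qed

text \<open>Splitting along \<open>U\<close> and \<open>V\<close> turns the equality of their
  measures into a relation between base measures, whose coefficients are the differences of level
  counts. Kernel vectors of this relation, used as letter counts, equalize the counts in each new
  tower.\<close>

lemma kr_step:
  assumes b: "kr {..<M} p b" and M: "M \<ge> 2" and ne: "\<forall>t<M. \<forall>i<p. b t i \<noteq> {}"
    and U: "U \<in> C" and V: "V \<in> C"
  shows "\<exists>M' q w b'. M' \<ge> (2::nat) \<and> kr {..<M'} (p * q) b' \<and>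
     (\<forall>t<M'. length (w t) = q \<and> marked_word (w t) \<and> set (w t) = {..<M}) \<and> inj_on w {..<M'} \<and>
     (\<forall>t<M'. \<forall>i<p * q. b' t i \<noteq> {} \<and> b' t i \<subseteq> b (w t ! (i div p)) (i mod p) \<and>
         (b' t i \<subseteq> U \<or> b' t i \<inter> U = {}) \<and> (b' t i \<subseteq> V \<or> b' t i \<inter> V = {})) \<and>
     ((\<forall>k\<in>K. m k U = m k V) \<longrightarrow>
        (\<forall>t<M'. card {i. i < p * q \<and> b' t i \<subseteq> U} = card {i. i < p * q \<and> b' t i \<subseteq> V}))"
proof -
  have p: "p > 0" using b by (simp add: kr_def)
  obtain d1 where d1: "kr ({..<M} \<times> Pow {..<p}) p d1"
    "\<forall>t\<in>{..<M} \<times> Pow {..<p}. \<forall>i<p. d1 t i \<subseteq> b (fst t) i \<and> (d1 t i \<subseteq> U \<or> d1 t i \<inter> U = {})"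
    using kr_split[OF b U] by blast
  let ?I2 = "({..<M} \<times> Pow {..<p}) \<times> Pow {..<p}"
  obtain d where d: "kr ?I2 p d"
    "\<forall>t\<in>?I2. \<forall>i<p. d t i \<subseteq> d1 (fst t) i \<and> (d t i \<subseteq> V \<or> d t i \<inter> V = {})"
    using kr_split[OF d1(1) V] by blast
  define \<pi> :: "(nat \<times> nat set) \<times> nat set \<Rightarrow> nat" where "\<pi> t = fst (fst t)" for t
  \<comment> \<open>Splitting may produce empty towers; they are dropped because the kernel
    decomposition needs nonempty bases.\<close>
  define I where "I = {t\<in>?I2. d t 0 \<noteq> {}}"
  have dI2: "d t i \<in> C" "\<And>k. k \<in> K \<Longrightarrow> m k (d t 0) = m k (d t i)" if "t \<in> ?I2" "i < p" for t i
    using d(1) that unfolding kr_def by blast+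
  have dne: "d t i \<noteq> {} \<longleftrightarrow> t \<in> I" if "t \<in> ?I2" "i < p" for t i
    using nonempty_cong[OF dI2(1)[OF that(1) p] dI2(1)[OF that] dI2(2)[OF that]] that by (auto simp: I_def)
  have finI: "finite I" using d(1) by (auto simp: I_def kr_def)
  have I_sub: "t \<in> ?I2" if "t \<in> I" for t using that unfolding I_def by blast
  have dcov: "(\<Union>t\<in>?I2. \<Union>i<p. d t i) = S" using d(1) by (simp add: kr_def)
  have krI: "kr I p d"
    unfolding kr_def
  proof (intro conjI)
    show "disjoint_family_on (\<lambda>(t, i). d t i) (I \<times> {..<p})"
      using d(1) unfolding kr_def by (elim conjE disjoint_family_on_mono[rotated]) (use I_sub in blast)
    have "(\<Union>t\<in>I. \<Union>i<p. d t i) = (\<Union>t\<in>?I2. \<Union>i<p. d t i)" using dne I_sub by blast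
    then show "(\<Union>t\<in>I. \<Union>i<p. d t i) = S" using dcov by simp
    show "\<forall>t\<in>I. \<forall>i<p. d t i \<in> C" "\<forall>t\<in>I. \<forall>i<p. \<forall>k\<in>K. m k (d t 0) = m k (d t i)"
      using dI2 I_sub by blast+
  qed (use finI p in auto)
  have d_sub: "d t i \<subseteq> b (\<pi> t) i" and dU: "d t i \<subseteq> U \<or> d t i \<inter> U = {}" and dV: "d t i \<subseteq> V \<or> d t i \<inter> V = {}"
    and d_ne: "d t i \<noteq> {}" if t: "t \<in> I" and i: "i < p" for t i
  proof -
    have t2: "t \<in> ?I2" using I_sub t .
    then have t1: "fst t \<in> {..<M} \<times> Pow {..<p}" by auto
    show "d t i \<noteq> {}" using dne[OF t2 i] t by blast
    have 1: "d t i \<subseteq> d1 (fst t) i" "d t i \<subseteq> V \<or> d t i \<inter> V = {}" using d(2)[rule_format, OF t2 i] by simp_all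
    have 2: "d1 (fst t) i \<subseteq> b (fst (fst t)) i" "d1 (fst t) i \<subseteq> U \<or> d1 (fst t) i \<inter> U = {}"
      using d1(2)[rule_format, OF t1 i] by simp_all
    show "d t i \<subseteq> b (\<pi> t) i" "d t i \<subseteq> U \<or> d t i \<inter> U = {}" "d t i \<subseteq> V \<or> d t i \<inter> V = {}"
      using 1 2 by (auto simp: \<pi>_def)
  qed
  \<comment> \<open>Every old tower keeps a nonempty part, so the letters 0 and 1 needed for the
    marking exist and each new word visits all old towers.\<close>
  have \<pi>_img: "\<pi> ` I = {..<M}"
  proof
    show "\<pi> ` I \<subseteq> {..<M}" by (auto simp: \<pi>_def I_def)
    show "{..<M} \<subseteq> \<pi> ` I"
    proof
      fix t assume t: "t \<in> {..<M}"
      have b0: "b t 0 \<in> C" using b t p by (simp add: kr_def)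
      obtain x where x: "x \<in> b t 0" using ne t p by auto
      then have "x \<in> S" using C_sub b0 by auto
      moreover have "S = (\<Union>r\<in>I. \<Union>i<p. d r i)" using krI by (simp add: kr_def)
      ultimately obtain r i where r: "r \<in> I" "i < p" "x \<in> d r i" by auto
      then have "x \<in> b (\<pi> r) i" using d_sub by blast
      moreover have "\<pi> r \<in> {..<M}" using r by (auto simp: \<pi>_def I_def)
      ultimately have "\<pi> r = t" using kr_unique[OF b] t r(2) p x by blast
      then show "t \<in> \<pi> ` I" using r by blast
    qed
  qed
  define cU where "cU r = card {i. i < p \<and> d r i \<subseteq> U}" for r
  define cV where "cV r = card {i. i < p \<and> d r i \<subseteq> V}" for r
  \<comment> \<open>If \<open>U\<close> and \<open>V\<close> differ on \<open>K\<close>, the zero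
    relation is used, so that both cases take the same path.\<close>
  define \<delta> where "\<delta> r = (if \<forall>k\<in>K. m k U = m k V then int (cU r) - int (cV r) else 0)" for r
  have rel: "\<forall>k\<in>K. (\<Sum>r\<in>I. of_int (\<delta> r) * m k (d r 0)) = 0"
  proof
    fix k assume k: "k \<in> K"
    show "(\<Sum>r\<in>I. of_int (\<delta> r) * m k (d r 0)) = 0"
    proof (cases "\<forall>k\<in>K. m k U = m k V")
      case True
      have "m k U = (\<Sum>r\<in>I. real (cU r) * m k (d r 0))"
        unfolding cU_def by (rule kr_count[OF krI k U]) (use dU in blast)
      moreover have "m k V = (\<Sum>r\<in>I. real (cV r) * m k (d r 0))"
        unfolding cV_def by (rule kr_count[OF krI k V]) (use dV in blast)
      moreover have "m k U = m k V" using True k by blast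
      moreover have "\<delta> r = int (cU r) - int (cV r)" for r using True by (simp add: \<delta>_def)
      ultimately show ?thesis by (simp add: left_diff_distrib sum_subtractf)
    next
      case False
      then have "\<delta> r = 0" for r unfolding \<delta>_def by (rule if_not_P)
      then show ?thesis by simp
    qed
  qed
  have tot: "\<forall>k\<in>K. (\<Sum>r\<in>I. m k (d r 0)) = 1 / real p" using kr_sum[OF krI] by blast
  have dis: "disjoint_family_on (\<lambda>r. d r 0) I"
    using kr_unique[OF krI _ _ p p] unfolding disjoint_family_on_def by blast
  have d0: "\<forall>r\<in>I. d r 0 \<in> C \<and> d r 0 \<noteq> {}" using d_ne p krI by (auto simp: kr_def)
  obtain i0 where i0: "i0 \<in> I" "\<pi> i0 = 0" using \<pi>_img M by (metis image_iff lessThan_iff less_le_trans zero_less_numeral)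
  obtain i1 where i1: "i1 \<in> I" "\<pi> i1 = 1" using \<pi>_img M by (metis image_iff lessThan_iff less_le_trans one_less_numeral_iff semiring_norm(76))
  have "I \<noteq> {}" using i0 by blast
  from decompose_kernel_uniform[OF finI this d0 dis tot rel]
  obtain M' q N e where *: "M' \<ge> (2::nat) \<and> (\<forall>t<M'. e t \<in> C \<and> e t \<noteq> {}) \<and>
           (\<forall>t<M'. \<forall>j\<in>I. M' + 3 \<le> N t j) \<and> (\<forall>t<M'. (\<Sum>j\<in>I. N t j) = q) \<and>
           (\<forall>j\<in>I. \<forall>k\<in>K. (\<Sum>t<M'. real (N t j) * m k (e t)) = m k (d j 0)) \<and>
           (\<forall>t<M'. (\<Sum>j\<in>I. \<delta> j * int (N t j)) = 0)"
    by (elim exE) (rule that)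
  have M': "M' \<ge> 2" and e: "\<And>t. t < M' \<Longrightarrow> e t \<in> C" "\<And>t. t < M' \<Longrightarrow> e t \<noteq> {}"
    and N: "\<And>t j. t < M' \<Longrightarrow> j \<in> I \<Longrightarrow> M' + 3 \<le> N t j" and Nq: "\<And>t. t < M' \<Longrightarrow> (\<Sum>j\<in>I. N t j) = q"
    and sums: "\<And>j k. j \<in> I \<Longrightarrow> k \<in> K \<Longrightarrow> (\<Sum>t<M'. real (N t j) * m k (e t)) = m k (d j 0)"
    and rel': "\<And>t. t < M' \<Longrightarrow> (\<Sum>j\<in>I. \<delta> j * int (N t j)) = 0"
    using * by blast+
  \<comment> \<open>The label is \<open>Suc t\<close> because labels have to be positive; it stays
    below the counts, which are at least \<open>M' + 3\<close>.\<close>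
  have "\<exists>xs. (\<forall>j\<in>I. count_list xs j = N t j) \<and> set xs \<subseteq> I \<and> length xs = (\<Sum>j\<in>I. N t j) \<and>
              marked_word (map \<pi> xs) \<and> word_label (map \<pi> xs) = Suc t" if t: "t < M'" for t
    by (rule word_with_counts[OF finI i0 _ i1]) (use N[OF t i0(1)] N[OF t i1(1)] t in auto)
  then obtain xs where xs0: "\<And>t. t < M' \<Longrightarrow> (\<forall>j\<in>I. count_list (xs t) j = N t j) \<and> set (xs t) \<subseteq> I \<and>
       length (xs t) = (\<Sum>j\<in>I. N t j) \<and> marked_word (map \<pi> (xs t)) \<and> word_label (map \<pi> (xs t)) = Suc t"
    by metis
  have xs: "\<And>t j. t < M' \<Longrightarrow> j \<in> I \<Longrightarrow> count_list (xs t) j = N t j" "\<And>t. t < M' \<Longrightarrow> length (xs t) = q"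
    "\<And>t. t < M' \<Longrightarrow> marked_word (map \<pi> (xs t))" "\<And>t. t < M' \<Longrightarrow> word_label (map \<pi> (xs t)) = Suc t"
    using xs0 Nq by simp_all
  have set_xs: "set (xs t) = I" if t: "t < M'" for t
  proof -
    have "j \<in> set (xs t)" if "j \<in> I" for j
      using xs(1)[OF t that] N[OF t that] count_list_0_iff[of "xs t" j] by auto
    then show ?thesis using xs0[OF t] by blast
  qed
  have q: "q > 0" using xs(2)[of 0] set_xs[of 0] i0 M' by auto
  have "\<exists>b'. kr {..<M'} (p * q) b' \<and> (\<forall>t<M'. \<forall>i<p * q. b' t i \<noteq> {} \<and> b' t i \<subseteq> d (xs t ! (i div p)) (i mod p))"
    by (rule kr_concat[OF krI d_ne _ xs(2) set_xs q e]) (use M' sums xs(1) in auto)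
  then obtain b' where b': "kr {..<M'} (p * q) b'" "\<And>t i. t < M' \<Longrightarrow> i < p * q \<Longrightarrow> b' t i \<noteq> {}"
    "\<And>t i. t < M' \<Longrightarrow> i < p * q \<Longrightarrow> b' t i \<subseteq> d (xs t ! (i div p)) (i mod p)" by blast
  have idx: "i div p < q" "i mod p < p" if "i < p * q" for i
    using that p by (auto simp: less_mult_imp_div_less mult.commute)
  have xsI: "xs t ! (i div p) \<in> I" if "t < M'" "i < p * q" for t i
    using nth_mem[of "i div p" "xs t"] idx[OF that(2)] xs(2)[OF that(1)] set_xs[OF that(1)] by simp
  have card_eq: "card {i. i < p * q \<and> b' t i \<subseteq> W} = (\<Sum>r\<in>I. N t r * card {i. i < p \<and> d r i \<subseteq> W})"
    if t: "t < M'" and W: "\<And>r i. r \<in> I \<Longrightarrow> i < p \<Longrightarrow> d r i \<subseteq> W \<or> d r i \<inter> W = {}" for t W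
  proof -
    have iff: "b' t i \<subseteq> W \<longleftrightarrow> d (xs t ! (i div p)) (i mod p) \<subseteq> W" if "i < p * q" for i
      using b'(2,3)[OF t that] W[OF xsI[OF t that] idx(2)[OF that]] by blast
    have card_of_bool: "card {i. i < n \<and> Q i} = (\<Sum>i<n. of_bool (Q i))" for n :: nat and Q
      by (simp add: Int_def flip: lessThan_def)
    have "card {i. i < p * q \<and> b' t i \<subseteq> W} = (\<Sum>i<p * q. of_bool (d (xs t ! (i div p)) (i mod p) \<subseteq> W))"
      unfolding card_of_bool using iff by (intro sum.cong) auto
    also have "\<dots> = (\<Sum>l<q. \<Sum>i<p. of_bool (d (xs t ! l) i \<subseteq> W))"
      unfolding sum_blocks by (intro sum.cong) auto
    also have "\<dots> = (\<Sum>l<q. card {i. i < p \<and> d (xs t ! l) i \<subseteq> W})"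
      unfolding card_of_bool ..
    also have "\<dots> = sum_list (map (\<lambda>r. card {i. i < p \<and> d r i \<subseteq> W}) (xs t))"
      using xs(2)[OF t] by (simp add: sum_list_sum_nth atLeast0LessThan)
    also have "\<dots> = (\<Sum>r\<in>I. N t r * card {i. i < p \<and> d r i \<subseteq> W})"
      unfolding sum_list_map_eq_sum_count set_xs[OF t] using xs(1)[OF t] by (intro sum.cong) auto
    finally show ?thesis .
  qed
  show ?thesis
  proof (rule exI[of _ M'], rule exI[of _ q], rule exI[of _ "\<lambda>t. map \<pi> (xs t)"], rule exI[of _ b'],
      intro conjI allI impI)
    show "inj_on (\<lambda>t. map \<pi> (xs t)) {..<M'}"
      using xs(4) by (intro inj_onI) (metis Suc_inject lessThan_iff)
    fix t assume t: "t < M'"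
    show "set (map \<pi> (xs t)) = {..<M}" using set_xs[OF t] \<pi>_img by simp
    { fix i assume i: "i < p * q"
      note sub = b'(3)[OF t i] and r = xsI[OF t i] idx(2)[OF i]
      show "b' t i \<noteq> {}" using b'(2)[OF t i] .
      show "b' t i \<subseteq> b (map \<pi> (xs t) ! (i div p)) (i mod p)"
        using sub d_sub[OF r] idx(1)[OF i] xs(2)[OF t] by auto
      show "b' t i \<subseteq> U \<or> b' t i \<inter> U = {}" "b' t i \<subseteq> V \<or> b' t i \<inter> V = {}"
        using sub dU[OF r] dV[OF r] by blast+ }
    assume eqv: "\<forall>k\<in>K. m k U = m k V"
    have "int (card {i. i < p * q \<and> b' t i \<subseteq> U}) - int (card {i. i < p * q \<and> b' t i \<subseteq> V}) =
          (\<Sum>r\<in>I. int (N t r) * int (cU r)) - (\<Sum>r\<in>I. int (N t r) * int (cV r))"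
      using card_eq[OF t dU] card_eq[OF t dV] by (simp add: cU_def cV_def)
    also have "\<dots> = (\<Sum>r\<in>I. \<delta> r * int (N t r))"
      using eqv by (simp add: \<delta>_def algebra_simps flip: sum_subtractf)
    finally show "card {i. i < p * q \<and> b' t i \<subseteq> U} = card {i. i < p * q \<and> b' t i \<subseteq> V}"
      using rel'[OF t] by simp
  qed (use M' b'(1) xs in auto)
qed

end

section \<open>The homeomorphism defined by a sequence of towers\<close>

text \<open>Tower \<open>t\<close> of stage \<open>Suc n\<close> is spelled by the word
  \<open>w n t\<close>, of length \<open>q n\<close>. Measures are absent: the dynamics depends on
  this combinatorial data alone. By \<open>decided\<close> the levels eventually resolve every
  clopen set and hence separate points.\<close>

locale tower_sequence =
  fixes X :: "'a topology" and M p q :: "nat \<Rightarrow> nat" and b :: "nat \<Rightarrow> nat \<Rightarrow> nat \<Rightarrow> 'a set"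
    and w :: "nat \<Rightarrow> nat \<Rightarrow> nat list"
  assumes compact: "compact_space X" and haus: "Hausdorff_space X"
    and clopen_base: "\<And>U x. openin X U \<Longrightarrow> x \<in> U \<Longrightarrow> \<exists>V. clopenin X V \<and> x \<in> V \<and> V \<subseteq> U"
    and M2: "\<And>n. M n \<ge> 2" and M0: "M 0 = 2" and p0: "p 0 = 1" and p_Suc: "\<And>n. p (Suc n) = p n * q n"
    and clopen: "\<And>n t i. t < M n \<Longrightarrow> i < p n \<Longrightarrow> clopenin X (b n t i)"
    and nonempty: "\<And>n t i. t < M n \<Longrightarrow> i < p n \<Longrightarrow> b n t i \<noteq> {}"
    and cover: "\<And>n. (\<Union>t<M n. \<Union>i<p n. b n t i) = topspace X"
    and unique: "\<And>n t i t' i' x. t < M n \<Longrightarrow> t' < M n \<Longrightarrow> i < p n \<Longrightarrow> i' < p n \<Longrightarrow>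
                   x \<in> b n t i \<Longrightarrow> x \<in> b n t' i' \<Longrightarrow> t = t' \<and> i = i'"
    and w_len: "\<And>n t. t < M (Suc n) \<Longrightarrow> length (w n t) = q n"
    and w_marked: "\<And>n t. t < M (Suc n) \<Longrightarrow> marked_word (w n t)"
    and w_set: "\<And>n t. t < M (Suc n) \<Longrightarrow> set (w n t) = {..<M n}"
    and w_inj: "\<And>n. inj_on (w n) {..<M (Suc n)}"
    and sub: "\<And>n t i. t < M (Suc n) \<Longrightarrow> i < p (Suc n) \<Longrightarrow>
                b (Suc n) t i \<subseteq> b n (w n t ! (i div p n)) (i mod p n)"
    and decided: "\<And>U. clopenin X U \<Longrightarrow> \<exists>n. \<forall>t<M n. \<forall>i<p n. b n t i \<subseteq> U \<or> b n t i \<inter> U = {}"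
begin

section \<open>Tower addresses and the topology they generate\<close>

lemma q3: "q n \<ge> 3"
  using w_marked[of 0 n] w_len[of 0 n] M2[of "Suc n"] by (auto simp: marked_word_def)

lemma p_gt: "p n > n"
proof (induction n)
  case 0
  then show ?case by (simp add: p0)
next
  case (Suc n)
  have "p n * 3 \<le> p (Suc n)" unfolding p_Suc using q3 by (rule mult_le_mono2)
  then show ?case using Suc by simp
qed

lemma p_pos [simp]: "p n > 0" using p_gt[of n] by simp

lemma M_gt [simp]: "0 < M n" "Suc 0 < M n" using M2[of n] by auto

lemma idx: "i div p n < q n" "i mod p n < p n" if "i < p (Suc n)"
  using that by (auto simp: p_Suc less_mult_imp_div_less mult.commute)

lemma idx_less: "k < q n \<Longrightarrow> i < p n \<Longrightarrow> k * p n + i < p (Suc n)"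
  using mult_le_mono1[of "Suc k" "q n" "p n"] by (simp add: p_Suc mult.commute)

lemma w_first: "t < M (Suc n) \<Longrightarrow> w n t ! 0 = 0" and w_second: "t < M (Suc n) \<Longrightarrow> w n t ! 1 = 0"
  and w_last: "t < M (Suc n) \<Longrightarrow> w n t ! (q n - 1) = 1"
  using w_marked[of t n] w_len[of t n] by (auto simp: marked_word_def)

lemma w_less: "t < M (Suc n) \<Longrightarrow> k < q n \<Longrightarrow> w n t ! k < M n"
  using nth_mem[of k "w n t"] w_len[of t n] w_set[of t n] by simp

lemma b_sub: "t < M n \<Longrightarrow> i < p n \<Longrightarrow> b n t i \<subseteq> topspace X"
  using clopen[of t n i] by (auto simp: clopenin_def dest: openin_subset)

text \<open>The address (tower, level) of a point at stage \<open>n\<close>; continuity and equality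
  of points are reduced to addresses.\<close>

definition ad :: "nat \<Rightarrow> 'a \<Rightarrow> nat \<times> nat" where
  "ad n x = (SOME (t, i). t < M n \<and> i < p n \<and> x \<in> b n t i)"

lemma ad_eqI: "t < M n \<Longrightarrow> i < p n \<Longrightarrow> x \<in> b n t i \<Longrightarrow> ad n x = (t, i)"
  unfolding ad_def by (rule some_equality) (use unique in auto)

lemma ad_cases:
  assumes "x \<in> topspace X"
  obtains t i where "t < M n" "i < p n" "x \<in> b n t i" "ad n x = (t, i)"
proof -
  obtain t i where "t < M n" "i < p n" "x \<in> b n t i"
    using assms cover[of n] by blast
  then show ?thesis using that ad_eqI by blast
qed

lemma ad_less: "x \<in> topspace X \<Longrightarrow> ad n x = (t, i) \<Longrightarrow> t < M n \<and> i < p n"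
  by (rule ad_cases[of x n]) auto

lemma ad_iff: "x \<in> topspace X \<Longrightarrow> t < M n \<Longrightarrow> i < p n \<Longrightarrow> ad n x = (t, i) \<longleftrightarrow> x \<in> b n t i"
  using ad_eqI[of t n i x] ad_cases[of x n] by (metis prod.inject)

lemma ad_Suc:
  assumes "x \<in> topspace X" "ad (Suc n) x = (t, i)"
  shows "ad n x = (w n t ! (i div p n), i mod p n)"
proof -
  have ti: "t < M (Suc n)" "i < p (Suc n)" using ad_less[OF assms] by auto
  then have "x \<in> b (Suc n) t i" using ad_iff[OF assms(1)] assms(2) by blast
  then show ?thesis using sub[OF ti] ti idx[of i n] w_less by (intro ad_eqI) auto
qed

lemma ad_mono: "x \<in> topspace X \<Longrightarrow> y \<in> topspace X \<Longrightarrow> ad n x = ad n y \<Longrightarrow> l \<le> n \<Longrightarrow> ad l x = ad l y"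
proof (induction n)
  case (Suc n)
  show ?case
  proof (cases "l = Suc n")
    case False
    obtain t i where "ad (Suc n) x = (t, i)" by fastforce
    then have "ad n x = ad n y" using ad_Suc Suc.prems by metis
    then show ?thesis using Suc False by simp
  qed (use Suc in simp)
qed simp

lemma clopen_decided:
  assumes "clopenin X U"
  shows "\<exists>n. \<forall>l\<ge>n. \<forall>x\<in>topspace X. \<forall>y\<in>topspace X. ad l x = ad l y \<longrightarrow> (x \<in> U \<longleftrightarrow> y \<in> U)"
proof -
  obtain n where n: "\<And>t i. t < M n \<Longrightarrow> i < p n \<Longrightarrow> b n t i \<subseteq> U \<or> b n t i \<inter> U = {}"
    using decided[OF assms] by blast
  have "x \<in> U \<longleftrightarrow> y \<in> U" if h: "n \<le> l" "x \<in> topspace X" "y \<in> topspace X" "ad l x = ad l y" for x y l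
  proof -
    obtain t i where ti: "t < M n" "i < p n" "x \<in> b n t i" "ad n x = (t, i)"
      using ad_cases[OF h(2)] .
    moreover have "ad n x = ad n y" using ad_mono h by blast
    ultimately have "y \<in> b n t i" using ad_iff[OF h(3) ti(1,2)] by simp
    then show ?thesis using n[OF ti(1,2)] ti(3) by blast
  qed
  then show ?thesis by blast
qed

lemma separation:
  assumes "x \<in> topspace X" "y \<in> topspace X" "\<And>n. ad n x = ad n y"
  shows "x = y"
proof (rule ccontr)
  assume "x \<noteq> y"
  then obtain U where "openin X U" "x \<in> U" "y \<notin> U"
    using haus assms(1,2) by (metis Hausdorff_space_def disjnt_iff)
  then obtain V where V: "clopenin X V" "x \<in> V" "y \<notin> V" using clopen_base by blast
  then show False using clopen_decided[OF V(1)] assms by blast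
qed

lemma continuous_map_adI:
  assumes f: "f \<in> topspace X \<rightarrow> topspace X"
    and "\<And>n. \<exists>l. \<forall>x\<in>topspace X. \<forall>y\<in>topspace X. ad l x = ad l y \<longrightarrow> ad n (f x) = ad n (f y)"
  shows "continuous_map X X f"
  unfolding continuous_map_def
proof (intro conjI f allI impI)
  fix U assume U: "openin X U"
  show "openin X {x \<in> topspace X. f x \<in> U}"
  proof (subst openin_subopen, safe)
    fix x assume x: "x \<in> topspace X" "f x \<in> U"
    obtain V where V: "clopenin X V" "f x \<in> V" "V \<subseteq> U" using clopen_base[OF U x(2)] by blast
    obtain n where n: "\<And>x y. x \<in> topspace X \<Longrightarrow> y \<in> topspace X \<Longrightarrow> ad n x = ad n y \<Longrightarrow> (x \<in> V \<longleftrightarrow> y \<in> V)"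
      using clopen_decided[OF V(1)] by blast
    obtain l where l: "\<And>x y. x \<in> topspace X \<Longrightarrow> y \<in> topspace X \<Longrightarrow> ad l x = ad l y \<Longrightarrow> ad n (f x) = ad n (f y)"
      using assms(2) by blast
    obtain t i where ti: "t < M l" "i < p l" "x \<in> b l t i" "ad l x = (t, i)"
      using ad_cases[OF x(1)] .
    have "b l t i \<subseteq> {x \<in> topspace X. f x \<in> U}"
    proof
      fix y assume y: "y \<in> b l t i"
      then have y': "y \<in> topspace X" using b_sub ti by blast
      then have "ad l x = ad l y" using ad_iff[OF y' ti(1,2)] ti(4) y by simp
      then have "f y \<in> V" using n[of "f x" "f y"] l[OF x(1) y'] f x(1) y' V(2) by auto
      then show "y \<in> {x \<in> topspace X. f x \<in> U}" using y' V(3) by blast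
    qed
    moreover have "openin X (b l t i)" using clopen[OF ti(1,2)] by (simp add: clopenin_def)
    ultimately show "\<exists>T. openin X T \<and> x \<in> T \<and> T \<subseteq> {x \<in> topspace X. f x \<in> U}" using ti(3) by blast
  qed
qed

section \<open>The map and its bijectivity\<close>

definition bot :: "nat \<Rightarrow> 'a set" where "bot n = (\<Union>t<M n. b n t 0)"

text \<open>What stage \<open>n\<close> knows about the image of \<open>x\<close>: the exact next
  level below the top, but only the union of all bottoms at the top.\<close>

definition nxt :: "nat \<Rightarrow> 'a \<Rightarrow> 'a set" where
  "nxt n x = (case ad n x of (t, i) \<Rightarrow> if Suc i < p n then b n t (Suc i) else bot n)"

lemma b00_bot: "b n 0 0 \<subseteq> bot n"
  unfolding bot_def by (rule UN_upper) (simp add: M_gt)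

lemma bot_iff: "x \<in> bot n \<longleftrightarrow> x \<in> topspace X \<and> snd (ad n x) = 0"
proof
  assume "x \<in> bot n"
  then obtain t where "t < M n" "x \<in> b n t 0" by (auto simp: bot_def)
  then show "x \<in> topspace X \<and> snd (ad n x) = 0" using ad_eqI[of t n 0 x] b_sub[of t n 0] by auto
next
  assume x: "x \<in> topspace X \<and> snd (ad n x) = 0"
  then obtain t i where "t < M n" "i < p n" "x \<in> b n t i" "ad n x = (t, i)" using ad_cases by blast
  then show "x \<in> bot n" using x by (auto simp: bot_def)
qed

lemma bot_Suc: "bot (Suc n) \<subseteq> b n 0 0"
proof
  fix x assume "x \<in> bot (Suc n)"
  then obtain t where "t < M (Suc n)" "x \<in> b (Suc n) t 0" by (auto simp: bot_def)
  then show "x \<in> b n 0 0" using sub[of t n 0] w_first by auto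
qed

text \<open>A top of stage \<open>Suc n\<close> is sent into \<open>bot (Suc n)\<close>, which lies
  in the single level \<open>b n 0 0\<close> because all words begin with 0. The ambiguity at the
  top thus disappears when one looks one stage further.\<close>

lemma nxt_Suc:
  assumes x: "x \<in> topspace X"
  shows "nxt (Suc n) x \<subseteq> nxt n x \<and> (\<exists>t<M n. \<exists>i<p n. nxt (Suc n) x \<subseteq> b n t i)"
proof -
  obtain t i where ti: "t < M (Suc n)" "i < p (Suc n)" "ad (Suc n) x = (t, i)"
    using ad_cases[OF x] .
  note adn = ad_Suc[OF x ti(3)]
  show ?thesis
  proof (cases "Suc i < p (Suc n)")
    case True
    then have nS: "nxt (Suc n) x = b (Suc n) t (Suc i)" using ti by (simp add: nxt_def)
    have s: "b (Suc n) t (Suc i) \<subseteq> b n (w n t ! (Suc i div p n)) (Suc i mod p n)" using sub ti True by blast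
    have 1: "w n t ! (Suc i div p n) < M n" "Suc i mod p n < p n" using w_less ti idx[OF True] by auto
    have "b n (w n t ! (Suc i div p n)) (Suc i mod p n) \<subseteq> nxt n x"
    proof (cases "Suc (i mod p n) < p n")
      case T: True
      then have "Suc i mod p n = Suc (i mod p n)" "Suc i div p n = i div p n"
        by (simp_all add: mod_Suc div_Suc)
      then show ?thesis using adn T by (simp add: nxt_def)
    next
      case False
      then have "Suc (i mod p n) = p n" using idx(2)[OF ti(2)] by linarith
      then have "Suc i mod p n = 0" by (simp add: mod_Suc)
      then show ?thesis using adn False 1 by (auto simp: nxt_def bot_def)
    qed
    then show ?thesis using nS s 1 by blast
  next
    case False
    then have nS: "nxt (Suc n) x = bot (Suc n)" using ti by (simp add: nxt_def)
    have "Suc i = q n * p n" using False ti(2) by (simp add: p_Suc mult.commute)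
    then have "Suc i mod p n = 0" by simp
    then have "\<not> Suc (i mod p n) < p n" by (simp add: mod_Suc split: if_splits)
    then have "nxt n x = bot n" using adn by (simp add: nxt_def)
    then show ?thesis using b00_bot[of n] nS bot_Suc[of n] M_gt[of n] p_pos[of n] by blast
  qed
qed

lemma nxt_closed_nonempty:
  assumes x: "x \<in> topspace X"
  shows "closedin X (nxt n x)" "nxt n x \<noteq> {}" "nxt n x \<subseteq> topspace X"
proof -
  obtain t i where ti: "t < M n" "i < p n" "ad n x = (t, i)" using ad_cases[OF x] .
  have cl: "closedin X (b n t i)" if "t < M n" "i < p n" for t i
    using clopen[OF that] by (simp add: clopenin_def)
  have "closedin X (bot n)" unfolding bot_def by (intro closedin_Union) (auto intro: cl)
  then show "closedin X (nxt n x)" using ti cl by (auto simp: nxt_def)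
  then show "nxt n x \<subseteq> topspace X" by (rule closedin_subset)
  show "nxt n x \<noteq> {}"
  proof (cases "Suc i < p n")
    case True
    then show ?thesis using nonempty[OF ti(1) True] ti(3) by (simp add: nxt_def)
  next
    case False
    then show ?thesis using b00_bot[of n] nonempty[of 0 n 0] ti(3) False by (auto simp: nxt_def)
  qed
qed

definition \<phi> :: "'a \<Rightarrow> 'a" where "\<phi> x = (SOME y. \<forall>n. y \<in> nxt n x)"

lemma \<phi>_nxt: "x \<in> topspace X \<Longrightarrow> \<phi> x \<in> nxt n x"
proof -
  assume x: "x \<in> topspace X"
  have "(\<Inter>n. nxt n x) \<noteq> {}"
    by (rule compact_space_imp_nest[OF compact]) (use nxt_closed_nonempty[OF x] nxt_Suc[OF x] in \<open>auto simp: decseq_Suc_iff\<close>)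
  then have "\<exists>y. \<forall>n. y \<in> nxt n x" by blast
  then show ?thesis unfolding \<phi>_def by (rule someI2_ex) blast
qed

lemma \<phi>_top [simp, intro]: "x \<in> topspace X \<Longrightarrow> \<phi> x \<in> topspace X"
  using \<phi>_nxt[of x 0] nxt_closed_nonempty(3)[of x 0] by blast

lemma ad_\<phi>: "x \<in> topspace X \<Longrightarrow> ad n x = (t, i) \<Longrightarrow> Suc i < p n \<Longrightarrow> ad n (\<phi> x) = (t, Suc i)"
  using \<phi>_nxt[of x n] ad_less[of x n t i] by (intro ad_eqI) (auto simp: nxt_def)

lemma ad_\<phi>_top: "x \<in> topspace X \<Longrightarrow> ad n x = (t, i) \<Longrightarrow> Suc i = p n \<Longrightarrow> snd (ad n (\<phi> x)) = 0"
  using \<phi>_nxt[of x n] bot_iff[of "\<phi> x" n] by (auto simp: nxt_def)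

lemma ad_\<phi>_cong:
  assumes "x \<in> topspace X" "y \<in> topspace X" "ad (Suc n) x = ad (Suc n) y"
  shows "ad n (\<phi> x) = ad n (\<phi> y)"
proof -
  obtain t i where ti: "t < M n" "i < p n" "nxt (Suc n) x \<subseteq> b n t i" using nxt_Suc[OF assms(1)] by blast
  have "nxt (Suc n) y = nxt (Suc n) x" using assms(3) by (simp add: nxt_def)
  then have "\<phi> x \<in> b n t i" "\<phi> y \<in> b n t i" using \<phi>_nxt assms ti by blast+
  then show ?thesis using ad_eqI ti by metis
qed

lemma continuous_\<phi>: "continuous_map X X \<phi>"
proof (rule continuous_map_adI)
  fix n
  show "\<exists>l. \<forall>x\<in>topspace X. \<forall>y\<in>topspace X. ad l x = ad l y \<longrightarrow> ad n (\<phi> x) = ad n (\<phi> y)"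
    using ad_\<phi>_cong by (intro exI[of _ "Suc n"]) blast
qed auto

lemma ad_pred:
  assumes x: "x \<in> topspace X" and "ad n (\<phi> x) = (t, Suc i)"
  shows "ad n x = (t, i)"
proof -
  obtain s j where s: "s < M n" "j < p n" "ad n x = (s, j)" using ad_cases[OF x] .
  show ?thesis
  proof (cases "Suc j < p n")
    case True
    then show ?thesis using ad_\<phi>[OF x s(3) True] assms(2) s by simp
  next
    case False
    then show ?thesis using ad_\<phi>_top[OF x s(3)] s assms(2) by simp
  qed
qed

lemma ad_pred_bot:
  assumes x: "x \<in> topspace X" and "ad n (\<phi> x) = (t, 0)"
  shows "snd (ad n x) = p n - 1"
proof -
  obtain s j where s: "s < M n" "j < p n" "ad n x = (s, j)" using ad_cases[OF x] .
  show ?thesis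
  proof (cases "Suc j < p n")
    case True
    then show ?thesis using ad_\<phi>[OF x s(3) True] assms(2) by simp
  qed (use s in simp)
qed

text \<open>The backward counterpart of \<open>bot_Suc\<close>: all words end with the letter 1, so
  the address of a preimage of a bottom point is determined as well. Injectivity rests on
  this.\<close>

lemma ad_top:
  assumes x: "x \<in> topspace X" and "snd (ad (Suc n) x) = p (Suc n) - 1"
  shows "ad n x = (1, p n - 1)"
proof -
  obtain t i where ti: "t < M (Suc n)" "i < p (Suc n)" "ad (Suc n) x = (t, i)"
    using ad_cases[OF x] .
  obtain c where c: "q n = Suc c" using q3[of n] by (cases "q n") auto
  have "i = q n * p n - 1" using assms(2) ti(3) by (simp add: p_Suc mult.commute)
  also have "\<dots> = c * p n + (p n - 1)"
    using p_pos[of n] unfolding c by (simp only: mult_Suc)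
  finally have i: "i = (q n - 1) * p n + (p n - 1)" by (simp add: c)
  have "p n - 1 < p n" using p_pos[of n] by simp
  then have "i div p n = q n - 1" "i mod p n = p n - 1" unfolding i by simp_all
  then show ?thesis using ad_Suc[OF x ti(3)] w_last[OF ti(1)] by simp
qed

lemma inj_\<phi>: "inj_on \<phi> (topspace X)"
proof (intro inj_onI separation)
  fix x y n assume xy: "x \<in> topspace X" "y \<in> topspace X" "\<phi> x = \<phi> y"
  obtain t i where ti: "ad (Suc n) (\<phi> x) = (t, i)" by fastforce
  show "ad n x = ad n y"
  proof (cases i)
    case 0
    then have "snd (ad (Suc n) x) = p (Suc n) - 1" "snd (ad (Suc n) y) = p (Suc n) - 1"
      using ad_pred_bot ti xy by metis+
    then show ?thesis using ad_top xy by metis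
  next
    case (Suc j)
    then have "ad (Suc n) x = (t, j)" "ad (Suc n) y = (t, j)" using ad_pred ti xy by metis+
    then show ?thesis using ad_mono[of x y "Suc n" n] xy by simp
  qed
qed

text \<open>Position 0 is excluded because \<open>surj_\<phi>\<close> needs a level below the
  occurrence; for the letter 0 the second position serves.\<close>

lemma letter_in_tower:
  assumes "t < M n" "s < M (Suc n)"
  shows "\<exists>k. 0 < k \<and> k < q n \<and> w n s ! k = t"
proof -
  have "t \<in> set (w n s)" using w_set assms by simp
  then obtain k where k: "k < q n" "w n s ! k = t" using w_len assms by (auto simp: in_set_conv_nth)
  show ?thesis
  proof (cases "k = 0")
    case True
    then have "t = 0" using k w_first assms by auto
    then show ?thesis using w_second assms q3[of n] by (intro exI[of _ 1]) auto
  qed (use k in auto)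
qed

lemma open_contains_atom:
  assumes "openin X U" "x \<in> U"
  shows "\<exists>n. \<exists>t<M n. \<exists>i<p n. x \<in> b n t i \<and> b n t i \<subseteq> U"
proof -
  obtain V where V: "clopenin X V" "x \<in> V" "V \<subseteq> U" using clopen_base[OF assms] by blast
  obtain n where n: "\<And>t i. t < M n \<Longrightarrow> i < p n \<Longrightarrow> b n t i \<subseteq> V \<or> b n t i \<inter> V = {}"
    using decided[OF V(1)] by blast
  have x: "x \<in> topspace X" using assms openin_subset by blast
  obtain t i where ti: "t < M n" "i < p n" "x \<in> b n t i" using ad_cases[OF x] by blast
  then show ?thesis using n[OF ti(1,2)] V by blast
qed

lemma dense_if_meets_atoms:
  assumes D: "D \<subseteq> topspace X" and "\<And>n t i. t < M n \<Longrightarrow> i < p n \<Longrightarrow> D \<inter> b n t i \<noteq> {}"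
  shows "X closure_of D = topspace X"
  unfolding closure_of_def using open_contains_atom assms by fast

text \<open>The image is compact, hence closed, so density suffices. A bottom level is reached
  because tower \<open>t\<close> also occurs in a tower of stage \<open>Suc n\<close> away from its
  bottom.\<close>

lemma surj_\<phi>: "\<phi> ` topspace X = topspace X"
proof -
  have "closedin X (\<phi> ` topspace X)"
    using compactin_imp_closedin[OF haus] image_compactin continuous_\<phi> compact compact_space_def by blast
  moreover have "X closure_of (\<phi> ` topspace X) = topspace X"
  proof (rule dense_if_meets_atoms)
    have suc: "\<phi> ` topspace X \<inter> b n t (Suc i) \<noteq> {}" if ti: "t < M n" "Suc i < p n" for n t i
    proof -
      have i: "i < p n" using ti by simp
      obtain x where x: "x \<in> b n t i" using nonempty[OF ti(1) i] by blast
      then have xX: "x \<in> topspace X" using b_sub[OF ti(1) i] by blast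
      have "\<phi> x \<in> b n t (Suc i)"
        using ad_\<phi>[OF xX ad_eqI[OF ti(1) i x] ti(2)] ad_iff[OF \<phi>_top[OF xX] ti] by simp
      then show ?thesis using xX by blast
    qed
    fix n t i assume ti: "t < M n" "i < p n"
    show "\<phi> ` topspace X \<inter> b n t i \<noteq> {}"
    proof (cases i)
      case 0
      obtain k where k: "0 < k" "k < q n" "w n 0 ! k = t" using letter_in_tower[OF ti(1) M_gt(1)] by blast
      define j where "j = k * p n - 1"
      have j: "Suc j = k * p n" using k p_pos[of n] by (simp add: j_def)
      have lt: "Suc j < p (Suc n)" using idx_less[OF k(2) p_pos[of n]] j by simp
      have "b (Suc n) 0 (Suc j) \<subseteq> b n t 0"
        using sub[OF M_gt(1)[of "Suc n"] lt] k(3) by (simp add: j)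
      then show ?thesis using suc[OF M_gt(1)[of "Suc n"] lt] 0 by blast
    qed (use suc ti in auto)
  qed auto
  ultimately show ?thesis using closure_of_eq by metis
qed

lemma homeo_\<phi>: "homeomorphic_map X X \<phi>"
  by (rule continuous_imp_homeomorphic_map) (use continuous_\<phi> compact haus surj_\<phi> inj_\<phi> in auto)

lemma vimage_\<phi>_atom:
  assumes "t < M n" "Suc i < p n"
  shows "\<phi> -` b n t (Suc i) \<inter> topspace X = b n t i"
proof -
  have i: "i < p n" using assms by simp
  have "\<phi> x \<in> b n t (Suc i) \<longleftrightarrow> x \<in> b n t i" if x: "x \<in> topspace X" for x
    using ad_iff[OF x assms(1) i] ad_iff[OF \<phi>_top[OF x] assms] ad_\<phi>[OF x _ assms(2)] ad_pred[OF x] by metis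
  then show ?thesis using b_sub[OF assms(1) i] by auto
qed

lemma vimage_\<phi>_bot: "\<phi> -` bot n \<inter> topspace X = (\<Union>t<M n. b n t (p n - 1))"
proof -
  have lt: "p n - 1 < p n" using p_pos[of n] by simp
  have "\<phi> x \<in> bot n \<longleftrightarrow> (\<exists>t<M n. x \<in> b n t (p n - 1))" if x: "x \<in> topspace X" for x
  proof -
    obtain t i where ti: "t < M n" "i < p n" "x \<in> b n t i" "ad n x = (t, i)" using ad_cases[OF x] .
    have "snd (ad n (\<phi> x)) = 0 \<longleftrightarrow> i = p n - 1"
    proof (cases "Suc i < p n")
      case True
      then show ?thesis using ad_\<phi>[OF x ti(4)] by simp
    next
      case False
      then show ?thesis using ad_\<phi>_top[OF x ti(4)] ti(2) by simp
    qed
    moreover have "(\<exists>t<M n. x \<in> b n t (p n - 1)) \<longleftrightarrow> i = p n - 1"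
      using ti unique lt by blast
    ultimately show ?thesis using bot_iff[of "\<phi> x" n] x by simp
  qed
  then show ?thesis using b_sub lt by blast
qed

definition \<psi> :: "'a \<Rightarrow> 'a" where "\<psi> = inv_into (topspace X) \<phi>"

lemma \<phi>_\<psi> [simp]: "x \<in> topspace X \<Longrightarrow> \<phi> (\<psi> x) = x"
  and \<psi>_\<phi> [simp]: "x \<in> topspace X \<Longrightarrow> \<psi> (\<phi> x) = x"
  and \<psi>_top [simp, intro]: "x \<in> topspace X \<Longrightarrow> \<psi> x \<in> topspace X"
  using surj_\<phi> inj_\<phi> by (auto simp: \<psi>_def f_inv_into_f inv_into_f_f) (metis inv_into_into)

lemma continuous_\<psi>: "continuous_map X X \<psi>"
proof -
  obtain g where g: "homeomorphic_maps X X \<phi> g" using homeo_\<phi> homeomorphic_map_maps by blast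
  then have "continuous_map X X g" by (simp add: homeomorphic_maps_def)
  then show ?thesis
  proof (rule continuous_map_eq)
    fix x assume x: "x \<in> topspace X"
    then have "\<phi> (g x) = x" "g x \<in> topspace X"
      using g by (auto simp: homeomorphic_maps_def dest: continuous_map_image_subset_topspace)
    then show "g x = \<psi> x" by (metis \<psi>_\<phi>)
  qed
qed

section \<open>Integer powers of the map and the addresses along an orbit\<close>

definition zpow :: "int \<Rightarrow> 'a \<Rightarrow> 'a" where
  "zpow k x = (if k \<ge> 0 then (\<phi> ^^ nat k) x else (\<psi> ^^ nat (- k)) x)"

lemma funpow_top:
  assumes "x \<in> topspace X" "\<And>x. x \<in> topspace X \<Longrightarrow> f x \<in> topspace X"
  shows "(f ^^ n) x \<in> topspace X"
  by (induction n) (use assms in auto)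

lemma zpow_top [simp, intro]: "x \<in> topspace X \<Longrightarrow> zpow k x \<in> topspace X"
  by (auto simp: zpow_def intro!: funpow_top)

lemma zpow_0 [simp]: "zpow 0 x = x" by (simp add: zpow_def)

lemma \<phi>_zpow: "x \<in> topspace X \<Longrightarrow> \<phi> (zpow k x) = zpow (k + 1) x"
proof (cases "k \<ge> 0")
  case True
  then show ?thesis by (simp add: zpow_def nat_add_distrib)
next
  case False
  assume x: "x \<in> topspace X"
  obtain n where n: "k = - int (Suc n)" using False by (metis int_cases linorder_not_less of_nat_0_le_iff)
  have "\<phi> (zpow k x) = \<phi> (\<psi> ((\<psi> ^^ n) x))" using n by (simp add: zpow_def nat_add_distrib)
  also have "\<dots> = (\<psi> ^^ n) x" by (intro \<phi>_\<psi> funpow_top x) auto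
  finally show ?thesis using n by (auto simp: zpow_def)
qed

lemma \<psi>_zpow: "x \<in> topspace X \<Longrightarrow> \<psi> (zpow k x) = zpow (k - 1) x"
  using \<phi>_zpow[of x "k - 1"] \<psi>_\<phi>[of "zpow (k - 1) x"] by simp

lemma zpow_add: "x \<in> topspace X \<Longrightarrow> zpow k (zpow l x) = zpow (k + l) x"
proof (induction k rule: int_induct[of _ 0])
  case (step1 i)
  then show ?case using \<phi>_zpow[of "zpow l x" i] \<phi>_zpow[of x "i + l"] by (simp add: algebra_simps)
next
  case (step2 i)
  then show ?case using \<psi>_zpow[of "zpow l x" i] \<psi>_zpow[of x "i + l"] by (simp add: algebra_simps)
qed simp

lemma continuous_zpow: "continuous_map X X (zpow k)"
proof -
  have "continuous_map X X (f ^^ n)" if "continuous_map X X f" for f n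
  proof (induction n)
    case (Suc n)
    from continuous_map_compose[OF Suc that] show ?case by (simp add: o_def)
  qed (simp add: id_def)
  then show ?thesis unfolding zpow_def using continuous_\<phi> continuous_\<psi> by simp
qed

lemma ad_zpow_up:
  assumes x: "x \<in> topspace X" and ad: "ad n x = (t, i)" and "i + j < p n"
  shows "ad n (zpow (int j) x) = (t, i + j)"
  using assms(3)
proof (induction j)
  case (Suc j)
  have "ad n (\<phi> (zpow (int j) x)) = (t, Suc (i + j))"
    by (rule ad_\<phi>) (use Suc x in auto)
  then show ?case using \<phi>_zpow[OF x, of "int j"] by (simp add: add.commute)
qed (simp add: ad)

lemma ad_zpow_down:
  assumes x: "x \<in> topspace X" and ad: "ad n x = (t, i)" and "j \<le> i"
  shows "ad n (zpow (- int j) x) = (t, i - j)"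
  using assms(3)
proof (induction j)
  case (Suc j)
  have "\<phi> (zpow (- int (Suc j)) x) = zpow (- int j) x" using \<phi>_zpow[OF x, of "- int (Suc j)"] by simp
  moreover have "i - j = Suc (i - Suc j)" using Suc by simp
  ultimately show ?case using ad_pred[of "zpow (- int (Suc j)) x" n t "i - Suc j"] x Suc by simp
qed (simp add: ad)

text \<open>A point at the bottom of a tower of level \<open>Suc n\<close> sees tower 0 of level \<open>n\<close> in its immediate
  future and tower 1 in its immediate past, whatever its own tower is.\<close>

lemma ad_around_bot:
  assumes x: "x \<in> topspace X" and bot: "snd (ad (Suc n) x) = 0"
    and m: "- int (p n) \<le> m" "m < int (p n)"
  shows "ad n (zpow m x) = (if m \<ge> 0 then (0, nat m) else (1, nat (int (p n) + m)))"
proof (cases "m \<ge> 0")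
  case True
  have "x \<in> b n 0 0" using bot_iff x bot bot_Suc by blast
  then have "ad n x = (0, 0)" by (intro ad_eqI) auto
  from ad_zpow_up[OF x this, of "nat m"] show ?thesis using True m by simp
next
  case False
  let ?y = "zpow (-1) x"
  have y: "?y \<in> topspace X" "\<phi> ?y = x" using x \<phi>_zpow[OF x, of "-1"] by auto
  have "snd (ad (Suc n) ?y) = p (Suc n) - 1"
    using ad_pred_bot[OF y(1), of "Suc n" "fst (ad (Suc n) x)"] y(2) bot by (simp add: prod_eq_iff)
  then have ad: "ad n ?y = (1, p n - 1)" by (rule ad_top[OF y(1)])
  have "ad n (zpow (- int (nat (- m - 1))) ?y) = (1, p n - 1 - nat (- m - 1))"
    by (rule ad_zpow_down[OF y(1) ad]) (use m in linarith)
  moreover have "zpow (- int (nat (- m - 1))) ?y = zpow m x" using zpow_add[OF x] False by simp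
  moreover have "p n - 1 - nat (- m - 1) = nat (int (p n) + m)" using False m by linarith
  ultimately show ?thesis using False by simp
qed

text \<open>As all towers of a stage have the same height, the level number advances by one modulo
  \<open>p n\<close> whatever the tower: an odometer factor. It yields both the Toeplitz periods and
  aperiodicity.\<close>

lemma phase:
  assumes x: "x \<in> topspace X"
  shows "int (snd (ad n (zpow k x))) = (int (snd (ad n x)) + k) mod int (p n)"
proof -
  have step: "int (snd (ad n (\<phi> y))) = (int (snd (ad n y)) + 1) mod int (p n)" if y: "y \<in> topspace X" for y
  proof -
    obtain t i where ti: "i < p n" "ad n y = (t, i)" using ad_cases[OF y] .
    show ?thesis
    proof (cases "Suc i < p n")
      case True
      then show ?thesis using ad_\<phi>[OF y ti(2)] ti by simp
    next
      case False
      then have eq: "Suc i = p n" using ti by simp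
      then have "(int i + 1) mod int (p n) = 0" by (metis mod_self of_nat_Suc add.commute)
      then show ?thesis using ad_\<phi>_top[OF y ti(2) eq] ti by simp
    qed
  qed
  have lt: "snd (ad n y) < p n" if "y \<in> topspace X" for y using ad_cases[OF that, of n] by fastforce
  show ?thesis
  proof (induction k rule: int_induct[of _ 0])
    case base
    then show ?case using lt[OF x] by simp
  next
    case (step1 i)
    then show ?case using step[of "zpow i x"] \<phi>_zpow[OF x, of i] x
      by (simp add: mod_add_left_eq add.assoc)
  next
    case (step2 i)
    let ?y = "zpow (i - 1) x"
    have "(int (snd (ad n ?y)) + 1) mod int (p n) = (int (snd (ad n x)) + i) mod int (p n)"
      using step[of ?y] \<phi>_zpow[OF x, of "i - 1"] step2 x by simp
    then have "(int (snd (ad n ?y)) + 1 - 1) mod int (p n) = (int (snd (ad n x)) + i - 1) mod int (p n)"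
      by (rule mod_diff_cong) simp
    then show ?case using lt[of ?y] x by (simp add: algebra_simps)
  qed
qed

section \<open>Symbolic coding of orbits\<close>

definition code :: "'a \<Rightarrow> int \<Rightarrow> nat" where
  "code x k = (if zpow k x \<in> b 0 0 0 then 0 else 1)"

text \<open>Stage 0 consists of two towers of height 1, so a letter of the code amounts to a stage 0
  address.\<close>

lemma code_eq_iff:
  assumes "x \<in> topspace X" "y \<in> topspace X"
  shows "code x k = code y l \<longleftrightarrow> ad 0 (zpow k x) = ad 0 (zpow l y)"
proof -
  have "ad 0 z = (if z \<in> b 0 0 0 then (0, 0) else (1, 0))" if z: "z \<in> topspace X" for z
  proof -
    obtain t i where "t < M 0" "i < p 0" "z \<in> b 0 t i" "ad 0 z = (t, i)" using ad_cases[OF z] .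
    then show ?thesis using ad_iff[OF z, of 0 0 0] by (auto simp: M0 p0 less_2_cases_iff)
  qed
  from this[of "zpow k x"] this[of "zpow l y"] show ?thesis using assms by (simp add: code_def)
qed

text \<open>Recognizability: the sequence of level \<open>n\<close> towers visited by the orbit of \<open>x\<close> determines when the
  orbit enters a tower of level \<open>Suc n\<close>, because a letter 0 following 1 and followed by 0
  only occurs at the beginning of a word.\<close>

lemma recognize_bot:
  assumes x: "x \<in> topspace X" and y: "y \<in> topspace X"
    and same: "\<And>k. ad n (zpow k x) = ad n (zpow k y)" and ad: "ad (Suc n) x = (t, 0)"
  shows "ad (Suc n) y = (t, 0)"
proof -
  have tM: "t < M (Suc n)" using ad_less[OF x ad] by simp
  obtain t' i' where ti': "t' < M (Suc n)" "i' < p (Suc n)" "ad (Suc n) y = (t', i')"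
    using ad_cases[OF y] .
  define k where "k = i' div p n"
  have around: "ad n (zpow m x) = (if m \<ge> 0 then (0, nat m) else (1, nat (int (p n) + m)))"
    if "- int (p n) \<le> m" "m < int (p n)" for m
    by (rule ad_around_bot[OF x _ that]) (simp add: ad)
  have k: "k < q n" using idx(1)[OF ti'(2)] by (simp add: k_def)
  have "ad n y = (0, 0)" using same[of 0] around[of 0] by simp
  then have w0: "w n t' ! k = 0" and "i' mod p n = 0" using ad_Suc[OF y ti'(3)] by (auto simp: k_def)
  then have i': "i' = k * p n" by (auto simp: k_def)
  have letter_y: "ad n (zpow (int (j * p n) - int i') y) = (w n t' ! j, 0)" if j: "j < q n" for j
  proof -
    have lt: "j * p n < p (Suc n)" using idx_less[OF j p_pos[of n]] by simp
    have "ad (Suc n) (zpow (int (j * p n) - int i') y) = (t', j * p n)"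
    proof (cases "i' \<le> j * p n")
      case True
      then show ?thesis using ad_zpow_up[OF y ti'(3), of "j * p n - i'"] lt by (simp add: of_nat_diff)
    next
      case False
      then show ?thesis using ad_zpow_down[OF y ti'(3), of "i' - j * p n"] by (simp add: of_nat_diff)
    qed
    from ad_Suc[OF zpow_top[OF y] this] show ?thesis by simp
  qed
  have letter_x: "ad n (zpow (int (j * p n)) x) = (w n t ! j, 0)" if j: "j < q n" for j
  proof -
    have lt: "j * p n < p (Suc n)" using idx_less[OF j p_pos[of n]] by simp
    have "ad (Suc n) (zpow (int (j * p n)) x) = (t, j * p n)"
      using ad_zpow_up[OF x ad, of "j * p n"] lt by simp
    from ad_Suc[OF zpow_top[OF x] this] show ?thesis by simp
  qed
  \<comment> \<open>\<open>y\<close> reads 0 at position \<open>k\<close>, while words end with 1;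
    so position \<open>Suc k\<close> still belongs to the same word.\<close>
  have "k \<noteq> q n - 1" using w0 w_last[OF ti'(1)] by auto
  then have Sk: "Suc k < q n" using k by simp
  have "ad n (zpow (int (p n)) y) = (w n t' ! Suc k, 0)"
    using letter_y[OF Sk] by (simp add: i' algebra_simps)
  moreover have "ad n (zpow (int (p n)) x) = (w n t ! 1, 0)"
    using letter_x[of 1] q3[of n] by simp
  ultimately have w1: "w n t' ! Suc k = 0" using same w_second[OF tM] by simp
  \<comment> \<open>Otherwise \<open>y\<close>, like \<open>x\<close>, sees the letters 1, 0, 0
    around its position, but inside a word, which the marking excludes.\<close>
  have "k = 0"
  proof (rule ccontr)
    assume k0: "k \<noteq> 0"
    then obtain l where l: "k = Suc l" by (cases k) auto
    have "ad n (zpow (- int (p n)) y) = (w n t' ! l, 0)"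
      using letter_y[of l] k by (simp add: i' l algebra_simps)
    moreover have "ad n (zpow (- int (p n)) x) = (1, 0)"
      using around[of "- int (p n)"] p_pos[of n] by simp
    ultimately have "w n t' ! (k - 1) = 1" using same l by simp
    moreover have "w n t' ! (k - 1) = 0"
      using w_marked[OF ti'(1)] w_len[OF ti'(1)] w0 w1 k0 Sk by (auto simp: marked_word_def)
    ultimately show False by simp
  qed
  then have i0: "i' = 0" using i' by simp
  have "w n t = w n t'"
  proof (rule nth_equalityI)
    show "length (w n t) = length (w n t')" using w_len tM ti' by simp
    fix j assume "j < length (w n t)"
    then have "j < q n" using w_len tM by simp
    then show "w n t ! j = w n t' ! j"
      using letter_x[of j] letter_y[of j] same[of "int (j * p n)"] i0 by simp
  qed
  then have "t = t'" using w_inj[of n] tM ti'(1) by (auto dest: inj_onD)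
  then show ?thesis using ti'(3) i0 by simp
qed

lemma recognize:
  assumes x: "x \<in> topspace X" and y: "y \<in> topspace X"
    and same: "\<And>k. ad n (zpow k x) = ad n (zpow k y)"
  shows "ad (Suc n) x = ad (Suc n) y"
proof -
  obtain t i where ti: "t < M (Suc n)" "i < p (Suc n)" "ad (Suc n) x = (t, i)" using ad_cases[OF x] .
  let ?x = "zpow (- int i) x" and ?y = "zpow (- int i) y"
  have "ad (Suc n) ?x = (t, 0)" using ad_zpow_down[OF x ti(3), of i] by simp
  moreover have "ad n (zpow k ?x) = ad n (zpow k ?y)" for k using same x y by (simp add: zpow_add)
  ultimately have "ad (Suc n) ?y = (t, 0)" using recognize_bot x y by blast
  then have "ad (Suc n) (zpow (int i) ?y) = (t, 0 + i)" using ti by (intro ad_zpow_up) (use y in auto)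
  then show ?thesis using ti y by (simp add: zpow_add)
qed

text \<open>Induction on the stage: the code gives the stage 0 addresses along the whole orbit, and
  \<open>recognize\<close>, applied at every orbit point, lifts equality from stage \<open>n\<close>
  to \<open>Suc n\<close>.\<close>

lemma code_inj: "inj_on code (topspace X)"
proof (rule inj_onI)
  fix x y assume xy: "x \<in> topspace X" "y \<in> topspace X" "code x = code y"
  have "\<forall>k. ad n (zpow k x) = ad n (zpow k y)" for n
  proof (induction n)
    case 0
    have "code x k = code y k" for k using xy by simp
    then show ?case using code_eq_iff xy by blast
  next
    case (Suc n)
    show ?case
    proof
      fix k
      have "ad n (zpow l (zpow k x)) = ad n (zpow l (zpow k y))" for l
        using Suc xy by (simp add: zpow_add)
      then show "ad (Suc n) (zpow k x) = ad (Suc n) (zpow k y)" using recognize xy by blast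
    qed
  qed
  then have "ad n (zpow 0 x) = ad n (zpow 0 y)" for n by blast
  then show "x = y" using separation[OF xy(1,2)] by simp
qed

lemma code_shift: "x \<in> topspace X \<Longrightarrow> code (\<phi> x) = shift (code x)"
proof
  fix k assume x: "x \<in> topspace X"
  have "zpow k (\<phi> x) = zpow (k + 1) x" using zpow_add[OF x, of k 1] \<phi>_zpow[OF x, of 0] by simp
  then show "code (\<phi> x) k = shift (code x) k" by (simp add: code_def shift_def)
qed

lemma code_zpow: "x \<in> topspace X \<Longrightarrow> code (zpow k x) = (\<lambda>n. code x (n + k))"
  by (auto simp: code_def zpow_add)

lemma continuous_code: "continuous_map X (full_shift {0, 1}) code"
  unfolding full_shift_def continuous_map_componentwise_UNIV
proof
  fix k
  have A: "openin X (b 0 0 0)" "openin X (topspace X - b 0 0 0)"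
    using clopen[of 0 0 0] by (auto simp: clopenin_def M0 p0)
  have "continuous_map X (discrete_topology {0, 1}) (\<lambda>x. if x \<in> b 0 0 0 then 0 else (1::nat))"
    unfolding continuous_map_def
  proof (intro conjI allI impI)
    fix U :: "nat set"
    have "{x \<in> topspace X. (if x \<in> b 0 0 0 then 0 else 1) \<in> U} =
        (if 0 \<in> U then b 0 0 0 else {}) \<union> (if 1 \<in> U then topspace X - b 0 0 0 else {})"
      using openin_subset[OF A(1)] by auto
    then show "openin X {x \<in> topspace X. (if x \<in> b 0 0 0 then 0 else 1) \<in> U}" using A by auto
  qed auto
  from continuous_map_compose[OF continuous_zpow this]
  show "continuous_map X (discrete_topology {0, 1}) (\<lambda>x. code x k)"
    by (simp add: code_def o_def)
qed

section \<open>The Toeplitz sequence\<close>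

lemma ex_base_point: "\<exists>x\<in>topspace X. \<forall>n. ad n x = (0, 0)"
proof -
  have "(\<Inter>n. b n 0 0) \<noteq> {}"
  proof (rule compact_space_imp_nest[OF compact])
    show "closedin X (b n 0 0)" for n using clopen[of 0 n 0] by (simp add: clopenin_def)
    show "b n 0 0 \<noteq> {}" for n using nonempty[of 0 n 0] by simp
    show "decseq (\<lambda>n. b n 0 0)" unfolding decseq_Suc_iff using b00_bot bot_Suc by blast
  qed
  then obtain x where x: "\<And>n. x \<in> b n 0 0" by blast
  then have "x \<in> topspace X" using b_sub[of 0 0 0] by (auto simp: M0 p0)
  moreover have "ad n x = (0, 0)" for n using x by (intro ad_eqI) auto
  ultimately show ?thesis by blast
qed

theorem conjugate_to_toeplitz:
  "\<exists>x. toeplitz {0, 1 :: nat} x \<and> isomorphic_to_subshift X \<phi> {0, 1} (toeplitz_subshift {0, 1} x)"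
proof -
  obtain x where x: "x \<in> topspace X" "\<And>n. ad n x = (0, 0)" using ex_base_point by blast
  have shift_top: "topspace (full_shift {0, 1}) = (UNIV \<rightarrow>\<^sub>E {0, 1 :: nat})"
    by (simp add: full_shift_def)
  have "quasiperiodic (code x)"
    unfolding quasiperiodic_def
  proof
    fix m :: int
    \<comment> \<open>As \<open>p n > n\<close>, the window of radius \<open>p n\<close> around a
      bottom contains position \<open>m\<close>; the returns of \<open>x\<close> to the bottom at
      stage \<open>Suc n\<close> then give the period.\<close>
    define n where "n = nat \<bar>m\<bar>"
    have m: "- int (p n) \<le> m" "m < int (p n)" using p_gt[of n] by (auto simp: n_def)
    have "code x m = code x (m + k * int (p (Suc n)))" for k
    proof -
      let ?y = "zpow (k * int (p (Suc n))) x"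
      have y: "?y \<in> topspace X" using x by blast
      have "snd (ad (Suc n) ?y) = 0" using phase[OF x(1), of "Suc n" "k * int (p (Suc n))"] x(2) by simp
      then have "ad n (zpow m ?y) = ad n (zpow m x)"
        using ad_around_bot[OF y _ m] ad_around_bot[OF x(1) _ m] x(2) by simp
      then have "ad 0 (zpow m ?y) = ad 0 (zpow m x)" using ad_mono[of _ _ n 0] x(1) y by simp
      then have "code x m = code ?y m" using code_eq_iff[OF x(1) y] by simp
      also have "\<dots> = code x (m + k * int (p (Suc n)))" using code_zpow[OF x(1)] by simp
      finally show ?thesis .
    qed
    then show "\<exists>d. d \<noteq> 0 \<and> (\<forall>k. code x m = code x (m + k * d))"
      using p_pos[of "Suc n"] by (intro exI[of _ "int (p (Suc n))"]) auto
  qed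
  moreover have "\<not> periodic (code x)"
  proof
    assume "periodic (code x)"
    then obtain d where d: "d \<noteq> 0" "\<And>m. code x (m + d) = code x m" by (auto simp: periodic_def)
    \<comment> \<open>By injectivity of the coding a period of the code is a period of the point,
      and by \<open>phase\<close> all the unbounded heights would divide it.\<close>
    have "code (zpow d x) = code x" using code_zpow[OF x(1)] d(2) by auto
    then have "zpow d x = x" using code_inj x(1) by (auto dest: inj_onD)
    then have "d mod int (p n) = 0" for n using phase[OF x(1), of n d] x(2)[of n] by simp
    then have "int (p (nat \<bar>d\<bar>)) dvd d" by (simp add: dvd_eq_mod_eq_0)
    then have "int (p (nat \<bar>d\<bar>)) \<le> \<bar>d\<bar>" using d(1) by (intro zdvd_imp_le) auto
    then show False using p_gt[of "nat \<bar>d\<bar>"] by simp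
  qed
  moreover have "code x \<in> topspace (full_shift {0, 1})"
    unfolding shift_top by (auto simp: code_def)
  ultimately have "toeplitz {0, 1} (code x)" by (simp add: toeplitz_def)
  moreover have "isomorphic_to_subshift X \<phi> {0, 1} (toeplitz_subshift {0, 1} (code x))"
  proof -
    let ?Y = "full_shift {0, 1 :: nat}"
    have haus_Y: "Hausdorff_space ?Y" by (simp add: full_shift_def Hausdorff_space_product_topology)
    define D where "D = range (\<lambda>k. zpow k x)"
    \<comment> \<open>The passage of \<open>x\<close> through tower 0 of stage \<open>Suc n\<close>
      already visits all levels of stage \<open>n\<close>, since its word contains every
      letter.\<close>
    have D: "X closure_of D = topspace X"
    proof (rule dense_if_meets_atoms)
      fix n t i assume ti: "t < M n" "i < p n"
      obtain k where k: "k < q n" "w n 0 ! k = t" using letter_in_tower[OF ti(1) M_gt(1)] by blast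
      have lt: "k * p n + i < p (Suc n)" using idx_less[OF k(1) ti(2)] .
      have "ad (Suc n) (zpow (int (k * p n + i)) x) = (0, 0 + (k * p n + i))"
        by (rule ad_zpow_up[OF x(1,2)]) (use lt in simp)
      then have "ad n (zpow (int (k * p n + i)) x) = (t, i)"
        using ad_Suc[of "zpow (int (k * p n + i)) x" n 0 "k * p n + i"] k ti x(1) by simp
      then have "zpow (int (k * p n + i)) x \<in> b n t i"
        using ad_iff[OF zpow_top[OF x(1)] ti] by simp
      then show "D \<inter> b n t i \<noteq> {}" by (auto simp: D_def)
    qed (use x(1) in \<open>auto simp: D_def\<close>)
    have orbit: "shift_orbit (code x) = code ` D"
      using code_zpow[OF x(1)] by (auto simp: shift_orbit_def D_def image_image)
    have "?Y closure_of (code ` D) = code ` topspace X"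
    proof
      have "compactin ?Y (code ` topspace X)"
        using compact continuous_code by (simp add: compact_space_def image_compactin)
      then have "closedin ?Y (code ` topspace X)" by (rule compactin_imp_closedin[OF haus_Y])
      then show "?Y closure_of (code ` D) \<subseteq> code ` topspace X"
        by (intro closure_of_minimal) (use x(1) in \<open>auto simp: D_def\<close>)
      show "code ` topspace X \<subseteq> ?Y closure_of (code ` D)"
        using continuous_map_image_closure_subset[OF continuous_code, of D] D by simp
    qed
    then have F: "toeplitz_subshift {0, 1} (code x) = code ` topspace X"
      by (simp add: toeplitz_subshift_def orbit)
    have sub_top: "code ` topspace X \<subseteq> topspace ?Y"
      using continuous_code by (rule continuous_map_image_subset_topspace)
    have "homeomorphic_map X (subtopology ?Y (code ` topspace X)) code"
    proof (rule continuous_imp_homeomorphic_map)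
      show "continuous_map X (subtopology ?Y (code ` topspace X)) code"
        using continuous_code by (simp add: continuous_map_in_subtopology)
      show "code ` topspace X = topspace (subtopology ?Y (code ` topspace X))"
        using sub_top by (auto simp: topspace_subtopology)
    qed (use compact haus_Y code_inj in \<open>auto intro: Hausdorff_space_subtopology\<close>)
    then show ?thesis unfolding isomorphic_to_subshift_def F using code_shift by blast
  qed
  ultimately show ?thesis by blast
qed

end

section \<open>Borel probability measures on a zero-dimensional space\<close>

lemma algebra_clopenin: "algebra (topspace X) {U. clopenin X U}"
  unfolding algebra_iff_Un
  by (auto simp: clopenin_def intro: openin_diff closedin_diff dest: subsetD[OF openin_subset])

lemma clopen_base_if_dim_le_0:
  assumes "X dim_le 0" "openin X U" "x \<in> U"
  shows "\<exists>V. clopenin X V \<and> x \<in> V \<and> V \<subseteq> U"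
  using assms unfolding dimension_le_0_neighbourhood_base_of_clopen neighbourhood_base_of clopenin_def
  by blast

text \<open>Finite clopen covers of mesh tending to 0 give a countable clopen base, and a clopen
  set, being compact, is a finite union of base sets. This is what makes the pairs of clopen sets
  enumerable.\<close>

lemma countable_clopenin:
  assumes X: "compact_space X" "metrizable_space X" "X dim_le 0"
  shows "countable {U. clopenin X U}"
proof -
  obtain A d where "Metric_space A d" and X_eq: "X = Metric_space.mtopology A d"
    using X(2) by (auto simp: metrizable_space_def)
  interpret Metric_space A d by fact
  have fin_cover: "\<exists>F. finite F \<and> F \<subseteq> {V. clopenin X V \<and> (\<exists>x\<in>A. V \<subseteq> mball x (1 / real (Suc n)))} \<and>
      topspace X \<subseteq> \<Union>F" for n
  proof -
    let ?U = "{V. clopenin X V \<and> (\<exists>x\<in>A. V \<subseteq> mball x (1 / real (Suc n)))}"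
    have "topspace X \<subseteq> \<Union>?U"
    proof
      fix x assume x: "x \<in> topspace X"
      then have xA: "x \<in> A" by (simp add: X_eq)
      have "openin X (mball x (1 / real (Suc n)))" "x \<in> mball x (1 / real (Suc n))"
        using xA by (auto simp: X_eq)
      then obtain V where "clopenin X V" "x \<in> V" "V \<subseteq> mball x (1 / real (Suc n))"
        using clopen_base_if_dim_le_0[OF X(3)] by blast
      then show "x \<in> \<Union>?U" using xA by blast
    qed
    moreover have "\<forall>V\<in>?U. openin X V" by (auto simp: clopenin_def)
    ultimately show ?thesis using X(1)[unfolded compact_space_alt, rule_format, of ?U] by blast
  qed
  have "\<exists>F. \<forall>n. finite (F n) \<and> F n \<subseteq> {V. clopenin X V \<and> (\<exists>x\<in>A. V \<subseteq> mball x (1 / real (Suc n)))} \<and>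
      topspace X \<subseteq> \<Union>(F n)"
    by (intro choice allI fin_cover)
  then obtain F where F0: "\<forall>n. finite (F n) \<and> F n \<subseteq> {V. clopenin X V \<and> (\<exists>x\<in>A. V \<subseteq> mball x (1 / real (Suc n)))} \<and>
      topspace X \<subseteq> \<Union>(F n)" by (rule exE)
  have F: "finite (F n)" "F n \<subseteq> {V. clopenin X V \<and> (\<exists>x\<in>A. V \<subseteq> mball x (1 / real (Suc n)))}"
    "topspace X \<subseteq> \<Union>(F n)" for n using F0[rule_format, of n] by simp_all
  define B where "B = (\<Union>n. F n)"
  have "countable B" unfolding B_def using F(1) by (auto intro: countable_finite)
  have base: "\<exists>V\<in>B. x \<in> V \<and> V \<subseteq> U" if U: "openin X U" "x \<in> U" for U x
  proof -
    obtain r where r: "r > 0" "mball x r \<subseteq> U"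
      using U unfolding X_eq openin_mtopology by blast
    obtain n where n: "1 / real (Suc n) < r / 2" using r(1) nat_approx_posE[of "r / 2"] by auto
    have "x \<in> topspace X" using U openin_subset by blast
    then obtain V where V: "V \<in> F n" "x \<in> V" using F(3) by blast
    then obtain y where y: "y \<in> A" "V \<subseteq> mball y (1 / real (Suc n))" using F(2) by blast
    have "V \<subseteq> mball x r"
    proof
      fix z assume z: "z \<in> V"
      have "d y x < r / 2" "d y z < r / 2" "x \<in> A" "z \<in> A" using y z V n by force+
      then have "d x z < r" using triangle[of x y z] y(1) commute[of x y] by simp
      then show "z \<in> mball x r" using \<open>x \<in> A\<close> \<open>z \<in> A\<close> by simp
    qed
    then show ?thesis using V r(2) unfolding B_def by blast
  qed
  have "{U. clopenin X U} \<subseteq> Union ` {G. finite G \<and> G \<subseteq> B}"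
  proof
    fix U assume "U \<in> {U. clopenin X U}"
    then have U: "openin X U" "closedin X U" by (auto simp: clopenin_def)
    have "compactin X U" using X(1) U(2) by (simp add: closedin_compact_space)
    moreover have "\<forall>V\<in>{V\<in>B. V \<subseteq> U}. openin X V" using F(2) by (auto simp: B_def clopenin_def)
    moreover have "U \<subseteq> \<Union>{V\<in>B. V \<subseteq> U}" using base[OF U(1)] by blast
    ultimately obtain G where "finite G" "G \<subseteq> {V\<in>B. V \<subseteq> U}" "U \<subseteq> \<Union>G"
      unfolding compactin_def by meson
    then show "U \<in> Union ` {G. finite G \<and> G \<subseteq> B}" by (intro image_eqI[of _ _ G]) auto
  qed
  moreover have "countable (Union ` {G. finite G \<and> G \<subseteq> B})"
    by (intro countable_image countable_Collect_finite_subset) fact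
  ultimately show ?thesis by (rule countable_subset)
qed

lemma space_borel_of [simp]: "space (borel_of X) = topspace X"
  unfolding borel_of_def by (rule space_measure_of) (auto dest: openin_subset)

lemma sets_borel_of_clopenin:
  assumes X: "compact_space X" "metrizable_space X" "X dim_le 0"
  shows "sets (borel_of X) = sigma_sets (topspace X) {U. clopenin X U}"
proof -
  have sub: "{U. clopenin X U} \<subseteq> Pow (topspace X)" by (auto simp: clopenin_def dest: openin_subset)
  have sub': "{U. openin X U} \<subseteq> Pow (topspace X)" by (auto dest: openin_subset)
  have "U \<in> sigma_sets (topspace X) {U. clopenin X U}" if U: "openin X U" for U
  proof -
    interpret sigma_algebra "topspace X" "sigma_sets (topspace X) {U. clopenin X U}"
      by (rule sigma_algebra_sigma_sets[OF sub])
    have "U = \<Union>{V. clopenin X V \<and> V \<subseteq> U}"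
      using clopen_base_if_dim_le_0[OF X(3) U] by blast
    moreover have "\<Union>{V. clopenin X V \<and> V \<subseteq> U} \<in> sigma_sets (topspace X) {U. clopenin X U}"
      by (intro countable_Union countable_subset[OF _ countable_clopenin[OF X]]) auto
    ultimately show ?thesis by simp
  qed
  then have "sigma_sets (topspace X) {U. openin X U} = sigma_sets (topspace X) {U. clopenin X U}"
    by (intro sigma_sets_eqI) (auto simp: clopenin_def intro: sigma_sets.Basic)
  then show ?thesis unfolding borel_of_def by (simp add: sets_measure_of[OF sub'])
qed

lemma ProbD:
  assumes "\<mu> \<in> Prob X"
  shows "prob_space \<mu>" "sets \<mu> = sets (borel_of X)" "space \<mu> = topspace X"
  using assms sets_eq_imp_space_eq[of \<mu> "borel_of X"] by (auto simp: Prob_def)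

lemma clopenin_sets:
  assumes "\<mu> \<in> Prob X" "clopenin X U"
  shows "U \<in> sets \<mu>"
proof -
  have sub: "{U. openin X U} \<subseteq> Pow (topspace X)" by (auto dest: openin_subset)
  show ?thesis using assms unfolding ProbD(2)[OF assms(1)] borel_of_def
    by (auto simp: sets_measure_of[OF sub] clopenin_def)
qed

lemma Prob_eqI:
  assumes X: "compact_space X" "metrizable_space X" "X dim_le 0"
    and \<mu>: "\<mu> \<in> Prob X" and \<nu>: "\<nu> \<in> Prob X"
    and eq: "\<And>U. clopenin X U \<Longrightarrow> measure \<mu> U = measure \<nu> U"
  shows "\<mu> = \<nu>"
proof -
  interpret \<mu>: prob_space \<mu> by (rule ProbD[OF \<mu>])
  interpret \<nu>: prob_space \<nu> by (rule ProbD[OF \<nu>])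
  show ?thesis
  proof (rule measure_eqI_generator_eq[where \<Omega> = "topspace X" and E = "{U. clopenin X U}" and A = "\<lambda>_. topspace X"])
    show "Int_stable {U. clopenin X U}" by (auto simp: Int_stable_def clopenin_def)
    show "{U. clopenin X U} \<subseteq> Pow (topspace X)" by (auto simp: clopenin_def dest: openin_subset)
    show "emeasure \<mu> U = emeasure \<nu> U" if "U \<in> {U. clopenin X U}" for U
      using eq that by (simp add: \<mu>.emeasure_eq_measure \<nu>.emeasure_eq_measure)
  qed (use ProbD[OF \<mu>] ProbD[OF \<nu>] sets_borel_of_clopenin[OF X] in \<open>auto simp: clopenin_def\<close>)
qed

lemma fin_additive_Prob:
  assumes "K \<subseteq> Prob X"
  shows "fin_additive (topspace X) {U. clopenin X U} K measure"
proof (rule fin_additive.intro)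
  fix \<mu> U V assume *: "\<mu> \<in> K" "U \<in> {U. clopenin X U}" "V \<in> {U. clopenin X U}" "U \<inter> V = {}"
  interpret prob_space \<mu> using * assms ProbD(1) by blast
  show "measure \<mu> (U \<union> V) = measure \<mu> U + measure \<mu> V"
    using * assms clopenin_sets by (intro finite_measure_Union) blast+
next
  fix \<mu> assume \<mu>: "\<mu> \<in> K"
  interpret prob_space \<mu> using \<mu> assms ProbD(1) by blast
  show "measure \<mu> (topspace X) = 1" using prob_space ProbD(3)[of \<mu> X] \<mu> assms by auto
next
  show "algebra (topspace X) {U. clopenin X U}" by (rule algebra_clopenin)
qed simp

lemma topspace_Prob_topology [simp]: "topspace (Prob_topology X) = Prob X"
proof -
  have "Prob X = {\<mu> \<in> Prob X. measure \<mu> {} \<in> (UNIV :: real set)}" by simp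
  moreover have "clopenin X {}" by (simp add: clopenin_def)
  ultimately have "Prob X \<in> {{\<mu> \<in> Prob X. measure \<mu> U \<in> I} | U I. clopenin X U \<and> open (I :: real set)}"
    by blast
  then show ?thesis unfolding Prob_topology_def topology_generated_by_topspace by blast
qed

lemma continuous_map_measure:
  assumes "clopenin X U"
  shows "continuous_map (Prob_topology X) euclideanreal (\<lambda>\<mu>. measure \<mu> U)"
  unfolding continuous_map_def
proof (intro conjI allI impI)
  fix I :: "real set" assume "openin euclideanreal I"
  then show "openin (Prob_topology X) {\<mu> \<in> topspace (Prob_topology X). measure \<mu> U \<in> I}"
    unfolding topspace_Prob_topology unfolding Prob_topology_def
    by (intro topology_generated_by_Basis) (use assms in auto)
qed auto

lemma attains_min_on_compactin:
  fixes f :: "'b \<Rightarrow> real"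
  assumes "compactin Y K" "K \<noteq> {}" "continuous_map Y euclideanreal f"
  shows "\<exists>x\<in>K. \<forall>y\<in>K. f x \<le> f y"
proof -
  have "compact (f ` K)" using image_compactin[OF assms(1,3)] by simp
  then show ?thesis using compact_attains_inf[of "f ` K"] assms(2) by auto
qed

lemma div_simplex_if_dynamical_simplex:
  assumes K: "dynamical_simplex X K" and "divisible X K"
  shows "div_simplex (topspace X) {U. clopenin X U} K measure"
proof -
  have sub: "K \<subseteq> Prob X" using K by (simp add: dynamical_simplex_def)
  interpret fin_additive "topspace X" "{U. clopenin X U}" K measure
    by (rule fin_additive_Prob[OF sub])
  show ?thesis
  proof
    fix U V assume "U \<in> {U. clopenin X U}" "V \<in> {U. clopenin X U}" "\<And>\<mu>. \<mu> \<in> K \<Longrightarrow> measure \<mu> U < measure \<mu> V"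
    then show "\<exists>W\<in>{U. clopenin X U}. W \<subseteq> V \<and> (\<forall>\<mu>\<in>K. measure \<mu> W = measure \<mu> U)"
      using K unfolding dynamical_simplex_def glasner_weiss_def by fastforce
  next
    fix U and n :: nat assume "U \<in> {U. clopenin X U}" "1 \<le> n"
    then obtain V where "clopenin X V \<and> V \<subseteq> U \<and> (\<forall>\<mu>\<in>K. measure \<mu> V = 1 / real n * measure \<mu> U)"
      using assms(2) unfolding divisible_def by blast
    then show "\<exists>V\<in>{U. clopenin X U}. V \<subseteq> U \<and> (\<forall>\<mu>\<in>K. measure \<mu> V = measure \<mu> U / real n)" by auto
  next
    fix U assume U: "U \<in> {U. clopenin X U}" "U \<noteq> {}"
    \<comment> \<open>The uniform lower bound is a minimum attained on the compact set
      \<open>K\<close>, positive by full support.\<close>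
    obtain \<mu> where \<mu>: "\<mu> \<in> K" "\<And>\<nu>. \<nu> \<in> K \<Longrightarrow> measure \<mu> U \<le> measure \<nu> U"
      using attains_min_on_compactin[OF _ _ continuous_map_measure, of X K U] K U
      by (auto simp: dynamical_simplex_def)
    have "measure \<mu> U > 0"
      using K \<mu>(1) U by (auto simp: dynamical_simplex_def full_support_def clopenin_def)
    then show "\<exists>\<epsilon>>0. \<forall>\<nu>\<in>K. \<epsilon> \<le> measure \<nu> U" using \<mu>(2) by blast
  next
    show "K \<noteq> {}" using K by (simp add: dynamical_simplex_def)
  qed
qed

section \<open>Separating a measure from the simplex\<close>

context div_simplex
begin

text \<open>The sets provided for \<open>K\<close> also work for \<nu>, which does not distinguish
  sets that agree on \<open>K\<close>. For divisibility, \<open>U\<close> is exhausted by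
  \<open>n\<close> disjoint copies of the given part, and \<nu> has the same value on each.\<close>

lemma insert_div_algebra:
  assumes ins: "fin_additive S C (insert \<nu> K) m"
    and resp: "\<And>U V. U \<in> C \<Longrightarrow> V \<in> C \<Longrightarrow> (\<forall>k\<in>K. m k U = m k V) \<Longrightarrow> m \<nu> U = m \<nu> V"
  shows "div_algebra S C (insert \<nu> K) m"
proof -
  interpret I: fin_additive S C "insert \<nu> K" m by (rule ins)
  show ?thesis
  proof
    fix U V assume UV: "U \<in> C" "V \<in> C" and "\<And>k. k \<in> insert \<nu> K \<Longrightarrow> m k U < m k V"
    then obtain W where "W \<in> C" "W \<subseteq> V" "\<forall>k\<in>K. m k W = m k U" using gw[OF UV] by blast
    then show "\<exists>W\<in>C. W \<subseteq> V \<and> (\<forall>k\<in>insert \<nu> K. m k W = m k U)" using resp[of W U] UV by blast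
  next
    fix U and n :: nat assume U: "U \<in> C" and n: "1 \<le> n"
    show "\<exists>V\<in>C. V \<subseteq> U \<and> (\<forall>k\<in>insert \<nu> K. m k V = m k U / real n)"
    proof (cases "U = {}")
      case False
      obtain V where V: "V \<in> C" "V \<subseteq> U" "\<And>k. k \<in> K \<Longrightarrow> m k V = m k U / n" using dv[OF U n] by blast
      obtain k0 where k0: "k0 \<in> K" using K_ne by blast
      have "V \<noteq> {}" using V(3)[OF k0] pos[OF k0 U False] k0 n by auto
      have "\<exists>d. (\<forall>l\<in>{..<n}. d l \<in> C \<and> (\<forall>k\<in>K. m k (d l) = m k V)) \<and>
             disjoint_family_on d {..<n} \<and> (\<Union>l\<in>{..<n}. d l) = U"
        by (rule partition_by_sum) (use V U n \<open>V \<noteq> {}\<close> in \<open>auto simp: lessThan_empty_iff\<close>)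
      then obtain d where d: "\<And>l. l < n \<Longrightarrow> d l \<in> C" "\<And>l. l < n \<Longrightarrow> \<forall>k\<in>K. m k (d l) = m k V"
        "disjoint_family_on d {..<n}" "(\<Union>l<n. d l) = U" by auto
      have "m \<nu> U = m \<nu> (\<Union>l<n. d l)" using d(4) by simp
      also have "\<dots> = (\<Sum>l<n. m \<nu> (d l))" by (rule I.m_UN) (use d in auto)
      also have "\<dots> = (\<Sum>l<n. m \<nu> V)" using resp[OF d(1) V(1) d(2)] by (intro sum.cong) auto
      finally have "m \<nu> V = m \<nu> U / n" using n by simp
      then show ?thesis using V by blast
    qed (auto intro!: bexI[of _ "{}"])
  qed
qed

text \<open>After scaling and rounding, the combination and an integer threshold \<open>r\<close>
  between its values on \<open>K\<close> and at \<nu> become measures of clopen sets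
  \<open>V\<close> and \<open>V0\<close>. Then \<open>gw\<close> puts a copy of \<open>V\<close>
  into \<open>V0\<close>, although \<nu>(V) > \<nu>(V0).\<close>

lemma no_strict_separation:
  assumes ins: "fin_additive S C (insert \<nu> K) m"
    and resp: "\<And>U V. U \<in> C \<Longrightarrow> V \<in> C \<Longrightarrow> (\<forall>k\<in>K. m k U = m k V) \<Longrightarrow> m \<nu> U = m \<nu> V"
    and F: "finite F" "\<And>U. U \<in> F \<Longrightarrow> E U \<in> C" "\<And>U. U \<in> F \<Longrightarrow> 0 \<le> a U" and \<delta>: "\<delta> > 0"
    and sep: "\<And>k. k \<in> K \<Longrightarrow> (\<Sum>U\<in>F. a U * m k (E U)) + \<delta> \<le> (\<Sum>U\<in>F. a U * m \<nu> (E U))"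
  shows False
proof -
  interpret I: div_algebra S C "insert \<nu> K" m by (rule insert_div_algebra[OF ins resp])
  \<comment> \<open>Rounding costs at most \<open>card F\<close>; the remaining gap of 2 leaves room
    for an integer strictly above the values on \<open>K\<close> and strictly below the value at
    \<nu>.\<close>
  obtain n :: nat where n: "real n * \<delta> > real (card F) + 2"
    using reals_Archimedean3[OF \<delta>] by blast
  define N where "N U = nat \<lfloor>n * a U\<rfloor>" for U
  have N: "real (N U) \<le> n * a U" "n * a U \<le> real (N U) + 1" if "U \<in> F" for U
    using F(3)[OF that] by (simp_all add: N_def)
  define s where "s k = (\<Sum>U\<in>F. N U * m k (E U))" for k
  have upper: "s k \<le> n * (\<Sum>U\<in>F. a U * m k (E U))" if "k \<in> insert \<nu> K" for k
    unfolding s_def sum_distrib_left mult.assoc[symmetric]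
    by (intro sum_mono mult_right_mono N I.nonneg[OF that] F)
  have lower': "n * (\<Sum>U\<in>F. a U * m k (E U)) \<le> s k + card F" if "k \<in> insert \<nu> K" for k
  proof -
    have "n * a U * m k (E U) \<le> N U * m k (E U) + 1" if U: "U \<in> F" for U
    proof -
      have "n * a U * m k (E U) \<le> (N U + 1) * m k (E U)"
        using N(2)[OF U] I.nonneg[OF \<open>k \<in> insert \<nu> K\<close> F(2)[OF U]] by (intro mult_right_mono) auto
      also have "\<dots> \<le> N U * m k (E U) + 1"
        using I.m_le_1[OF \<open>k \<in> insert \<nu> K\<close> F(2)[OF U]] by (simp add: algebra_simps)
      finally show ?thesis .
    qed
    then have "(\<Sum>U\<in>F. n * a U * m k (E U)) \<le> (\<Sum>U\<in>F. N U * m k (E U) + 1)" by (intro sum_mono)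
    then show ?thesis by (simp add: s_def sum.distrib sum_distrib_left mult.assoc)
  qed
  have gap: "s k + 2 < s \<nu>" if k: "k \<in> K" for k
  proof -
    have "n * (\<Sum>U\<in>F. a U * m k (E U)) + n * \<delta> \<le> n * (\<Sum>U\<in>F. a U * m \<nu> (E U))"
      using mult_left_mono[OF sep[OF k], of "real n"] by (simp add: algebra_simps)
    then show ?thesis using upper[of k] lower'[of \<nu>] n k by simp
  qed
  have s_nonneg: "0 \<le> s k" if "k \<in> insert \<nu> K" for k
    unfolding s_def using I.nonneg[OF that] F by (intro sum_nonneg mult_nonneg_nonneg) auto
  obtain k0 where k0: "k0 \<in> K" using K_ne by blast
  define r where "r = nat (\<lceil>s \<nu>\<rceil> - 1)"
  have r: "real r < s \<nu>" "s \<nu> \<le> real r + 1"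
  proof -
    have "0 < s \<nu>" using gap[OF k0] s_nonneg[of k0] k0 by simp
    then have "real r = of_int \<lceil>s \<nu>\<rceil> - 1" by (simp add: r_def)
    then show "real r < s \<nu>" "s \<nu> \<le> real r + 1" by linarith+
  qed
  \<comment> \<open>Dividing by \<open>L\<close> brings the rounded combination and \<open>r\<close>
    strictly below the total measure 1, as \<open>realize_sum\<close> requires.\<close>
  define L where "L = r + (\<Sum>U\<in>F. N U) + 1"
  have L: "r < L" "(\<Sum>U\<in>F. N U) < L" "L \<ge> 1" by (auto simp: L_def)
  have "\<exists>V\<in>C. V \<subseteq> E U \<and> (\<forall>k\<in>insert \<nu> K. m k V = m k (E U) / L)" if "U \<in> F" for U
    by (rule I.dv) (use F that L in auto)
  then obtain e where e: "\<And>U. U \<in> F \<Longrightarrow> e U \<in> C"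
    "\<And>U k. U \<in> F \<Longrightarrow> k \<in> insert \<nu> K \<Longrightarrow> m k (e U) = m k (E U) / L" by metis
  obtain c where c: "c \<in> C" "\<And>k. k \<in> insert \<nu> K \<Longrightarrow> m k c = 1 / L"
    using I.dv[OF I.C_top L(3)] I.total by auto
  have sum_e: "(\<Sum>x\<in>(SIGMA U:F. {..<N U}). m k (e (fst x))) = s k / L" if k: "k \<in> insert \<nu> K" for k
  proof -
    have "(\<Sum>x\<in>(SIGMA U:F. {..<N U}). m k (e (fst x))) = (\<Sum>U\<in>F. \<Sum>l<N U. m k (e U))"
      by (subst sum.Sigma) (use F in \<open>auto simp: case_prod_unfold\<close>)
    also have "\<dots> = s k / L" using e(2)[OF _ k] by (simp add: s_def sum_divide_distrib)
    finally show ?thesis .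
  qed
  have "\<exists>V\<in>C. V \<subseteq> S \<and> (\<forall>k\<in>insert \<nu> K. m k V = (\<Sum>x\<in>(SIGMA U:F. {..<N U}). m k (e (fst x))))"
  proof (rule I.realize_sum)
    fix k assume k: "k \<in> insert \<nu> K"
    have "s k \<le> (\<Sum>U\<in>F. real (N U))"
      unfolding s_def by (intro sum_mono mult_left_le) (use I.m_le_1[OF k] F in auto)
    also have "\<dots> = real (\<Sum>U\<in>F. N U)" by simp
    also have "\<dots> < L" using L(2) by (simp only: of_nat_less_iff)
    finally show "(\<Sum>x\<in>(SIGMA U:F. {..<N U}). m k (e (fst x))) < m k S"
      unfolding sum_e[OF k] I.total[OF k] using L(3) by simp
  qed (use F e in auto)
  then obtain V where V: "V \<in> C" "\<And>k. k \<in> insert \<nu> K \<Longrightarrow> m k V = s k / L" using sum_e by auto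
  have "\<exists>V\<in>C. V \<subseteq> S \<and> (\<forall>k\<in>insert \<nu> K. m k V = (\<Sum>x\<in>{..<r}. m k c))"
    by (rule I.realize_sum) (use c L I.total in auto)
  then obtain V0 where V0: "V0 \<in> C" "\<And>k. k \<in> insert \<nu> K \<Longrightarrow> m k V0 = r / L" using c(2) by auto
  have "\<exists>W\<in>C. W \<subseteq> V0 \<and> (\<forall>k\<in>K. m k W = m k V)"
  proof (rule gw[OF V(1) V0(1)])
    fix k assume k: "k \<in> K"
    have "s k < r" using gap[OF k] r(2) by linarith
    then show "m k V < m k V0" using V(2)[of k] V0(2)[of k] k L(3) by (simp add: divide_strict_right_mono)
  qed
  then obtain W where W: "W \<in> C" "W \<subseteq> V0" "\<forall>k\<in>K. m k W = m k V" by blast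
  have "m \<nu> V = m \<nu> W" using resp[OF W(1) V(1) W(3)] by simp
  also have "\<dots> \<le> m \<nu> V0" using W V0(1) by (intro I.m_mono) auto
  finally have "s \<nu> / L \<le> r / L" using V(2)[of \<nu>] V0(2)[of \<nu>] by simp
  then show False using r(1) L(3) by (simp add: divide_le_cancel)
qed

end

text \<open>By compactness and \<open>Prob_eqI\<close> it is enough to match \<nu> on finitely many
  clopen sets at a time. There the point of \<open>K\<close> whose values are nearest in the
  Euclidean distance is taken; at positive distance, the difference vector would separate \<nu> from
  \<open>K\<close>.\<close>

lemma mem_dynamical_simplexI:
  assumes X: "compact_space X" "metrizable_space X" "X dim_le 0"
    and K: "dynamical_simplex X K" "divisible X K" and \<nu>: "\<nu> \<in> Prob X"
    and resp: "\<And>U V. clopenin X U \<Longrightarrow> clopenin X V \<Longrightarrow> (\<forall>\<mu>\<in>K. measure \<mu> U = measure \<mu> V) \<Longrightarrow>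
                 measure \<nu> U = measure \<nu> V"
  shows "\<nu> \<in> K"
proof -
  interpret D: div_simplex "topspace X" "{U. clopenin X U}" K measure
    by (rule div_simplex_if_dynamical_simplex[OF K])
  have K': "K \<subseteq> Prob X" "K \<noteq> {}" "compactin (Prob_topology X) K" "convex_measures X K"
    using K(1) by (auto simp: dynamical_simplex_def)
  interpret I: fin_additive "topspace X" "{U. clopenin X U}" "insert \<nu> K" measure
    by (rule fin_additive_Prob) (use K' \<nu> in auto)
  have finite_match: "\<exists>\<mu>\<in>K. \<forall>U\<in>F. measure \<mu> U = measure \<nu> U" if F: "finite F" "\<forall>U\<in>F. clopenin X U" for F
  proof -
    have "continuous_map (Prob_topology X) euclideanreal (\<lambda>\<mu>. \<Sum>U\<in>F. (measure \<mu> U - measure \<nu> U)\<^sup>2)"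
      using F by (intro continuous_map_sum continuous_map_real_pow continuous_map_diff continuous_map_measure) auto
    from attains_min_on_compactin[OF K'(3,2) this]
    obtain \<mu>0 where \<mu>0: "\<mu>0 \<in> K"
      "\<And>\<mu>. \<mu> \<in> K \<Longrightarrow> (\<Sum>U\<in>F. (measure \<mu>0 U - measure \<nu> U)\<^sup>2) \<le> (\<Sum>U\<in>F. (measure \<mu> U - measure \<nu> U)\<^sup>2)"
      by blast
    define c where "c U = measure \<nu> U - measure \<mu>0 U" for U
    define \<delta> where "\<delta> = (\<Sum>U\<in>F. (c U)\<^sup>2)"
    \<comment> \<open>The variational inequality for a nearest point: moving from
      \<open>\<mu>0\<close> towards \<mu> inside the convex set \<open>K\<close> cannot reduce the
      distance to \<nu>.\<close>
    have obtuse: "(\<Sum>U\<in>F. c U * (measure \<mu> U - measure \<mu>0 U)) \<le> 0" if \<mu>: "\<mu> \<in> K" for \<mu>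
    proof -
      define A where "A = (\<Sum>U\<in>F. (measure \<mu> U - measure \<mu>0 U)\<^sup>2)"
      define B where "B = (\<Sum>U\<in>F. c U * (measure \<mu> U - measure \<mu>0 U))"
      have ineq: "2 * B \<le> t * A" if t: "0 < t" "t \<le> 1" for t
      proof -
        obtain \<rho> where \<rho>: "\<rho> \<in> K" "\<And>V. V \<in> sets (borel_of X) \<Longrightarrow> measure \<rho> V = t * measure \<mu> V + (1 - t) * measure \<mu>0 V"
          using K'(4) \<mu> \<mu>0(1) t unfolding convex_measures_def by (metis atLeastAtMost_iff less_eq_real_def)
        have eq: "measure \<rho> U - measure \<nu> U = t * (measure \<mu> U - measure \<mu>0 U) - c U" if "U \<in> F" for U
        proof -
          have "U \<in> sets (borel_of X)" using clopenin_sets[OF \<nu>] F(2) that ProbD(2)[OF \<nu>] by blast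
          from \<rho>(2)[OF this] show ?thesis by (simp add: c_def algebra_simps)
        qed
        have "\<delta> = (\<Sum>U\<in>F. (measure \<mu>0 U - measure \<nu> U)\<^sup>2)"
          unfolding \<delta>_def c_def by (intro sum.cong refl power2_commute)
        also have "\<dots> \<le> (\<Sum>U\<in>F. (measure \<rho> U - measure \<nu> U)\<^sup>2)" by (rule \<mu>0(2)[OF \<rho>(1)])
        also have "\<dots> = (\<Sum>U\<in>F. t\<^sup>2 * (measure \<mu> U - measure \<mu>0 U)\<^sup>2
              - 2 * t * (c U * (measure \<mu> U - measure \<mu>0 U)) + (c U)\<^sup>2)"
        proof (intro sum.cong refl)
          fix U assume "U \<in> F"
          then show "(measure \<rho> U - measure \<nu> U)\<^sup>2 = t\<^sup>2 * (measure \<mu> U - measure \<mu>0 U)\<^sup>2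
              - 2 * t * (c U * (measure \<mu> U - measure \<mu>0 U)) + (c U)\<^sup>2"
            unfolding eq[OF \<open>U \<in> F\<close>] by (simp add: power2_eq_square algebra_simps)
        qed
        also have "\<dots> = t\<^sup>2 * A - 2 * t * B + \<delta>"
          by (simp only: A_def B_def \<delta>_def sum.distrib sum_subtractf sum_distrib_left)
        finally have "t * (2 * B) \<le> t * (t * A)" by (simp add: power2_eq_square)
        then show ?thesis using t(1) by simp
      qed
      have "A \<ge> 0" by (simp add: A_def sum_nonneg)
      have "B \<le> 0"
      proof (rule ccontr)
        assume "\<not> B \<le> 0"
        then have B: "B > 0" by simp
        \<comment> \<open>Small enough that \<open>t * A\<close> is at most \<open>B\<close>,
          against \<open>2 * B \<le> t * A\<close>.\<close>
        define t where "t = min 1 (B / (A + 1))"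
        have t: "0 < t" "t \<le> 1" "t \<le> B / (A + 1)" using B \<open>A \<ge> 0\<close> by (auto simp: t_def)
        have "t * A \<le> B / (A + 1) * A" using t(3) \<open>A \<ge> 0\<close> by (rule mult_right_mono)
        also have "\<dots> \<le> B" using B \<open>A \<ge> 0\<close> by (simp add: field_simps)
        finally show False using ineq[OF t(1,2)] B by simp
      qed
      then show ?thesis by (simp add: B_def)
    qed
    have "\<delta> = 0"
    proof (rule ccontr)
      assume "\<delta> \<noteq> 0"
      then have \<delta>: "\<delta> > 0" by (simp add: \<delta>_def sum_nonneg order_less_le)
      \<comment> \<open>\<open>no_strict_separation\<close> takes nonnegative coefficients. Passing
        to the complement reverses the sign of a coefficient, at the cost of the constant
        \<open>G\<close>, which is the same for all measures.\<close>
      define E where "E U = (if c U \<ge> 0 then U else topspace X - U)" for U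
      have E: "clopenin X (E U)" if "U \<in> F" for U
        using F that I.C_Diff[OF I.C_top] by (auto simp: E_def)
      define G where "G = (\<Sum>U\<in>F. if c U \<ge> 0 then 0 else - c U)"
      have flip: "(\<Sum>U\<in>F. \<bar>c U\<bar> * measure \<mu> (E U)) = (\<Sum>U\<in>F. c U * measure \<mu> U) + G" if \<mu>: "\<mu> \<in> insert \<nu> K" for \<mu>
        unfolding G_def sum.distrib[symmetric]
      proof (intro sum.cong refl)
        fix U assume U: "U \<in> F"
        have eq: "measure \<mu> (topspace X - U) = 1 - measure \<mu> U"
          using I.m_diff[OF \<mu>, of "topspace X" U] I.total[OF \<mu>] I.C_top I.C_sub[of U] F U by simp
        then show "\<bar>c U\<bar> * measure \<mu> (E U) = c U * measure \<mu> U + (if c U \<ge> 0 then 0 else - c U)"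
          by (simp add: E_def eq right_diff_distrib)
      qed
      have sep: "(\<Sum>U\<in>F. \<bar>c U\<bar> * measure \<mu> (E U)) + \<delta> \<le> (\<Sum>U\<in>F. \<bar>c U\<bar> * measure \<nu> (E U))" if \<mu>: "\<mu> \<in> K" for \<mu>
      proof -
        have "(\<Sum>U\<in>F. c U * measure \<nu> U) = (\<Sum>U\<in>F. c U * measure \<mu>0 U) + \<delta>"
          by (simp add: \<delta>_def c_def power2_eq_square algebra_simps flip: sum.distrib)
        moreover have "(\<Sum>U\<in>F. c U * measure \<mu> U) \<le> (\<Sum>U\<in>F. c U * measure \<mu>0 U)"
          using obtuse[OF \<mu>] by (simp add: right_diff_distrib sum_subtractf)
        ultimately show ?thesis using flip[of \<mu>] flip[of \<nu>] \<mu> by simp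
      qed
      show False
      proof (rule D.no_strict_separation[OF I.fin_additive_axioms _ F(1) _ _ \<delta> sep])
        show "measure \<nu> U = measure \<nu> V"
          if "U \<in> {U. clopenin X U}" "V \<in> {U. clopenin X U}" "\<forall>\<mu>\<in>K. measure \<mu> U = measure \<mu> V" for U V
          by (rule resp) (use that in blast)+
        show "E U \<in> {U. clopenin X U}" if "U \<in> F" for U using E that by simp
      qed simp
    qed
    then have "\<forall>U\<in>F. (c U)\<^sup>2 = 0"
      using sum_nonneg_eq_0_iff[OF F(1), of "\<lambda>U. (c U)\<^sup>2"] by (simp add: \<delta>_def)
    then show ?thesis using \<mu>0(1) by (auto simp: c_def)
  qed
  define Z where "Z U = {\<mu> \<in> Prob X. measure \<mu> U = measure \<nu> U}" for U
  have Z_closed: "closedin (Prob_topology X) (Z U)" if "clopenin X U" for U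
    using closedin_continuous_map_preimage[OF continuous_map_measure[OF that], of "{measure \<nu> U}"]
    by (simp add: Z_def)
  have "K \<inter> \<Inter>(Z ` {U. clopenin X U}) \<noteq> {}"
  proof -
    have "K \<inter> \<Inter>\<F> \<noteq> {}" if h: "finite \<F>" "\<F> \<subseteq> Z ` {U. clopenin X U}" for \<F>
    proof -
      obtain F where F: "F \<subseteq> {U. clopenin X U}" "finite F" "\<F> = Z ` F"
        using finite_subset_image[OF h] by blast
      then obtain \<mu> where "\<mu> \<in> K" "\<forall>U\<in>F. measure \<mu> U = measure \<nu> U" using finite_match[of F] by blast
      then have "\<mu> \<in> K \<inter> \<Inter>\<F>" using F(3) K'(1) by (auto simp: Z_def)
      then show ?thesis by blast
    qed
    moreover have "\<forall>C\<in>Z ` {U. clopenin X U}. closedin (Prob_topology X) C" using Z_closed by auto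
    ultimately show ?thesis
      using conjunct2[OF K'(3)[unfolded compactin_fip], rule_format, of "Z ` {U. clopenin X U}"] by simp
  qed
  then obtain \<mu> where "\<mu> \<in> K" "\<And>U. clopenin X U \<Longrightarrow> measure \<mu> U = measure \<nu> U"
    by (auto simp: Z_def)
  then show ?thesis using Prob_eqI[OF X _ \<nu>] K'(1) by blast
qed

section \<open>Invariant measures\<close>

context tower_sequence
begin

lemma measurable_\<phi>:
  assumes "\<mu> \<in> Prob X"
  shows "\<phi> \<in> measurable \<mu> (borel_of X)"
  unfolding borel_of_def
proof (rule measurable_measure_of)
  fix U assume "U \<in> {U. openin X U}"
  then have "openin X {x \<in> topspace X. \<phi> x \<in> U}"
    using continuous_\<phi> by (simp add: continuous_map_def)
  moreover have "\<phi> -` U \<inter> space \<mu> = {x \<in> topspace X. \<phi> x \<in> U}" using ProbD(3)[OF assms] by auto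
  moreover have "V \<in> sets \<mu>" if "openin X V" for V
  proof -
    have "{U. openin X U} \<subseteq> Pow (topspace X)" by (auto dest: openin_subset)
    then show ?thesis using that unfolding ProbD(2)[OF assms] borel_of_def
      by (auto simp: sets_measure_of)
  qed
  ultimately show "\<phi> -` U \<inter> space \<mu> \<in> sets \<mu>" by simp
qed (use ProbD(3)[OF assms] in \<open>auto dest: openin_subset\<close>)

lemma measure_distr_\<phi>:
  assumes "\<mu> \<in> Prob X" "clopenin X U"
  shows "measure (distr \<mu> (borel_of X) \<phi>) U = measure \<mu> (\<phi> -` U \<inter> topspace X)"
proof -
  have "borel_of X \<in> {N. sets N = sets \<mu>}" using ProbD(2)[OF assms(1)] by simp
  then have "U \<in> sets (borel_of X)" using clopenin_sets[OF assms] by auto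
  from measure_distr[OF measurable_\<phi>[OF assms(1)] this] show ?thesis
    using ProbD(3)[OF assms(1)] by simp
qed

lemma clopenin_vimage_\<phi>: "clopenin X U \<Longrightarrow> clopenin X (\<phi> -` U \<inter> topspace X)"
  using continuous_\<phi> openin_continuous_map_preimage[of X X \<phi> U] closedin_continuous_map_preimage[of X X \<phi> U]
  by (simp add: clopenin_def vimage_def Int_def conj_commute)

lemma uniform_if_invariant:
  assumes "\<mu> \<in> Prob X" "distr \<mu> (borel_of X) \<phi> = \<mu>" "t < M n" "i < p n"
  shows "measure \<mu> (b n t 0) = measure \<mu> (b n t i)"
  using assms(4)
proof (induction i)
  case (Suc i)
  have "measure \<mu> (b n t (Suc i)) = measure (distr \<mu> (borel_of X) \<phi>) (b n t (Suc i))"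
    using assms(2) by simp
  also have "\<dots> = measure \<mu> (b n t i)"
    using measure_distr_\<phi>[OF assms(1) clopen[OF assms(3) Suc.prems]] vimage_\<phi>_atom[OF assms(3) Suc.prems] by simp
  finally show ?case using Suc by simp
qed simp

lemma disjoint_atoms:
  assumes "inj_on g A" "g ` A \<subseteq> {..<M n} \<times> {..<p n}"
  shows "disjoint_family_on (\<lambda>x. b n (fst (g x)) (snd (g x))) A"
  unfolding disjoint_family_on_def
proof (intro ballI impI)
  fix x y assume xy: "x \<in> A" "y \<in> A" "x \<noteq> y"
  then have "g x \<noteq> g y" "g x \<in> {..<M n} \<times> {..<p n}" "g y \<in> {..<M n} \<times> {..<p n}"
    using assms by (auto dest: inj_onD)
  then show "b n (fst (g x)) (snd (g x)) \<inter> b n (fst (g y)) (snd (g y)) = {}"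
    using unique[of "fst (g x)" n "fst (g y)" "snd (g x)" "snd (g y)"] by (auto simp: mem_Times_iff prod_eq_iff)
qed

text \<open>Makes \<open>kr_count\<close> and \<open>kr_sum\<close> available for measures not yet
  known to lie in \<open>K\<close>, such as a single invariant one.\<close>

lemma kr_tower:
  assumes "K \<subseteq> Prob X"
    and "\<And>\<mu> t i. \<mu> \<in> K \<Longrightarrow> t < M n \<Longrightarrow> i < p n \<Longrightarrow> measure \<mu> (b n t 0) = measure \<mu> (b n t i)"
  shows "fin_additive.kr (topspace X) {U. clopenin X U} K measure {..<M n} (p n) (b n)"
proof -
  interpret F: fin_additive "topspace X" "{U. clopenin X U}" K measure by (rule fin_additive_Prob) fact
  have "disjoint_family_on (\<lambda>(t, i). b n t i) ({..<M n} \<times> {..<p n})"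
    using disjoint_atoms[of id "{..<M n} \<times> {..<p n}" n] by (simp add: case_prod_unfold)
  then show ?thesis unfolding F.kr_def using cover[of n] clopen assms(2) by simp
qed

text \<open>Clopen sets suffice by \<open>Prob_eqI\<close>. Stage \<open>n\<close> leaves a defect
  of at most 1 / p n, the measure of one level taken across all towers, and the heights are
  unbounded.\<close>

lemma invariant_if_uniform:
  assumes X: "metrizable_space X" "X dim_le 0" and \<mu>: "\<mu> \<in> Prob X"
    and unif: "\<And>n t i. t < M n \<Longrightarrow> i < p n \<Longrightarrow> measure \<mu> (b n t 0) = measure \<mu> (b n t i)"
  shows "distr \<mu> (borel_of X) \<phi> = \<mu>"
proof (rule Prob_eqI[OF compact X])
  interpret prob_space \<mu> by (rule ProbD[OF \<mu>])
  show "distr \<mu> (borel_of X) \<phi> \<in> Prob X"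
    using prob_space_distr[OF measurable_\<phi>[OF \<mu>]] by (simp add: Prob_def)
  show "\<mu> \<in> Prob X" by fact
  interpret F: fin_additive "topspace X" "{U. clopenin X U}" "{\<mu>}" measure
    by (rule fin_additive_Prob) (use \<mu> in simp)
  fix U assume U: "clopenin X U"
  obtain n0 where n0: "\<And>l x y. l \<ge> n0 \<Longrightarrow> x \<in> topspace X \<Longrightarrow> y \<in> topspace X \<Longrightarrow> ad l x = ad l y \<Longrightarrow> (x \<in> U \<longleftrightarrow> y \<in> U)"
    using clopen_decided[OF U] by blast
  \<comment> \<open>\<open>\<phi>\<close> moves levels to levels of the same measure, except for the top of the towers.\<close>
  have close: "\<bar>measure \<mu> (\<phi> -` U \<inter> topspace X) - measure \<mu> U\<bar> \<le> 1 / real (p n)" if n: "n \<ge> n0" for n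
  proof -
    have kr: "F.kr {..<M n} (p n) (b n)" by (rule kr_tower) (use \<mu> unif in auto)
    have lt: "p n - 1 < p n" using p_pos[of n] by simp
    have cl_bot: "clopenin X (bot n)"
      using F.C_UN[of "{..<M n}" "\<lambda>t. b n t 0"] clopen by (simp add: bot_def)
    have sum_level: "measure \<mu> (\<Union>t<M n. b n t i) = 1 / real (p n)" if i: "i < p n" for i
    proof -
      have "measure \<mu> (\<Union>t<M n. b n t i) = (\<Sum>t<M n. measure \<mu> (b n t i))"
        by (rule F.m_UN) (use clopen i unique in \<open>auto simp: disjoint_family_on_def\<close>)
      also have "\<dots> = (\<Sum>t<M n. measure \<mu> (b n t 0))" using unif i by (intro sum.cong) auto
      finally show ?thesis using F.kr_sum[OF kr] by simp
    qed
    define I where "I = {(t, i). t < M n \<and> Suc i < p n \<and> b n t (Suc i) \<subseteq> U}"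
    have finI: "finite I" by (rule finite_subset[of _ "{..<M n} \<times> {..<p n}"]) (auto simp: I_def)
    define U1 where "U1 = (\<Union>(t, i)\<in>I. b n t (Suc i))"
    have U_eq: "U = U1 \<union> (U \<inter> bot n)"
    proof
      show "U \<subseteq> U1 \<union> (U \<inter> bot n)"
      proof
        fix x assume x: "x \<in> U"
        then have xX: "x \<in> topspace X" using F.C_sub U by auto
        obtain t i where ti: "t < M n" "i < p n" "x \<in> b n t i" "ad n x = (t, i)" using ad_cases[OF xX] .
        show "x \<in> U1 \<union> (U \<inter> bot n)"
        proof (cases i)
          case 0
          then show ?thesis using x xX ti bot_iff by simp
        next
          case (Suc j)
          have "b n t i \<subseteq> U"
          proof
            fix y assume y: "y \<in> b n t i"
            then have "y \<in> topspace X" using b_sub ti by blast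
            moreover have "ad n y = ad n x" using ad_eqI y ti by simp
            ultimately show "y \<in> U" using n0[OF n, of x y] x xX by simp
          qed
          then have "(t, j) \<in> I" using ti Suc by (simp add: I_def)
          then show ?thesis using ti(3) Suc by (auto simp: U1_def)
        qed
      qed
    qed (auto simp: U1_def I_def)
    have disj: "U1 \<inter> bot n = {}"
    proof -
      have "snd (ad n x) \<noteq> 0" if "x \<in> U1" for x
        using that ad_eqI unfolding U1_def I_def by fastforce
      then show ?thesis using bot_iff by blast
    qed
    have cl1: "clopenin X U1"
      using F.C_UN[OF finI, of "\<lambda>(t, i). b n t (Suc i)"] clopen by (auto simp: U1_def I_def)
    let ?pre = "\<lambda>A. \<phi> -` A \<inter> topspace X"
    have pre1: "?pre U1 = (\<Union>(t, i)\<in>I. b n t i)"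
    proof -
      have "?pre U1 = (\<Union>(t, i)\<in>I. ?pre (b n t (Suc i)))" by (auto simp: U1_def)
      also have "\<dots> = (\<Union>(t, i)\<in>I. b n t i)"
      proof (rule SUP_cong[OF refl])
        fix x assume "x \<in> I"
        then show "(case x of (t, i) \<Rightarrow> ?pre (b n t (Suc i))) = (case x of (t, i) \<Rightarrow> b n t i)"
          by (cases x) (simp add: I_def vimage_\<phi>_atom)
      qed
      finally show ?thesis .
    qed
    have "measure \<mu> (?pre U1) = (\<Sum>x\<in>I. measure \<mu> (case x of (t, i) \<Rightarrow> b n t i))"
      unfolding pre1
    proof (rule F.m_UN[OF _ finI])
      show "disjoint_family_on (\<lambda>(t, i). b n t i) I"
        using disjoint_atoms[of id I n] by (force simp: I_def case_prod_unfold)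
    qed (use clopen Suc_lessD in \<open>auto simp: I_def\<close>)
    also have "\<dots> = (\<Sum>x\<in>I. measure \<mu> (case x of (t, i) \<Rightarrow> b n t (Suc i)))"
    proof (intro sum.cong refl)
      fix x assume "x \<in> I"
      then obtain t i where x: "x = (t, i)" "t < M n" "Suc i < p n" by (auto simp: I_def)
      then have "measure \<mu> (b n t i) = measure \<mu> (b n t (Suc i))"
        using unif[of t n i] unif[of t n "Suc i"] by simp
      then show "measure \<mu> (case x of (t, i) \<Rightarrow> b n t i) = measure \<mu> (case x of (t, i) \<Rightarrow> b n t (Suc i))"
        using x by simp
    qed
    also have "\<dots> = measure \<mu> U1"
      unfolding U1_def
    proof (rule F.m_UN[symmetric, OF _ finI])
      show "disjoint_family_on (\<lambda>(t, i). b n t (Suc i)) I"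
        using disjoint_atoms[of "\<lambda>x. (fst x, Suc (snd x))" I n]
        by (force simp: I_def case_prod_unfold inj_on_def)
    qed (use clopen in \<open>auto simp: I_def\<close>)
    finally have eq1: "measure \<mu> (?pre U1) = measure \<mu> U1" .
    have "measure \<mu> U = measure \<mu> (U1 \<union> (U \<inter> bot n))" using U_eq by simp
    also have "\<dots> = measure \<mu> U1 + measure \<mu> (U \<inter> bot n)"
      by (rule F.add) (use U cl1 cl_bot disj F.C_Int in auto)
    finally have m1: "measure \<mu> U = measure \<mu> U1 + measure \<mu> (U \<inter> bot n)" .
    have "?pre U = ?pre U1 \<union> ?pre (U \<inter> bot n)" using U_eq by blast
    then have "measure \<mu> (?pre U) = measure \<mu> (?pre U1 \<union> ?pre (U \<inter> bot n))" by simp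
    also have "\<dots> = measure \<mu> (?pre U1) + measure \<mu> (?pre (U \<inter> bot n))"
      by (rule F.add) (use U cl1 cl_bot disj F.C_Int clopenin_vimage_\<phi> in \<open>auto simp del: vimage_Int\<close>)
    finally have m2: "measure \<mu> (?pre U) = measure \<mu> U1 + measure \<mu> (?pre (U \<inter> bot n))" using eq1 by simp
    have "measure \<mu> (U \<inter> bot n) \<le> measure \<mu> (bot n)"
      by (rule F.m_mono) (use U cl_bot F.C_Int in auto)
    also have "\<dots> = 1 / real (p n)" unfolding bot_def by (rule sum_level) simp
    finally have b1: "measure \<mu> (U \<inter> bot n) \<le> 1 / real (p n)" .
    have "measure \<mu> (?pre (U \<inter> bot n)) \<le> measure \<mu> (?pre (bot n))"
      by (rule F.m_mono) (use U cl_bot F.C_Int clopenin_vimage_\<phi> in \<open>auto simp del: vimage_Int\<close>)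
    also have "\<dots> = 1 / real (p n)" unfolding vimage_\<phi>_bot by (rule sum_level[OF lt])
    finally have b2: "measure \<mu> (?pre (U \<inter> bot n)) \<le> 1 / real (p n)" .
    show ?thesis using m1 m2 b1 b2 measure_nonneg[of \<mu> "U \<inter> bot n"] measure_nonneg[of \<mu> "?pre (U \<inter> bot n)"]
      by linarith
  qed
  have "measure \<mu> (\<phi> -` U \<inter> topspace X) = measure \<mu> U"
  proof (rule ccontr)
    assume ne: "measure \<mu> (\<phi> -` U \<inter> topspace X) \<noteq> measure \<mu> U"
    define \<epsilon> where "\<epsilon> = \<bar>measure \<mu> (\<phi> -` U \<inter> topspace X) - measure \<mu> U\<bar>"
    have "\<epsilon> > 0" using ne by (simp add: \<epsilon>_def)
    then obtain k where k: "1 / real (Suc k) < \<epsilon>" using nat_approx_posE by metis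
    define n where "n = max n0 k"
    have "Suc k \<le> p n" using p_gt[of n] by (simp add: n_def)
    then have "1 / real (p n) \<le> 1 / real (Suc k)" by (intro divide_left_mono) auto
    then show False using close[of n] k by (simp add: n_def \<epsilon>_def)
  qed
  then show "measure (distr \<mu> (borel_of X) \<phi>) U = measure \<mu> U" using measure_distr_\<phi>[OF \<mu> U] by simp
qed

end

section \<open>Assembling the construction\<close>

lemma (in div_simplex) ex_tower_sequence:
  fixes f :: "nat \<Rightarrow> 'a set \<times> 'a set"
  assumes f: "\<forall>n. fst (f n) \<in> C \<and> snd (f n) \<in> C"
  shows "\<exists>M p q b w. M 0 = 2 \<and> p 0 = 1 \<and> (\<forall>n. M n \<ge> 2 \<and> kr {..<M n} (p n) (b n) \<and>
     (\<forall>t<M n. \<forall>i<p n. b n t i \<noteq> {}) \<and> p (Suc n) = p n * q n \<and>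
     (\<forall>t<M (Suc n). length (w n t) = q n \<and> marked_word (w n t) \<and> set (w n t) = {..<M n}) \<and>
     inj_on (w n) {..<M (Suc n)} \<and>
     (\<forall>t<M (Suc n). \<forall>i<p (Suc n). b (Suc n) t i \<subseteq> b n (w n t ! (i div p n)) (i mod p n) \<and>
         (b (Suc n) t i \<subseteq> fst (f n) \<or> b (Suc n) t i \<inter> fst (f n) = {}) \<and>
         (b (Suc n) t i \<subseteq> snd (f n) \<or> b (Suc n) t i \<inter> snd (f n) = {})) \<and>
     ((\<forall>k\<in>K. m k (fst (f n)) = m k (snd (f n))) \<longrightarrow> (\<forall>t<M (Suc n).
        card {i. i < p (Suc n) \<and> b (Suc n) t i \<subseteq> fst (f n)} = card {i. i < p (Suc n) \<and> b (Suc n) t i \<subseteq> snd (f n)})))"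
proof -
  obtain k0 where k0: "k0 \<in> K" using K_ne by blast
  \<comment> \<open>A state is a triple of tower number, height and levels; \<open>q\<close> and
    \<open>w\<close> belong to the transitions and are chosen afterwards. The clause for
    \<open>n = 0\<close> preserves the initial values through the choice.\<close>
  define P where "P n s \<longleftrightarrow> (case s of (M, p, b) \<Rightarrow> (n = 0 \<longrightarrow> M = 2 \<and> p = 1) \<and> M \<ge> 2 \<and> kr {..<M} p b \<and>
     (\<forall>t<M. \<forall>i<p. b t i \<noteq> {}))" for n :: nat and s :: "nat \<times> nat \<times> (nat \<Rightarrow> nat \<Rightarrow> 'a set)"
  define R where "R n s s' q w \<longleftrightarrow> (case s of (M, p, b) \<Rightarrow> case s' of (M', p', b') \<Rightarrow> p' = p * q \<and>
     (\<forall>t<M'. length (w t) = q \<and> marked_word (w t) \<and> set (w t) = {..<M}) \<and> inj_on w {..<M'} \<and>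
     (\<forall>t<M'. \<forall>i<p'. b' t i \<subseteq> b (w t ! (i div p)) (i mod p) \<and>
         (b' t i \<subseteq> fst (f n) \<or> b' t i \<inter> fst (f n) = {}) \<and> (b' t i \<subseteq> snd (f n) \<or> b' t i \<inter> snd (f n) = {})) \<and>
     ((\<forall>k\<in>K. m k (fst (f n)) = m k (snd (f n))) \<longrightarrow>
        (\<forall>t<M'. card {i. i < p' \<and> b' t i \<subseteq> fst (f n)} = card {i. i < p' \<and> b' t i \<subseteq> snd (f n)})))"
    for n and s s' :: "nat \<times> nat \<times> (nat \<Rightarrow> nat \<Rightarrow> 'a set)" and q and w :: "nat \<Rightarrow> nat list"
  have "\<exists>g. \<forall>n. P n (g n) \<and> (\<exists>q w. R n (g n) (g (Suc n)) q w)"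
  proof (rule dependent_nat_choice)
    \<comment> \<open>Stage 0 consists of two halves of the space, given by divisibility and
      nonempty because both have measure 1/2.\<close>
    obtain A where A: "A \<in> C" "\<And>k. k \<in> K \<Longrightarrow> m k A = 1 / 2" using dv[OF C_top, of 2] total by auto
    have "m k0 A = 1 / 2" "m k0 (S - A) = 1 / 2"
      using A(2)[OF k0] m_diff[OF k0 C_top A(1) C_sub[OF A(1)]] total[OF k0] by simp_all
    then have A_ne: "A \<noteq> {}" "S - A \<noteq> {}" using m_empty[OF k0] by (metis zero_neq_one divide_eq_0_iff zero_neq_numeral)+
    have less2: "{..<2} = {0, 1::nat}" by auto
    have "P 0 (2, 1, \<lambda>t i. if t = 0 then A else S - A)"
      using A(1) A_ne C_sub[OF A(1)] C_Diff[OF C_top A(1)]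
      by (auto simp: P_def kr_def less2 disjoint_family_on_def less_2_cases_iff)
    then show "\<exists>s. P 0 s" by blast
  next
    fix s n assume "P n s"
    then obtain M p b where s: "s = (M, p, b)" "M \<ge> 2" "kr {..<M} p b" "\<forall>t<M. \<forall>i<p. b t i \<noteq> {}"
      by (auto simp: P_def)
    from kr_step[OF s(3,2,4) conjunct1[OF f[rule_format, of n]] conjunct2[OF f[rule_format, of n]]]
    obtain M' q w b' where *: "M' \<ge> (2::nat) \<and> kr {..<M'} (p * q) b' \<and>
     (\<forall>t<M'. length (w t) = q \<and> marked_word (w t) \<and> set (w t) = {..<M}) \<and> inj_on w {..<M'} \<and>
     (\<forall>t<M'. \<forall>i<p * q. b' t i \<noteq> {} \<and> b' t i \<subseteq> b (w t ! (i div p)) (i mod p) \<and>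
         (b' t i \<subseteq> fst (f n) \<or> b' t i \<inter> fst (f n) = {}) \<and> (b' t i \<subseteq> snd (f n) \<or> b' t i \<inter> snd (f n) = {})) \<and>
     ((\<forall>k\<in>K. m k (fst (f n)) = m k (snd (f n))) \<longrightarrow>
        (\<forall>t<M'. card {i. i < p * q \<and> b' t i \<subseteq> fst (f n)} = card {i. i < p * q \<and> b' t i \<subseteq> snd (f n)}))"
      by (elim exE) (rule that)
    then have "P (Suc n) (M', p * q, b')" "R n s (M', p * q, b') q w"
      unfolding P_def R_def s(1) prod.case by simp_all
    then show "\<exists>s'. P (Suc n) s' \<and> (\<exists>q w. R n s s' q w)" by blast
  qed
  then obtain g where g: "\<And>n. P n (g n)" "\<And>n. \<exists>q w. R n (g n) (g (Suc n)) q w" by blast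
  from g(2) obtain q w where qw: "\<And>n. R n (g n) (g (Suc n)) (q n) (w n)" by metis
  define M where "M n = fst (g n)" for n
  define p where "p n = fst (snd (g n))" for n
  define b where "b n = snd (snd (g n))" for n
  have g_eq: "g n = (M n, p n, b n)" for n by (simp add: M_def p_def b_def)
  note P = g(1)[unfolded g_eq P_def prod.case] and R = qw[unfolded g_eq R_def prod.case]
  have base: "M 0 = 2" "p 0 = 1" using P[of 0] by simp_all
  show ?thesis
    apply (rule exI[of _ M], rule exI[of _ p], rule exI[of _ q], rule exI[of _ b], rule exI[of _ w])
    apply (intro conjI base, rule allI)
    subgoal for n
      using P[of n] R[of n] by (elim conjE) (intro conjI; assumption)
    done
qed

theorem theorem3p2:
  fixes X :: "'a topology" and K :: "'a measure set"
  assumes "cantor_space X"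
    and "dynamical_simplex X K"
    and "divisible X K"
  shows "\<exists>\<phi>. homeomorphic_map X X \<phi> \<and>
           (\<exists>x. toeplitz {0, 1 :: nat} x \<and>
                isomorphic_to_subshift X \<phi> {0, 1} (toeplitz_subshift {0, 1} x)) \<and>
           K = invariant_measures X \<phi>"
proof -
  have X: "compact_space X" "metrizable_space X" "X dim_le 0"
    using assms(1) by (auto simp: cantor_space_def)
  have K_sub: "K \<subseteq> Prob X" using assms(2) by (simp add: dynamical_simplex_def)
  interpret D: div_simplex "topspace X" "{U. clopenin X U}" K measure
    by (rule div_simplex_if_dynamical_simplex[OF assms(2,3)])
  let ?Pairs = "{U. clopenin X U} \<times> {U. clopenin X U}"
  have "countable ?Pairs" using countable_clopenin[OF X] by (intro countable_SIGMA) auto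
  have "?Pairs \<noteq> {}" using D.C_empty by blast
  define f where "f = from_nat_into ?Pairs"
  have f: "range f = ?Pairs"
    unfolding f_def by (rule range_from_nat_into) fact+
  have fC: "\<forall>n. fst (f n) \<in> {U. clopenin X U} \<and> snd (f n) \<in> {U. clopenin X U}"
  proof
    fix n
    have "f n \<in> ?Pairs" using f by blast
    then show "fst (f n) \<in> {U. clopenin X U} \<and> snd (f n) \<in> {U. clopenin X U}" by (auto simp: mem_Times_iff)
  qed
  from D.ex_tower_sequence[OF fC]
  obtain M p q b w where base: "M 0 = 2" "p 0 = 1"
    and seq: "\<forall>n. M n \<ge> 2 \<and> D.kr {..<M n} (p n) (b n) \<and>
     (\<forall>t<M n. \<forall>i<p n. b n t i \<noteq> {}) \<and> p (Suc n) = p n * q n \<and>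
     (\<forall>t<M (Suc n). length (w n t) = q n \<and> marked_word (w n t) \<and> set (w n t) = {..<M n}) \<and>
     inj_on (w n) {..<M (Suc n)} \<and>
     (\<forall>t<M (Suc n). \<forall>i<p (Suc n). b (Suc n) t i \<subseteq> b n (w n t ! (i div p n)) (i mod p n) \<and>
         (b (Suc n) t i \<subseteq> fst (f n) \<or> b (Suc n) t i \<inter> fst (f n) = {}) \<and>
         (b (Suc n) t i \<subseteq> snd (f n) \<or> b (Suc n) t i \<inter> snd (f n) = {})) \<and>
     ((\<forall>\<mu>\<in>K. measure \<mu> (fst (f n)) = measure \<mu> (snd (f n))) \<longrightarrow> (\<forall>t<M (Suc n).
        card {i. i < p (Suc n) \<and> b (Suc n) t i \<subseteq> fst (f n)} = card {i. i < p (Suc n) \<and> b (Suc n) t i \<subseteq> snd (f n)}))"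
    by (elim exE conjE) (rule that)
  have kr: "D.kr {..<M n} (p n) (b n)" for n using seq by blast
  interpret T: tower_sequence X M p q b w
  proof
    show "compact_space X" "Hausdorff_space X" using X metrizable_imp_Hausdorff_space by auto
    show "\<exists>V. clopenin X V \<and> x \<in> V \<and> V \<subseteq> U" if "openin X U" "x \<in> U" for U x
      by (rule clopen_base_if_dim_le_0[OF X(3) that])
    show "\<exists>n. \<forall>t<M n. \<forall>i<p n. b n t i \<subseteq> U \<or> b n t i \<inter> U = {}" if "clopenin X U" for U
    proof -
      \<comment> \<open>The diagonal pair is among those treated, and the step that treats it
        decides \<open>U\<close>.\<close>
      have "(U, U) \<in> range f" using f that by simp
      then obtain n where n: "(U, U) = f n" by blast
      then have "fst (f n) = U" by (metis fst_conv)
      then have "\<forall>t<M (Suc n). \<forall>i<p (Suc n). b (Suc n) t i \<subseteq> U \<or> b (Suc n) t i \<inter> U = {}"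
        using seq by blast
      then show ?thesis by blast
    qed
    fix n
    show "(\<Union>t<M n. \<Union>i<p n. b n t i) = topspace X" using kr[of n] by (simp add: D.kr_def)
    show "clopenin X (b n t i)" if "t < M n" "i < p n" for t i using kr[of n] that by (simp add: D.kr_def)
    show "t = t' \<and> i = i'" if "t < M n" "t' < M n" "i < p n" "i' < p n" "x \<in> b n t i" "x \<in> b n t' i'" for t t' i i' x
      using D.kr_unique[OF kr[of n]] that by blast
  qed (use base seq in blast)+
  have unif: "measure \<mu> (b n t 0) = measure \<mu> (b n t i)" if "\<mu> \<in> K" "t < M n" "i < p n" for \<mu> n t i
    using kr[of n] that unfolding D.kr_def by blast
  have "K = invariant_measures X T.\<phi>"
  proof
    show "K \<subseteq> invariant_measures X T.\<phi>"
      using T.invariant_if_uniform[OF X(2,3)] unif K_sub unfolding invariant_measures_def by blast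
    show "invariant_measures X T.\<phi> \<subseteq> K"
    proof
      fix \<nu> assume "\<nu> \<in> invariant_measures X T.\<phi>"
      then have \<nu>: "\<nu> \<in> Prob X" "distr \<nu> (borel_of X) T.\<phi> = \<nu>" by (auto simp: invariant_measures_def)
      interpret N: fin_additive "topspace X" "{U. clopenin X U}" "{\<nu>}" measure
        by (rule fin_additive_Prob) (use \<nu> in simp)
      have krN: "N.kr {..<M n} (p n) (b n)" for n
        by (rule T.kr_tower) (use \<nu> T.uniform_if_invariant[OF \<nu>] in auto)
      show "\<nu> \<in> K"
      proof (rule mem_dynamical_simplexI[OF X assms(2,3) \<nu>(1)])
        fix U V assume UV: "clopenin X U" "clopenin X V" and eq: "\<forall>\<mu>\<in>K. measure \<mu> U = measure \<mu> V"
        have "(U, V) \<in> range f" using f UV by simp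
        then obtain n where "(U, V) = f n" by blast
        then have fn: "fst (f n) = U" "snd (f n) = V" by (metis fst_conv, metis snd_conv)
        note sn = seq[rule_format, of n, unfolded fn]
        have dec: "b (Suc n) t i \<subseteq> U \<or> b (Suc n) t i \<inter> U = {}" "b (Suc n) t i \<subseteq> V \<or> b (Suc n) t i \<inter> V = {}"
          if "t < M (Suc n)" "i < p (Suc n)" for t i
          using sn that by blast+
        have count: "card {i. i < p (Suc n) \<and> b (Suc n) t i \<subseteq> U} = card {i. i < p (Suc n) \<and> b (Suc n) t i \<subseteq> V}"
          if "t < M (Suc n)" for t
          using sn eq that by blast
        have "measure \<nu> U = (\<Sum>t<M (Suc n). real (card {i. i < p (Suc n) \<and> b (Suc n) t i \<subseteq> U}) * measure \<nu> (b (Suc n) t 0))"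
          by (rule N.kr_count[OF krN]) (use UV dec in auto)
        also have "\<dots> = (\<Sum>t<M (Suc n). real (card {i. i < p (Suc n) \<and> b (Suc n) t i \<subseteq> V}) * measure \<nu> (b (Suc n) t 0))"
          using count by (intro sum.cong) auto
        also have "\<dots> = measure \<nu> V"
          by (rule N.kr_count[symmetric, OF krN]) (use UV dec in auto)
        finally show "measure \<nu> U = measure \<nu> V" .
      qed
    qed
  qed
  then show ?thesis using T.homeo_\<phi> T.conjugate_to_toeplitz by blast
qed

end
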